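(* Let $G$ be a countable amenable group, let $\mathcal{A}$ be a finite alphabet, and let $X \subset \mathcal{A}^G$ be a $G$-subshift. Let $\phi : X \to \mathbb{R}$ be a potential with summable variation ($\phi \in SV(X)$), let $\mu_\phi$ be an equilibrium state for $\phi$, let $F \subset G$ be finite, and let $v, w \in L_F(X)$. If $E_X(v) \subset E_X(w)$, then $$\mu_\phi([v]) \leq \mu_\phi([w]) \cdot \sup_{x \in [v]} \exp\left( \sum_{g \in G} \big( \phi(\sigma_g(x)) - \phi(\sigma_g(\xi_{v,w}(x))) \big) \right).$$
   Context: $\mathcal{A}$ is a finite set with the discrete topology and $\mathcal{A}^G$ has the product topology. For $g \in G$ and $x \in \mathcal{A}^G$, $\sigma_g(x)_h = x_{gh}$ for all $h\in G$. A $G$-subshift is a closed set $X \subset \mathcal{A}^G$ with $\sigma_g(X) \subset X$ for all $g \in G$. For $H \subset G$, $x_H$ is the restriction of $x$ to $H$, and $F^c = G \setminus F$. For finite $F \subset G$, $L_F(X) = \{x_F : x \in X\}$. For $w \in L_F(X)$, $[w] = \{x \in X : x_F = w\}$ and the extender set is $E_X(w) = \{\eta \in \mathcal{A}^{F^c} : w\eta \in X\}$, where $w\eta \in \mathcal{A}^G$ is the concatenation (equal to $w$ on $F$ and $\eta$ on $F^c$). The map $\xi_{v,w} : X \to X$ for $v,w \in L_F(X)$: if $x \in [v]$, then $\xi_{v,w}(x) = w x_{F^c}$ if $w x_{F^c} \in X$, and $\xi_{v,w}(x) = x$ otherwise; if $x \in [w]$, then $\xi_{v,w}(x) = v x_{F^c}$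 if $v x_{F^c} \in X$, and $\xi_{v,w}(x)=x$ otherwise; if $x \notin [v] \cup [w]$, $\xi_{v,w}(x) = x$. A potential is a continuous function $\phi : X \to \mathbb{R}$. For $E \subset G$, $Var_E(\phi) = \sup\{\phi(x) - \phi(y) : x,y \in X,\ x_E = y_E\}$. An exhaustive sequence is a sequence of finite sets $E_1 \subset E_2 \subset \cdots$ with $\bigcup_n E_n = G$. A potential $\phi$ has summable variation, written $\phi \in SV(X)$, if there is an exhaustive sequence $\{E_n\}$ with $\sum_{n \in \mathbb{N}} |E_{n+1}^{-1} \setminus E_n^{-1}| \cdot Var_{E_n}(\phi) < \infty$. (For such $\phi$ the sum over $G$ in the claim converges absolutely.) $\mathcal{M}_\sigma(X)$ is the set of Borel probability measures on $X$ invariant under all $\sigma_g$. For $\mu \in \mathcal{M}_\sigma(X)$, $h(\mu)$ is its Kolmogorov–Sinai entropy with respect to the $G$-action. An equilibrium state for $\phi$ is a $\mu \in \mathcal{M}_\sigma(X)$ maximizing $h(\mu) + \int \phi \, d\mu$ over $\mathcal{M}_\sigma(X)$. *)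

theory Defs
  imports "HOL-Probability.Probability"
begin

text \<open>
  The group is a type of class \<open>{group_add, countable}\<close>. This class is not commutative; the
  product $gh$ is written \<open>g + h\<close> and the inverse of $g$ is \<open>- g\<close>. The alphabet is a type of
  class \<open>{finite, discrete_topology}\<close>, so that the topology and the Borel sets of the
  function type \<open>'g \<Rightarrow> 'a\<close> are those of the product of discrete spaces.
\<close>

subsection \<open>Amenability\<close>

text \<open>
  The sets are asymptotically invariant under right translation. Inverting them exchanges this
  with left translation, so amenability does not depend on the side. The entropy does: for the
  shift action below, invariant measures satisfy $H(P^{kF}) = H(P^F)$, and this is the side on which
  the averages $H(P^{F_n}) / |F_n|$ converge.
\<close>

definition folner_seq :: "(nat \<Rightarrow> 'g::group_add set) \<Rightarrow> bool" where
  "folner_seq \<Phi> \<longleftrightarrow> (\<forall>n. finite (\<Phi> n) \<and> \<Phi> n \<noteq> {}) \<and>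
     (\<forall>g. (\<lambda>n. real (card (sym_diff ((\<lambda>h. h + g) ` \<Phi> n) (\<Phi> n))) / real (card (\<Phi> n)))
            \<longlonglongrightarrow> 0)"

definition amenable :: "'g::group_add itself \<Rightarrow> bool" where
  "amenable _ \<longleftrightarrow> (\<exists>\<Phi> :: nat \<Rightarrow> 'g set. folner_seq \<Phi>)"

subsection \<open>Subshifts\<close>

definition lshift :: "'g::group_add \<Rightarrow> ('g \<Rightarrow> 'a) \<Rightarrow> 'g \<Rightarrow> 'a" where
  "lshift g x = (\<lambda>h. x (g + h))"

definition subshift :: "('g::group_add \<Rightarrow> 'a::{finite, discrete_topology}) set \<Rightarrow> bool" where
  "subshift X \<longleftrightarrow> closed X \<and> (\<forall>g. lshift g ` X \<subseteq> X)"

text \<open>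
  A pattern on \<open>F\<close> is a function that is \<open>undefined\<close> outside \<open>F\<close>.
\<close>

definition language :: "'g set \<Rightarrow> ('g \<Rightarrow> 'a) set \<Rightarrow> ('g \<Rightarrow> 'a) set" where
  "language F X = (\<lambda>x. restrict x F) ` X"

definition cylinder :: "('g \<Rightarrow> 'a) set \<Rightarrow> 'g set \<Rightarrow> ('g \<Rightarrow> 'a) \<Rightarrow> ('g \<Rightarrow> 'a) set" where
  "cylinder X F w = {x \<in> X. restrict x F = w}"

definition glue :: "'g set \<Rightarrow> ('g \<Rightarrow> 'a) \<Rightarrow> ('g \<Rightarrow> 'a) \<Rightarrow> 'g \<Rightarrow> 'a" where
  "glue F w \<eta> = (\<lambda>g. if g \<in> F then w g else \<eta> g)"

definition extender_set :: "('g \<Rightarrow> 'a) set \<Rightarrow> 'g set \<Rightarrow> ('g \<Rightarrow> 'a) \<Rightarrow> ('g \<Rightarrow> 'a) set" where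
  "extender_set X F w = {\<eta> \<in> (- F) \<rightarrow>\<^sub>E UNIV. glue F w \<eta> \<in> X}"

definition pattern_swap :: "('g \<Rightarrow> 'a) set \<Rightarrow> 'g set \<Rightarrow> ('g \<Rightarrow> 'a) \<Rightarrow> ('g \<Rightarrow> 'a) \<Rightarrow> ('g \<Rightarrow> 'a) \<Rightarrow> 'g \<Rightarrow> 'a"
  where
  "pattern_swap X F v w x =
     (if x \<in> cylinder X F v then
        (if glue F w (restrict x (- F)) \<in> X then glue F w (restrict x (- F)) else x)
      else if x \<in> cylinder X F w then
        (if glue F v (restrict x (- F)) \<in> X then glue F v (restrict x (- F)) else x)
      else x)"

subsection \<open>Potentials with summable variation\<close>

text \<open>
  Potentials are total functions of which only the values on \<open>X\<close> matter. If \<open>X\<close> is nonempty and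
  \<open>\<phi>\<close> is continuous on \<open>X\<close>, the supremum is over a nonempty set that is bounded by compactness.
\<close>

definition variation :: "('g \<Rightarrow> 'a) set \<Rightarrow> (('g \<Rightarrow> 'a) \<Rightarrow> real) \<Rightarrow> 'g set \<Rightarrow> real" where
  "variation X \<phi> E = Sup {\<phi> x - \<phi> y |x y. x \<in> X \<and> y \<in> X \<and> restrict x E = restrict y E}"

definition exhaustive :: "(nat \<Rightarrow> 'g set) \<Rightarrow> bool" where
  "exhaustive E \<longleftrightarrow> (\<forall>n. finite (E n)) \<and> incseq E \<and> (\<Union>n. E n) = UNIV"

definition summable_variation ::
  "('g::group_add \<Rightarrow> 'a::{finite, discrete_topology}) set \<Rightarrow> (('g \<Rightarrow> 'a) \<Rightarrow> real) set" where
  "summable_variation X = {\<phi>. continuous_on X \<phi> \<and>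
     (\<exists>E. exhaustive E \<and>
        summable (\<lambda>n. real (card (uminus ` E (Suc n) - uminus ` E n)) * variation X \<phi> (E n)))}"

subsection \<open>Entropy and equilibrium states\<close>

definition invariant_measures ::
  "('g::group_add \<Rightarrow> 'a::{finite, discrete_topology}) set \<Rightarrow> ('g \<Rightarrow> 'a) measure set" where
  "invariant_measures X = {\<mu>. sets \<mu> = sets (restrict_space borel X) \<and> prob_space \<mu> \<and>
     (\<forall>g. distr \<mu> \<mu> (lshift g) = \<mu>)}"

definition finite_partition :: "'b measure \<Rightarrow> 'b set set \<Rightarrow> bool" where
  "finite_partition \<mu> P \<longleftrightarrow> finite P \<and> P \<subseteq> sets \<mu> \<and> partition_on (space \<mu>) P"

definition partition_entropy :: "'b measure \<Rightarrow> 'b set set \<Rightarrow> real" where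
  "partition_entropy \<mu> P = - (\<Sum>A\<in>P. measure \<mu> A * ln (measure \<mu> A))"

text \<open>
  $P^F = \bigvee_{g \in F} \sigma_g^{-1} P$
\<close>

definition shift_join ::
  "('g::group_add \<Rightarrow> 'a) measure \<Rightarrow> ('g \<Rightarrow> 'a) set set \<Rightarrow> 'g set \<Rightarrow> ('g \<Rightarrow> 'a) set set" where
  "shift_join \<mu> P F = {{x \<in> space \<mu>. \<forall>g\<in>F. lshift g x \<in> f g} |f. f \<in> F \<rightarrow>\<^sub>E P} - {{}}"

text \<open>
  The limit exists and is the same along all Folner sequences (Ornstein and Weiss).
\<close>

definition entropy_wrt :: "('g::group_add \<Rightarrow> 'a) measure \<Rightarrow> ('g \<Rightarrow> 'a) set set \<Rightarrow> real" where
  "entropy_wrt \<mu> P = (THE l. \<forall>\<Phi>. folner_seq \<Phi> \<longrightarrow>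
     (\<lambda>n. partition_entropy \<mu> (shift_join \<mu> P (\<Phi> n)) / real (card (\<Phi> n))) \<longlonglongrightarrow> l)"

definition ks_entropy :: "('g::group_add \<Rightarrow> 'a) measure \<Rightarrow> ereal" where
  "ks_entropy \<mu> = (SUP P\<in>{P. finite_partition \<mu> P}. ereal (entropy_wrt \<mu> P))"

definition equilibrium_state ::
  "('g::group_add \<Rightarrow> 'a::{finite, discrete_topology}) set \<Rightarrow> (('g \<Rightarrow> 'a) \<Rightarrow> real)
     \<Rightarrow> ('g \<Rightarrow> 'a) measure \<Rightarrow> bool" where
  "equilibrium_state X \<phi> \<mu> \<longleftrightarrow> \<mu> \<in> invariant_measures X \<and>
     (\<forall>\<nu>\<in>invariant_measures X.
        ks_entropy \<nu> + ereal (integral\<^sup>L \<nu> \<phi>) \<le> ks_entropy \<mu> + ereal (integral\<^sup>L \<mu> \<phi>))"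

end

theory Submission
  imports Defs
begin

text \<open>
  Suppose that $\mu([v]) > \mu([w]) S$, where $S$ is the supremum on the right-hand side. For a Folner
  set $\Phi$ choose well-separated sites $g$ in its interior, in number proportional to $|\Phi|$, and
  independently at each of them replace an occurrence of $v$ by $w$ with a small probability. One
  replacement costs at most about $\ln S$ of the energy $\sum_{h \in \Phi} \phi \circ \sigma_h$, but
  its contribution to the entropy on $\Phi$ exceeds this since $v$ is more than $S$ times as frequent
  as $w$. Averaging the new measure over the shifts in $\Phi$ and passing to a cluster point along a
  Folner sequence gives an invariant measure whose pressure exceeds that of $\mu$. Entropy does not
  drop in the limit because Shearer's inequality bounds the entropy on $\Phi$ by the average entropy
  on the translates of a fixed finite set; the same inequality shows that the entropy along Folner
  sequences is an infimum over finite sets.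
\<close>

subsection \<open>Entropy of finite random variables\<close>

text \<open>An equilibrium state is compared only with invariant measures, while a replacement acts
  on one finite window. The gain must therefore be a fixed multiple of \<open>card \<Phi>\<close>,
  which dictates the choice of sites. Disjoint windows \<open>g + F\<close> keep the probabilities
  \<open>p\<close> of \<open>v\<close> and \<open>q\<close> of \<open>w\<close> unchanged at
  untreated sites, so every replacement gains equally. Sites deep in \<Phi> see a partial sum of the
  series of the theorem with uniformly small error \<kappa>. The inclusion of extender sets makes
  the replacement a map of \<open>X\<close> into itself that is injective on the configurations
  showing \<open>v\<close>. Each pattern on \<Phi> with \<open>v\<close> at \<open>g\<close> thus
  hands a fraction \<open>e\<close> of its mass to a target of its own. The constants: \<tau>
  satisfies \<open>S < \<tau>\<close> and \<open>\<tau> * q < p\<close>, and \<open>e\<close> solves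
  \<open>\<tau> * (q + e * p) = (1 - e) * p\<close>, so that even after the replacement
  \<open>v\<close> is still \<tau> times as frequent as \<open>w\<close>. The entropy gain per site
  is then at least \<open>e * p * ln \<tau>\<close>, against an energy loss of at most
  \<open>e * p * (ln S + \<kappa>)\<close>. No expansion in small \<open>e\<close> is
  needed.\<close>

definition eta :: "real \<Rightarrow> real" where
  "eta t = - (t * ln t)"

lemma eta_0 [simp]: "eta 0 = 0"
  by (simp add: eta_def)

text \<open>Concavity of \<open>eta\<close>: the right-hand side is its tangent at \<open>m\<close>.
  Submodularity, Jensen's inequality and the gain of a swap come from different choices of
  \<open>m\<close>.\<close>

lemma eta_le_tangent:
  assumes "0 \<le> t" "0 < m"
  shows "eta t \<le> m - t - t * ln m"
proof (cases "t = 0")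
  case False
  then have "t > 0" using assms by simp
  have "ln (m / t) \<le> m / t - 1"
    using \<open>t > 0\<close> assms by (intro ln_le_minus_one) auto
  then have "t * (ln m - ln t) \<le> t * (m / t - 1)"
    using \<open>t > 0\<close> assms by (intro mult_left_mono) (auto simp: ln_div)
  also have "\<dots> = m - t" using \<open>t > 0\<close> by (simp add: field_simps)
  finally show ?thesis by (simp add: eta_def algebra_simps)
qed (use assms in auto)

text \<open>Here monotonicity of \<open>ln\<close> suffices. The inequality expresses that merging
  atoms lowers entropy.\<close>

lemma eta_add_le:
  assumes "0 \<le> a" "0 \<le> b"
  shows "eta (a + b) \<le> eta a + eta b"
proof -
  have "x * ln x \<le> x * ln (x + y)" if "0 \<le> x" "0 \<le> y" for x y :: real
    using that by (cases "x = 0") (auto intro!: mult_left_mono)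
  from this[of a b] this[of b a] show ?thesis
    using assms by (simp add: eta_def algebra_simps)
qed

lemma eta_sum_le:
  assumes "\<And>i. i \<in> I \<Longrightarrow> 0 \<le> a i"
  shows "eta (\<Sum>i\<in>I. a i) \<le> (\<Sum>i\<in>I. eta (a i))"
  using assms
proof (induction I rule: infinite_finite_induct)
  case (insert i I)
  have "eta (a i + sum a I) \<le> eta (a i) + eta (sum a I)"
    using insert by (intro eta_add_le sum_nonneg) auto
  then show ?case using insert by auto
qed auto

text \<open>Nonnegativity of mutual information for a matrix of arbitrary total mass; the term
  \<open>eta\<close> of the total corrects for the missing normalisation. Slices of a joint
  distribution at a fixed value of a third variable have exactly this form.\<close>

lemma eta_matrix_submodular:
  assumes "finite I" "finite J" and nn: "\<And>i j. i \<in> I \<Longrightarrow> j \<in> J \<Longrightarrow> 0 \<le> a i j"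
  shows "(\<Sum>i\<in>I. \<Sum>j\<in>J. eta (a i j)) + eta (\<Sum>i\<in>I. \<Sum>j\<in>J. a i j)
    \<le> (\<Sum>i\<in>I. eta (\<Sum>j\<in>J. a i j)) + (\<Sum>j\<in>J. eta (\<Sum>i\<in>I. a i j))"
proof -
  define r where "r i = (\<Sum>j\<in>J. a i j)" for i
  define c where "c j = (\<Sum>i\<in>I. a i j)" for j
  define s where "s = (\<Sum>i\<in>I. r i)"
  have sc: "s = (\<Sum>j\<in>J. c j)"
    unfolding s_def r_def c_def by (rule sum.swap)
  have r0: "0 \<le> r i" if "i \<in> I" for i using nn that by (auto simp: r_def intro: sum_nonneg)
  have c0: "0 \<le> c j" if "j \<in> J" for j using nn that by (auto simp: c_def intro: sum_nonneg)
  have s0: "0 \<le> s" using r0 by (auto simp: s_def intro: sum_nonneg)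
  have ar: "a i j \<le> r i" if "i \<in> I" "j \<in> J" for i j
    unfolding r_def using assms that by (intro member_le_sum) auto
  have ac: "a i j \<le> c j" if "i \<in> I" "j \<in> J" for i j
    unfolding c_def using assms that by (intro member_le_sum[of i I "\<lambda>i. a i j"]) auto
  have rs: "r i \<le> s" if "i \<in> I" for i
    unfolding s_def using assms that r0 by (intro member_le_sum) auto
  \<comment> \<open>The tangent is taken at the product of the marginals, the value of
    \<open>a i j\<close> under independence. A zero entry is separate because the marginals may then
    vanish as well.\<close>
  have key: "eta (a i j) \<le> r i * c j / s - a i j - a i j * (ln (r i) + ln (c j) - ln s)"
    if "i \<in> I" "j \<in> J" for i j
  proof (cases "a i j = 0")
    case True
    then show ?thesis using r0 c0 s0 that by simp
  next
    case False
    then have "0 < a i j" using nn[OF that] by simp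
    then have pos: "0 < r i" "0 < c j" "0 < s" using ar[OF that] ac[OF that] rs[OF that(1)] by linarith+
    then have "ln (r i * c j / s) = ln (r i) + ln (c j) - ln s" by (simp add: ln_div ln_mult)
    with eta_le_tangent[of "a i j" "r i * c j / s"] pos \<open>0 < a i j\<close> show ?thesis by simp
  qed
  have "(\<Sum>i\<in>I. \<Sum>j\<in>J. eta (a i j))
      \<le> (\<Sum>i\<in>I. \<Sum>j\<in>J. r i * c j / s - a i j - a i j * (ln (r i) + ln (c j) - ln s))"
    by (intro sum_mono key)
  also have "\<dots> = (\<Sum>i\<in>I. \<Sum>j\<in>J. r i * c j / s) - (\<Sum>i\<in>I. \<Sum>j\<in>J. a i j)
      - (\<Sum>i\<in>I. \<Sum>j\<in>J. a i j * ln (r i)) - (\<Sum>i\<in>I. \<Sum>j\<in>J. a i j * ln (c j))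
      + (\<Sum>i\<in>I. \<Sum>j\<in>J. a i j) * ln s"
    by (simp only: right_diff_distrib distrib_left sum_subtractf sum.distrib sum_distrib_right)
  also have "(\<Sum>i\<in>I. \<Sum>j\<in>J. a i j) = s" by (simp add: s_def r_def)
  also have "(\<Sum>i\<in>I. \<Sum>j\<in>J. r i * c j / s) = s * s / s"
  proof -
    have "(\<Sum>i\<in>I. \<Sum>j\<in>J. r i * c j / s) = (\<Sum>i\<in>I. r i) * (\<Sum>j\<in>J. c j) / s"
      by (simp only: sum_product sum_divide_distrib)
    then show ?thesis using sc s_def by metis
  qed
  also have "s * s / s = s" by simp
  also have "(\<Sum>i\<in>I. \<Sum>j\<in>J. a i j * ln (r i)) = - (\<Sum>i\<in>I. eta (r i))"
    by (simp add: eta_def r_def sum_distrib_right sum_negf)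
  also have "(\<Sum>i\<in>I. \<Sum>j\<in>J. a i j * ln (c j)) = - (\<Sum>j\<in>J. eta (c j))"
    by (subst sum.swap) (simp add: eta_def c_def sum_distrib_right sum_negf)
  finally show ?thesis
    by (simp add: r_def[symmetric] c_def[symmetric] s_def[symmetric] eta_def)
qed

text \<open>Jensen's inequality, from the tangent at the mean. If the mean is 0, every term with
  positive weight vanishes.\<close>

lemma eta_concave:
  assumes "finite I" and w: "\<And>i. i \<in> I \<Longrightarrow> 0 \<le> w i" "(\<Sum>i\<in>I. w i) = 1"
    and t: "\<And>i. i \<in> I \<Longrightarrow> 0 \<le> t i"
  shows "(\<Sum>i\<in>I. w i * eta (t i)) \<le> eta (\<Sum>i\<in>I. w i * t i)"
proof -
  define m where "m = (\<Sum>i\<in>I. w i * t i)"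
  have "0 \<le> m" unfolding m_def using w t by (intro sum_nonneg) auto
  show ?thesis
  proof (cases "m = 0")
    case True
    then have "w i * t i = 0" if "i \<in> I" for i
      using that w t \<open>finite I\<close> by (auto simp: m_def sum_nonneg_eq_0_iff)
    then have "w i * eta (t i) = 0" if "i \<in> I" for i
      using that by (auto simp: eta_def)
    then have "(\<Sum>i\<in>I. w i * eta (t i)) = 0"
      by (rule sum.neutral[OF ballI])
    then show ?thesis using True by (simp add: m_def)
  next
    case False
    with \<open>0 \<le> m\<close> have "0 < m" by simp
    have "(\<Sum>i\<in>I. w i * eta (t i)) \<le> (\<Sum>i\<in>I. w i * (m - t i - t i * ln m))"
      using w t \<open>0 < m\<close> by (intro sum_mono mult_left_mono eta_le_tangent) auto
    also have "\<dots> = (\<Sum>i\<in>I. w i) * m - (\<Sum>i\<in>I. w i * t i) - (\<Sum>i\<in>I. w i * t i) * ln m"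
      by (simp only: right_diff_distrib sum_subtractf sum_distrib_right mult.assoc)
    also have "\<dots> = (\<Sum>i\<in>I. w i) * m - m - m * ln m"
      by (simp only: m_def)
    also have "\<dots> = eta m" using w by (simp add: eta_def)
    finally show ?thesis by (simp add: m_def)
  qed
qed

lemma tendsto_eta_0: "(eta \<longlongrightarrow> 0) (at_right 0)"
  unfolding eta_def by real_asymp

text \<open>The point 0 matters, since probabilities of patterns may vanish in a limit of
  measures.\<close>

lemma continuous_on_eta: "continuous_on {0..} eta"
proof (clarsimp simp: continuous_on_eq_continuous_within)
  fix x :: real assume "0 \<le> x"
  show "continuous (at x within {0..}) eta"
  proof (cases "x = 0")
    case True
    have "at (0::real) within {0..} = at_right 0"
    proof -
      have "{0..} - {0::real} = {0<..}" by auto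
      then show ?thesis by (simp add: at_within_def)
    qed
    then show ?thesis using True tendsto_eta_0 by (simp add: continuous_within)
  next
    case False
    then have "isCont (\<lambda>t. - (t * ln t)) x"
      using \<open>0 \<le> x\<close> by (intro continuous_minus continuous_mult continuous_ident isCont_ln) auto
    then have "isCont eta x" by (simp add: eta_def[abs_def])
    then show ?thesis by (rule continuous_at_imp_continuous_at_within)
  qed
qed

lemma tendsto_eta:
  assumes "(f \<longlongrightarrow> l) F" "\<And>x. 0 \<le> f x" "0 \<le> l"
  shows "((\<lambda>x. eta (f x)) \<longlongrightarrow> eta l) F"
  using continuous_on_tendsto_compose[OF continuous_on_eta assms(1)] assms by auto

section \<open>Shannon entropy of random variables with finitely many values\<close>

definition rv_entropy :: "'x measure \<Rightarrow> ('x \<Rightarrow> 'v) \<Rightarrow> real" where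
  "rv_entropy M f = (\<Sum>v\<in>f ` space M. eta (measure M {x \<in> space M. f x = v}))"

lemma rv_entropy_eq:
  assumes "finite V" "f ` space M \<subseteq> V"
  shows "rv_entropy M f = (\<Sum>v\<in>V. eta (measure M {x \<in> space M. f x = v}))"
  unfolding rv_entropy_def
proof (rule sum.mono_neutral_left[OF assms])
  have "{x \<in> space M. f x = v} = {}" if "v \<in> V - f ` space M" for v
    using that by auto
  then show "\<forall>v\<in>V - f ` space M. eta (measure M {x \<in> space M. f x = v}) = 0"
    by (metis measure_empty eta_0)
qed

lemma simple_function_fibre:
  assumes "simple_function M f"
  shows "{x \<in> space M. f x = v} \<in> sets M"
proof -
  have "{x \<in> space M. f x = v} = f -` {v} \<inter> space M" by auto
  then show ?thesis using simple_functionD(2)[OF assms, of "{v}"] by simp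
qed

context prob_space
begin

lemma prob_fibre_sum:
  assumes "simple_function M f" "simple_function M g" "finite W" "g ` space M \<subseteq> W"
  shows "prob {x \<in> space M. f x = v} = (\<Sum>w\<in>W. prob {x \<in> space M. f x = v \<and> g x = w})"
proof -
  have "{x \<in> space M. f x = v} = (\<Union>w\<in>W. {x \<in> space M. f x = v \<and> g x = w})"
    using assms(4) by auto
  moreover have "{x \<in> space M. f x = v \<and> g x = w} \<in> sets M" for w
  proof -
    have "{x \<in> space M. f x = v \<and> g x = w} = {x \<in> space M. f x = v} \<inter> {x \<in> space M. g x = w}"
      by auto
    also have "\<dots> \<in> sets M" using assms by (intro sets.Int simple_function_fibre)
    finally show ?thesis .
  qed
  moreover have "disjoint_family_on (\<lambda>w. {x \<in> space M. f x = v \<and> g x = w}) W"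
    by (auto simp: disjoint_family_on_def)
  ultimately show ?thesis
    using finite_measure_finite_Union[OF \<open>finite W\<close>, of "\<lambda>w. {x \<in> space M. f x = v \<and> g x = w}"]
    by (metis (no_types, lifting) image_subset_iff)
qed

text \<open>The hypothesis \<open>det\<close> makes \<open>f\<close> a function of \<open>g\<close>,
  so the fibres of \<open>g\<close> refine those of \<open>f\<close>, and subadditivity of
  \<open>eta\<close> compares the two sums.\<close>

lemma rv_entropy_mono:
  assumes g: "simple_function M g" and f: "simple_function M f"
    and det: "\<And>x y. x \<in> space M \<Longrightarrow> y \<in> space M \<Longrightarrow> g x = g y \<Longrightarrow> f x = f y"
  shows "rv_entropy M f \<le> rv_entropy M g"
proof -
  define V where "V = f ` space M"
  define W where "W = g ` space M"
  have fin: "finite V" "finite W"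
    using f g by (auto simp: V_def W_def simple_functionD)
  \<comment> \<open>On one fibre of \<open>g\<close> the function \<open>f\<close> is constant, so a
    single \<open>v\<close> contributes.\<close>
  have *: "(\<Sum>v\<in>V. eta (prob {x \<in> space M. f x = v \<and> g x = w})) = eta (prob {x \<in> space M. g x = w})"
    if w: "w \<in> W" for w
  proof -
    obtain y where y: "y \<in> space M" "w = g y" using w unfolding W_def by blast
    have same: "{x \<in> space M. f x = f y \<and> g x = w} = {x \<in> space M. g x = w}"
      using y det by blast
    have other: "eta (prob {x \<in> space M. f x = v \<and> g x = w}) = 0" if "v \<noteq> f y" for v
    proof -
      have "{x \<in> space M. f x = v \<and> g x = w} = {}"
        using y det that by blast
      then show ?thesis by (metis measure_empty eta_0)
    qed
    have "(\<Sum>v\<in>V. eta (prob {x \<in> space M. f x = v \<and> g x = w}))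
        = (\<Sum>v\<in>V. if v = f y then eta (prob {x \<in> space M. g x = w}) else 0)"
    proof (rule sum.cong[OF refl])
      fix v show "eta (prob {x \<in> space M. f x = v \<and> g x = w})
          = (if v = f y then eta (prob {x \<in> space M. g x = w}) else 0)"
        using other[of v] by (cases "v = f y") (simp_all only: same if_True if_False simp_thms)
    qed
    then show ?thesis using fin y by (simp add: V_def)
  qed
  have "rv_entropy M f = (\<Sum>v\<in>V. eta (\<Sum>w\<in>W. prob {x \<in> space M. f x = v \<and> g x = w}))"
    unfolding rv_entropy_def V_def[symmetric] using fin f g
    by (intro sum.cong arg_cong[of _ _ eta] prob_fibre_sum) (auto simp: W_def)
  also have "\<dots> \<le> (\<Sum>v\<in>V. \<Sum>w\<in>W. eta (prob {x \<in> space M. f x = v \<and> g x = w}))"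
    by (intro sum_mono eta_sum_le) auto
  also have "\<dots> = (\<Sum>w\<in>W. \<Sum>v\<in>V. eta (prob {x \<in> space M. f x = v \<and> g x = w}))"
    by (rule sum.swap)
  also have "\<dots> = rv_entropy M g"
    unfolding rv_entropy_def W_def[symmetric] using * by (intro sum.cong) auto
  finally show ?thesis .
qed

lemma rv_entropy_cong:
  assumes "simple_function M g" "simple_function M f"
    and "\<And>x y. x \<in> space M \<Longrightarrow> y \<in> space M \<Longrightarrow> f x = f y \<longleftrightarrow> g x = g y"
  shows "rv_entropy M f = rv_entropy M g"
  using assms by (intro antisym rv_entropy_mono) blast+

text \<open>Nonnegativity of the conditional mutual information of \<open>f\<close> and
  \<open>g\<close> given \<open>k\<close>. For each value \<open>c\<close> of \<open>k\<close> the
  matrix inequality is applied to \<open>p a b c\<close>, whose total mass is the probability of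
  \<open>k = c\<close>; the facts \<open>e1\<close> to \<open>e4\<close> write the four entropies as
  sums over \<open>c\<close>.\<close>

lemma rv_entropy_submodular:
  assumes f: "simple_function M f" and g: "simple_function M g" and k: "simple_function M k"
  shows "rv_entropy M (\<lambda>x. (f x, g x, k x)) + rv_entropy M k
    \<le> rv_entropy M (\<lambda>x. (f x, k x)) + rv_entropy M (\<lambda>x. (g x, k x))"
proof -
  define A where "A = f ` space M"
  define B where "B = g ` space M"
  define C where "C = k ` space M"
  have fin: "finite A" "finite B" "finite C"
    using f g k by (auto simp: A_def B_def C_def simple_functionD)
  define p where "p a b c = prob {x \<in> space M. f x = a \<and> g x = b \<and> k x = c}" for a b c
  have fgk: "simple_function M (\<lambda>x. (f x, g x))" "simple_function M (\<lambda>x. (f x, k x))"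
    "simple_function M (\<lambda>x. (g x, k x))" "simple_function M (\<lambda>x. (f x, g x, k x))"
    by (intro simple_function_Pair f g k)+
  have e1: "rv_entropy M (\<lambda>x. (f x, g x, k x)) = (\<Sum>c\<in>C. \<Sum>a\<in>A. \<Sum>b\<in>B. eta (p a b c))"
  proof -
    have "rv_entropy M (\<lambda>x. (f x, g x, k x)) = (\<Sum>(a,b,c)\<in>A \<times> B \<times> C. eta (p a b c))"
    proof -
      have "(\<lambda>x. (f x, g x, k x)) ` space M \<subseteq> A \<times> B \<times> C" by (auto simp: A_def B_def C_def)
      with fin have "rv_entropy M (\<lambda>x. (f x, g x, k x))
          = (\<Sum>w\<in>A \<times> B \<times> C. eta (prob {x \<in> space M. (f x, g x, k x) = w}))"
        by (intro rv_entropy_eq) auto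
      also have "\<dots> = (\<Sum>(a,b,c)\<in>A \<times> B \<times> C. eta (p a b c))"
        by (intro sum.cong refl) (auto simp: p_def)
      finally show ?thesis .
    qed
    also have "\<dots> = (\<Sum>a\<in>A. \<Sum>b\<in>B. \<Sum>c\<in>C. eta (p a b c))"
      by (simp add: sum.cartesian_product)
    also have "\<dots> = (\<Sum>a\<in>A. \<Sum>c\<in>C. \<Sum>b\<in>B. eta (p a b c))"
      by (intro sum.cong refl sum.swap)
    also have "\<dots> = (\<Sum>c\<in>C. \<Sum>a\<in>A. \<Sum>b\<in>B. eta (p a b c))"
      by (rule sum.swap)
    finally show ?thesis .
  qed
  have e2: "rv_entropy M (\<lambda>x. (f x, k x)) = (\<Sum>c\<in>C. \<Sum>a\<in>A. eta (\<Sum>b\<in>B. p a b c))"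
  proof -
    have "rv_entropy M (\<lambda>x. (f x, k x)) = (\<Sum>(a,c)\<in>A \<times> C. eta (\<Sum>b\<in>B. p a b c))"
    proof -
      have "(\<lambda>x. (f x, k x)) ` space M \<subseteq> A \<times> C" by (auto simp: A_def C_def)
      with fin have "rv_entropy M (\<lambda>x. (f x, k x)) = (\<Sum>w\<in>A \<times> C. eta (prob {x \<in> space M. (f x, k x) = w}))"
        by (intro rv_entropy_eq) auto
      also have "\<dots> = (\<Sum>w\<in>A \<times> C. eta (\<Sum>b\<in>B. prob {x \<in> space M. (f x, k x) = w \<and> g x = b}))"
        using fin g fgk by (intro sum.cong refl arg_cong[of _ _ eta] prob_fibre_sum) (auto simp: B_def)
      also have "\<dots> = (\<Sum>(a,c)\<in>A \<times> C. eta (\<Sum>b\<in>B. p a b c))"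
        by (intro sum.cong refl) (auto simp: p_def intro!: arg_cong[of _ _ eta] sum.cong arg_cong[of _ _ prob])
      finally show ?thesis .
    qed
    also have "\<dots> = (\<Sum>a\<in>A. \<Sum>c\<in>C. eta (\<Sum>b\<in>B. p a b c))"
      by (simp add: sum.cartesian_product)
    also have "\<dots> = (\<Sum>c\<in>C. \<Sum>a\<in>A. eta (\<Sum>b\<in>B. p a b c))"
      by (rule sum.swap)
    finally show ?thesis .
  qed
  have e3: "rv_entropy M (\<lambda>x. (g x, k x)) = (\<Sum>c\<in>C. \<Sum>b\<in>B. eta (\<Sum>a\<in>A. p a b c))"
  proof -
    have "rv_entropy M (\<lambda>x. (g x, k x)) = (\<Sum>(b,c)\<in>B \<times> C. eta (\<Sum>a\<in>A. p a b c))"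
    proof -
      have "(\<lambda>x. (g x, k x)) ` space M \<subseteq> B \<times> C" by (auto simp: B_def C_def)
      with fin have "rv_entropy M (\<lambda>x. (g x, k x)) = (\<Sum>w\<in>B \<times> C. eta (prob {x \<in> space M. (g x, k x) = w}))"
        by (intro rv_entropy_eq) auto
      also have "\<dots> = (\<Sum>w\<in>B \<times> C. eta (\<Sum>a\<in>A. prob {x \<in> space M. (g x, k x) = w \<and> f x = a}))"
        using fin f fgk by (intro sum.cong refl arg_cong[of _ _ eta] prob_fibre_sum) (auto simp: A_def)
      also have "\<dots> = (\<Sum>(b,c)\<in>B \<times> C. eta (\<Sum>a\<in>A. p a b c))"
        by (intro sum.cong refl) (auto simp: p_def intro!: arg_cong[of _ _ eta] sum.cong arg_cong[of _ _ prob])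
      finally show ?thesis .
    qed
    also have "\<dots> = (\<Sum>b\<in>B. \<Sum>c\<in>C. eta (\<Sum>a\<in>A. p a b c))"
      by (simp add: sum.cartesian_product)
    also have "\<dots> = (\<Sum>c\<in>C. \<Sum>b\<in>B. eta (\<Sum>a\<in>A. p a b c))"
      by (rule sum.swap)
    finally show ?thesis .
  qed
  have e4: "rv_entropy M k = (\<Sum>c\<in>C. eta (\<Sum>a\<in>A. \<Sum>b\<in>B. p a b c))"
  proof -
    have "prob {x \<in> space M. k x = c} = (\<Sum>(a,b)\<in>A \<times> B. p a b c)" for c
    proof -
      have "(\<lambda>x. (f x, g x)) ` space M \<subseteq> A \<times> B" by (auto simp: A_def B_def)
      with fin have "prob {x \<in> space M. k x = c} = (\<Sum>w\<in>A \<times> B. prob {x \<in> space M. k x = c \<and> (f x, g x) = w})"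
        by (intro prob_fibre_sum[OF k fgk(1)]) auto
      also have "\<dots> = (\<Sum>(a,b)\<in>A \<times> B. p a b c)"
        by (intro sum.cong refl) (auto simp: p_def intro!: arg_cong[of _ _ prob])
      finally show ?thesis .
    qed
    then show ?thesis
      by (simp add: rv_entropy_def C_def sum.cartesian_product)
  qed
  have "(\<Sum>c\<in>C. (\<Sum>a\<in>A. \<Sum>b\<in>B. eta (p a b c)) + eta (\<Sum>a\<in>A. \<Sum>b\<in>B. p a b c))
      \<le> (\<Sum>c\<in>C. (\<Sum>a\<in>A. eta (\<Sum>b\<in>B. p a b c)) + (\<Sum>b\<in>B. eta (\<Sum>a\<in>A. p a b c)))"
    using fin by (intro sum_mono eta_matrix_submodular) (auto simp: p_def)
  then show ?thesis by (simp add: e1 e2 e3 e4 sum.distrib)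
qed

end

subsection \<open>Joint entropy of a family\<close>

definition joint :: "('i \<Rightarrow> 'x \<Rightarrow> 'v) \<Rightarrow> 'i set \<Rightarrow> 'x \<Rightarrow> 'i \<Rightarrow> 'v" where
  "joint Y S x = restrict (\<lambda>i. Y i x) S"

abbreviation joint_entropy :: "'x measure \<Rightarrow> ('i \<Rightarrow> 'x \<Rightarrow> 'v) \<Rightarrow> 'i set \<Rightarrow> real" where
  "joint_entropy M Y S \<equiv> rv_entropy M (joint Y S)"

lemma joint_eq_iff: "joint Y S x = joint Y S y \<longleftrightarrow> (\<forall>i\<in>S. Y i x = Y i y)"
  by (auto simp: joint_def fun_eq_iff restrict_def)

lemma simple_function_joint:
  assumes "finite S" "\<And>i. i \<in> S \<Longrightarrow> simple_function M (Y i)"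
  shows "simple_function M (joint Y S)"
proof -
  have "joint Y S ` space M \<subseteq> PiE S (\<lambda>i. Y i ` space M)"
    by (auto simp: joint_def)
  moreover have "finite (PiE S (\<lambda>i. Y i ` space M))"
    using assms by (intro finite_PiE) (auto simp: simple_functionD)
  ultimately have fin: "finite (joint Y S ` space M)" by (rule finite_subset)
  have "joint Y S -` {joint Y S x} \<inter> space M \<in> sets M" if "x \<in> space M" for x
  proof -
    have "joint Y S -` {joint Y S x} \<inter> space M = {y \<in> space M. \<forall>i\<in>S. Y i y = Y i x}"
      by (auto simp: joint_eq_iff)
    also have "\<dots> \<in> sets M"
      using assms by (intro sets.sets_Collect_finite_All simple_function_fibre)
    finally show ?thesis .
  qed
  with fin show ?thesis by (auto simp: simple_function_def)
qed

lemma (in prob_space) rv_entropy_const: "rv_entropy M (\<lambda>x. c) = 0"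
  by (subst rv_entropy_eq[of "{c}"]) (auto simp: eta_def prob_space)

lemma (in prob_space) joint_entropy_empty: "joint_entropy M Y {} = 0"
  by (simp add: joint_def[abs_def] restrict_def rv_entropy_const)

locale rv_family = prob_space M for M :: "'x measure" +
  fixes Y :: "'i \<Rightarrow> 'x \<Rightarrow> 'v"
  assumes simple: "simple_function M (Y i)"
begin

lemma joint_entropy_mono:
  assumes "finite T" "S \<subseteq> T"
  shows "joint_entropy M Y S \<le> joint_entropy M Y T"
  using assms finite_subset[OF assms(2,1)] simple
  by (intro rv_entropy_mono simple_function_joint) (auto simp: joint_eq_iff)

text \<open>Conditioning is on the joint variable of the intersection. It is already determined by
  the variables of \<open>S\<close> and of \<open>T\<close>, so adjoining it changes none of the
  entropies.\<close>

lemma joint_entropy_submodular: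
  assumes "finite S" "finite T"
  shows "joint_entropy M Y (S \<union> T) + joint_entropy M Y (S \<inter> T) \<le> joint_entropy M Y S + joint_entropy M Y T"
proof -
  note s = simple_function_joint[of _ M Y, OF _ simple]
  have "joint_entropy M Y (S \<union> T) = rv_entropy M (\<lambda>x. (joint Y S x, joint Y T x, joint Y (S \<inter> T) x))"
    using assms s by (intro rv_entropy_cong) (auto simp: joint_eq_iff)
  moreover have "joint_entropy M Y S = rv_entropy M (\<lambda>x. (joint Y S x, joint Y (S \<inter> T) x))"
    using assms s by (intro rv_entropy_cong) (auto simp: joint_eq_iff)
  moreover have "joint_entropy M Y T = rv_entropy M (\<lambda>x. (joint Y T x, joint Y (S \<inter> T) x))"
    using assms s by (intro rv_entropy_cong) (auto simp: joint_eq_iff)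
  ultimately show ?thesis
    using rv_entropy_submodular[of "joint Y S" "joint Y T" "joint Y (S \<inter> T)"] assms s by simp
qed

end

subsection \<open>Submodular set functions and Folner sequences\<close>

text \<open>The rank function of a polymatroid: Shearer's inequality uses only these properties of
  joint entropy.\<close>

locale entropy_like =
  fixes h :: "'i set \<Rightarrow> real"
  assumes h_empty: "h {} = 0"
    and h_mono: "finite T \<Longrightarrow> S \<subseteq> T \<Longrightarrow> h S \<le> h T"
    and h_submodular: "finite S \<Longrightarrow> finite T \<Longrightarrow> h (S \<union> T) + h (S \<inter> T) \<le> h S + h T"
begin

lemma h_nonneg: "finite S \<Longrightarrow> 0 \<le> h S"
  using h_mono[of S "{}"] h_empty by simp

lemma h_Un_le: "finite S \<Longrightarrow> finite T \<Longrightarrow> h (S \<union> T) \<le> h S + h T"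
  using h_submodular[of S T] h_nonneg[of "S \<inter> T"] by simp

lemma h_le_sum: "finite S \<Longrightarrow> h S \<le> (\<Sum>i\<in>S. h {i})"
proof (induction S rule: finite_induct)
  case (insert i S)
  then show ?case using h_Un_le[of "{i}" S] by simp
qed (simp add: h_empty)

text \<open>Induction on \<Phi>. By submodularity a new point \<open>s\<close> adds at least as much
  to the smaller set \<open>S i \<inter> \<Phi>\<close> as to \<Phi>, and at least \<open>m\<close>
  of the sets \<open>S i\<close> contain \<open>s\<close>.\<close>

lemma shearer:
  assumes "finite \<Phi>" "finite I" and fin: "\<And>i. i \<in> I \<Longrightarrow> finite (S i)"
    and cover: "\<And>s. s \<in> \<Phi> \<Longrightarrow> m \<le> card {i \<in> I. s \<in> S i}"
  shows "real m * h \<Phi> \<le> (\<Sum>i\<in>I. h (S i \<inter> \<Phi>))"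
  using assms(1) cover
proof (induction \<Phi> rule: finite_induct)
  case empty
  then show ?case by (simp add: h_empty)
next
  case (insert s \<Phi>)
  define d where "d = h (insert s \<Phi>) - h \<Phi>"
  have d0: "0 \<le> d" using insert h_mono[of "insert s \<Phi>" \<Phi>] by (auto simp: d_def)
  have step: "h (S i \<inter> \<Phi>) + (if s \<in> S i then d else 0) \<le> h (S i \<inter> insert s \<Phi>)" if "i \<in> I" for i
  proof (cases "s \<in> S i")
    case True
    have "insert s (S i \<inter> \<Phi>) \<union> \<Phi> = insert s \<Phi>" "insert s (S i \<inter> \<Phi>) \<inter> \<Phi> = S i \<inter> \<Phi>"
      "S i \<inter> insert s \<Phi> = insert s (S i \<inter> \<Phi>)"
      using True insert by auto
    then show ?thesis
      using h_submodular[of "insert s (S i \<inter> \<Phi>)" \<Phi>] insert True by (simp add: d_def)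
  qed auto
  have "real m * d \<le> real (card {i \<in> I. s \<in> S i}) * d"
    using insert.prems[of s] d0 by (intro mult_right_mono) auto
  also have "\<dots> = (\<Sum>i\<in>I. if s \<in> S i then d else 0)"
    using \<open>finite I\<close> by (simp add: sum.If_cases Int_def)
  finally have "real m * h (insert s \<Phi>) \<le> (\<Sum>i\<in>I. h (S i \<inter> \<Phi>)) + (\<Sum>i\<in>I. if s \<in> S i then d else 0)"
    using insert by (simp add: d_def algebra_simps)
  also have "\<dots> \<le> (\<Sum>i\<in>I. h (S i \<inter> insert s \<Phi>))"
    unfolding sum.distrib[symmetric] by (intro sum_mono step)
  finally show ?case .
qed

end

sublocale rv_family \<subseteq> entropy_like "joint_entropy M Y"
  by unfold_locales (auto intro: joint_entropy_empty joint_entropy_mono joint_entropy_submodular)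

section \<open>Shearer's inequality for translates and the limit along Folner sequences\<close>

lemma inj_minus_left: "inj_on (\<lambda>k. s - k) K" for s :: "'g::group_add"
  by (rule inj_onI) (metis add_left_cancel diff_conv_add_uminus neg_equal_iff_equal)

lemma inj_plus_left: "inj_on ((+) g) K" for g :: "'g::group_add"
  by (auto simp: inj_on_def)

text \<open>The translates \<open>g + K\<close> cover every point \<open>s\<close> of \<Phi> once
  for each centre \<open>s - k\<close>, hence \<open>card K\<close> times. Centres outside \<Phi>
  are counted by the boundaries of right translates, and each of them costs at most
  \<open>card K * c\<close>. Since \<open>h\<close> need not be invariant, the result also serves
  for the modified measures.\<close>

lemma folner_shearer:
  fixes h :: "'g::group_add set \<Rightarrow> real"
  assumes "entropy_like h" "finite \<Phi>" "finite K" and c: "0 \<le> c" "\<And>g. h {g} \<le> c"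
  shows "real (card K) * h \<Phi> \<le> (\<Sum>g\<in>\<Phi>. h ((+) g ` K))
    + (\<Sum>k\<in>K. real (card ((\<lambda>g. g - k) ` \<Phi> - \<Phi>))) * (real (card K) * c)"
proof -
  interpret entropy_like h by fact
  \<comment> \<open>All centres whose translate can meet \<Phi>, together with \<Phi> itself, so
    that the main term is a sum over exactly \<Phi>.\<close>
  define I where "I = \<Phi> \<union> (\<Union>k\<in>K. (\<lambda>g. g - k) ` \<Phi>)"
  have [simp]: "finite I" using assms by (simp add: I_def)
  have card_le: "h S \<le> c * card S" if "finite S" for S
    using h_le_sum[OF that] sum_bounded_above[of S "\<lambda>i. h {i}" c] c by (simp add: mult.commute)
  have "real (card K) * h \<Phi> \<le> (\<Sum>i\<in>I. h ((+) i ` K \<inter> \<Phi>))"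
  proof (rule shearer)
    fix s assume "s \<in> \<Phi>"
    have "(\<lambda>k. s - k) ` K \<subseteq> {i \<in> I. s \<in> (+) i ` K}"
    proof safe
      fix k assume "k \<in> K"
      then show "s - k \<in> I" using \<open>s \<in> \<Phi>\<close> by (auto simp: I_def)
      show "s \<in> (+) (s - k) ` K" using \<open>k \<in> K\<close> by (intro image_eqI[of _ _ k]) auto
    qed
    then have "card ((\<lambda>k. s - k) ` K) \<le> card {i \<in> I. s \<in> (+) i ` K}"
      by (intro card_mono) auto
    then show "card K \<le> card {i \<in> I. s \<in> (+) i ` K}"
      by (simp add: card_image inj_minus_left)
  qed (use assms in auto)
  also have "\<dots> = (\<Sum>i\<in>\<Phi>. h ((+) i ` K \<inter> \<Phi>)) + (\<Sum>i\<in>I - \<Phi>. h ((+) i ` K \<inter> \<Phi>))"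
    by (subst sum.subset_diff[of \<Phi> I]) (auto simp: I_def assms)
  also have "(\<Sum>i\<in>\<Phi>. h ((+) i ` K \<inter> \<Phi>)) \<le> (\<Sum>g\<in>\<Phi>. h ((+) g ` K))"
    using assms by (intro sum_mono h_mono) auto
  also have "(\<Sum>i\<in>I - \<Phi>. h ((+) i ` K \<inter> \<Phi>)) \<le> real (card (I - \<Phi>)) * (real (card K) * c)"
  proof (rule sum_bounded_above)
    fix i
    have "h ((+) i ` K \<inter> \<Phi>) \<le> h ((+) i ` K)" using assms by (intro h_mono) auto
    also have "\<dots> \<le> c * card ((+) i ` K)" using assms by (intro card_le) auto
    also have "\<dots> = real (card K) * c" by (simp add: card_image inj_plus_left)
    finally show "h ((+) i ` K \<inter> \<Phi>) \<le> real (card K) * c" .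
  qed
  also have "real (card (I - \<Phi>)) \<le> (\<Sum>k\<in>K. real (card ((\<lambda>g. g - k) ` \<Phi> - \<Phi>)))"
  proof -
    have "I - \<Phi> = (\<Union>k\<in>K. (\<lambda>g. g - k) ` \<Phi> - \<Phi>)" by (auto simp: I_def)
    then have "card (I - \<Phi>) \<le> (\<Sum>k\<in>K. card ((\<lambda>g. g - k) ` \<Phi> - \<Phi>))"
      using card_UN_le[OF \<open>finite K\<close>] by metis
    then show ?thesis by (metis of_nat_le_iff of_nat_sum)
  qed
  finally show ?thesis using c by (simp add: mult_right_mono)
qed

lemma folner_seq_diff:
  assumes "folner_seq \<Phi>"
  shows "(\<lambda>n. real (card ((\<lambda>h. h + g) ` \<Phi> n - \<Phi> n)) / real (card (\<Phi> n))) \<longlonglongrightarrow> 0"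
    and "(\<lambda>n. real (card (\<Phi> n - (\<lambda>h. h + g) ` \<Phi> n)) / real (card (\<Phi> n))) \<longlonglongrightarrow> 0"
proof -
  have fin: "finite (\<Phi> n)" for n using assms by (simp add: folner_seq_def)
  have lim: "(\<lambda>n. real (card (sym_diff ((\<lambda>h. h + g) ` \<Phi> n) (\<Phi> n))) / real (card (\<Phi> n))) \<longlonglongrightarrow> 0"
    using assms by (simp add: folner_seq_def)
  have "card ((\<lambda>h. h + g) ` \<Phi> n - \<Phi> n) \<le> card (sym_diff ((\<lambda>h. h + g) ` \<Phi> n) (\<Phi> n))"
    "card (\<Phi> n - (\<lambda>h. h + g) ` \<Phi> n) \<le> card (sym_diff ((\<lambda>h. h + g) ` \<Phi> n) (\<Phi> n))" for n
    using fin by (auto intro!: card_mono)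
  then show "(\<lambda>n. real (card ((\<lambda>h. h + g) ` \<Phi> n - \<Phi> n)) / real (card (\<Phi> n))) \<longlonglongrightarrow> 0"
    "(\<lambda>n. real (card (\<Phi> n - (\<lambda>h. h + g) ` \<Phi> n)) / real (card (\<Phi> n))) \<longlonglongrightarrow> 0"
    by (auto intro!: tendsto_sandwich[OF _ _ tendsto_const lim] always_eventually divide_right_mono)
qed

lemma folner_seq_diff_minus:
  assumes "folner_seq \<Phi>"
  shows "(\<lambda>n. real (card ((\<lambda>h. h - g) ` \<Phi> n - \<Phi> n)) / real (card (\<Phi> n))) \<longlonglongrightarrow> 0"
  using folner_seq_diff(1)[OF assms, of "- g"] by simp

text \<open>An infimum over all nonempty finite sets, with no Folner sequence involved: it bounds
  the average on every single set, and it can be bounded below one set at a time.\<close>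

definition entropy_rate :: "('g set \<Rightarrow> real) \<Rightarrow> real" where
  "entropy_rate h = (INF K\<in>{K. finite K \<and> K \<noteq> {}}. h K / real (card K))"

lemma entropy_rate_le:
  assumes "entropy_like h" "finite K" "K \<noteq> {}"
  shows "entropy_rate h \<le> h K / real (card K)"
  unfolding entropy_rate_def
proof (rule cINF_lower)
  show "bdd_below ((\<lambda>K. h K / real (card K)) ` {K. finite K \<and> K \<noteq> {}})"
    using entropy_like.h_nonneg[OF assms(1)] by (intro bdd_belowI[of _ 0]) auto
qed (use assms in auto)

lemma entropy_rate_ge:
  assumes "\<And>K. finite K \<Longrightarrow> K \<noteq> {} \<Longrightarrow> l \<le> h K / real (card K)"
  shows "l \<le> entropy_rate h"
  unfolding entropy_rate_def using assms by (intro cINF_greatest) auto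

text \<open>The infimum bounds every term from below. From above, Shearer's inequality for a nearly
  optimal \<open>K\<close> applies, where invariance makes all translates of \<open>K\<close>
  contribute \<open>h K\<close> and the boundary term vanishes. The limit is thus the same along all
  Folner sequences, as the definition of \<open>entropy_wrt\<close> demands.\<close>

lemma entropy_rate_lim:
  fixes h :: "'g::group_add set \<Rightarrow> real"
  assumes h: "entropy_like h" and inv: "\<And>g K. finite K \<Longrightarrow> h ((+) g ` K) = h K"
    and \<Phi>: "folner_seq \<Phi>"
  shows "(\<lambda>n. h (\<Phi> n) / real (card (\<Phi> n))) \<longlonglongrightarrow> entropy_rate h"
proof (rule order_tendstoI)
  have fin: "finite (\<Phi> n)" "\<Phi> n \<noteq> {}" for n using \<Phi> by (auto simp: folner_seq_def)
  fix a
  {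
    assume "a < entropy_rate h"
    then have "a < h (\<Phi> n) / real (card (\<Phi> n))" for n
      using entropy_rate_le[OF h fin, of n] by simp
    then show "eventually (\<lambda>n. a < h (\<Phi> n) / real (card (\<Phi> n))) sequentially"
      by simp
  }
  assume "entropy_rate h < a"
  then obtain K where K: "finite K" "K \<noteq> {}" "h K / real (card K) < a"
    using entropy_rate_ge[of a h] by force
  define c where "c = h {0}"
  have c: "0 \<le> c" "h {g} \<le> c" for g
    using entropy_like.h_nonneg[OF h, of "{0}"] inv[of "{0}" g] by (auto simp: c_def)
  define r where "r n = (\<Sum>k\<in>K. real (card ((\<lambda>g. g - k) ` \<Phi> n - \<Phi> n)) / real (card (\<Phi> n)))" for n
  have "r \<longlonglongrightarrow> (\<Sum>k\<in>K. 0)"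
    unfolding r_def by (intro tendsto_sum folner_seq_diff_minus \<Phi>)
  then have "(\<lambda>n. h K / real (card K) + r n * c) \<longlonglongrightarrow> h K / real (card K) + 0 * c"
    by (intro tendsto_intros) simp
  then have "eventually (\<lambda>n. h K / real (card K) + r n * c < a) sequentially"
    using K by (intro order_tendstoD(2)) auto
  moreover have "h (\<Phi> n) / real (card (\<Phi> n)) \<le> h K / real (card K) + r n * c" for n
  proof -
    define N where "N = real (card (\<Phi> n))"
    define k where "k = real (card K)"
    have pos: "0 < N" "0 < k"
      using fin[of n] K by (auto simp: N_def k_def card_gt_0_iff)
    have R: "(\<Sum>k\<in>K. real (card ((\<lambda>g. g - k) ` \<Phi> n - \<Phi> n))) = r n * N"
      using pos by (simp add: r_def sum_distrib_right N_def)
    have "k * h (\<Phi> n) \<le> (\<Sum>g\<in>\<Phi> n. h ((+) g ` K)) + (r n * N) * (k * c)"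
      using folner_shearer[OF h fin(1) K(1) c, of n] by (simp add: R k_def)
    also have "(\<Sum>g\<in>\<Phi> n. h ((+) g ` K)) = N * h K"
      using inv[OF K(1)] by (simp add: N_def)
    finally have "k * h (\<Phi> n) / (k * N) \<le> (N * h K + (r n * N) * (k * c)) / (k * N)"
      using pos by (intro divide_right_mono) auto
    then show ?thesis using pos by (simp add: add_divide_distrib N_def k_def)
  qed
  ultimately show "eventually (\<lambda>n. h (\<Phi> n) / real (card (\<Phi> n)) < a) sequentially"
    by (auto elim!: eventually_mono intro: le_less_trans)
qed

subsection \<open>Clopen sets of a subshift\<close>

definition determined_on :: "('g \<Rightarrow> 'a) set \<Rightarrow> 'g set \<Rightarrow> ('g \<Rightarrow> 'a) set \<Rightarrow> bool" where
  "determined_on X K A \<longleftrightarrow> A \<subseteq> X \<and> (\<forall>x\<in>A. \<forall>y\<in>X. (\<forall>g\<in>K. x g = y g) \<longrightarrow> y \<in> A)"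

text \<open>Described by coordinates instead of topology, so that the finite set of relevant
  coordinates is at hand and the Boolean operations are immediate.\<close>

definition clopens :: "('g \<Rightarrow> 'a) set \<Rightarrow> ('g \<Rightarrow> 'a) set set" where
  "clopens X = {A. \<exists>K. finite K \<and> determined_on X K A}"

lemma restrict_eq_iff: "restrict x K = restrict y K \<longleftrightarrow> (\<forall>g\<in>K. x g = y g)"
  by (auto simp: fun_eq_iff restrict_def)

lemma clopensI: "finite K \<Longrightarrow> determined_on X K A \<Longrightarrow> A \<in> clopens X"
  by (auto simp: clopens_def)

lemma clopens_space: "X \<in> clopens X"
  by (rule clopensI[of "{}"]) (auto simp: determined_on_def)

lemma clopens_empty: "{} \<in> clopens X"
  by (rule clopensI[of "{}"]) (auto simp: determined_on_def)

lemma clopens_subset: "A \<in> clopens X \<Longrightarrow> A \<subseteq> X"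
  by (auto simp: clopens_def determined_on_def)

lemma clopens_compl:
  assumes "A \<in> clopens X"
  shows "X - A \<in> clopens X"
proof -
  obtain K where "finite K" "determined_on X K A" using assms by (auto simp: clopens_def)
  moreover from this(2) have "determined_on X K (X - A)"
    unfolding determined_on_def by (metis DiffD1 DiffD2 DiffI Diff_subset)
  ultimately show ?thesis by (intro clopensI[of K])
qed

lemma clopens_Un:
  assumes "A \<in> clopens X" "B \<in> clopens X"
  shows "A \<union> B \<in> clopens X"
proof -
  obtain K L where "finite K" "determined_on X K A" "finite L" "determined_on X L B"
    using assms by (auto simp: clopens_def)
  then show ?thesis
    by (intro clopensI[of "K \<union> L"]) (simp, unfold determined_on_def, blast)
qed

lemma clopens_Int:
  assumes "A \<in> clopens X" "B \<in> clopens X"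
  shows "A \<inter> B \<in> clopens X"
proof -
  obtain K L where "finite K" "determined_on X K A" "finite L" "determined_on X L B"
    using assms by (auto simp: clopens_def)
  then show ?thesis
    by (intro clopensI[of "K \<union> L"]) (simp, unfold determined_on_def, blast)
qed

lemma algebra_clopens: "algebra X (clopens X)"
  unfolding algebra_iff_Un
  by (intro conjI ballI clopens_empty clopens_compl clopens_Un subsetI PowI) (auto dest: clopens_subset)

lemma clopens_cylinder:
  assumes "finite K"
  shows "{x \<in> X. restrict x K = u} \<in> clopens X"
proof (rule clopensI[OF assms])
  have "restrict y K = u" if "restrict x K = u" "\<forall>g\<in>K. x g = y g" for x y
    using that(1) iffD2[OF restrict_eq_iff that(2)] by simp
  then show "determined_on X K {x \<in> X. restrict x K = u}"
    unfolding determined_on_def by blast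
qed

section \<open>Cylinder neighbourhoods, compactness and the Borel sets\<close>

lemma open_agree:
  fixes x :: "'g \<Rightarrow> 'a::discrete_topology"
  assumes "finite K"
  shows "open {y. \<forall>g\<in>K. x g = y g}"
proof -
  have "open {f. \<forall>i\<in>K. f ((\<lambda>g. g) i) \<in> {x i}}"
    by (rule product_topology_basis'[OF assms]) (rule discrete_topology_class.open_discrete)
  then show ?thesis by (simp add: eq_commute)
qed

lemma open_contains_agree:
  fixes x :: "'g \<Rightarrow> 'a::topological_space"
  assumes "open U" "x \<in> U"
  obtains K where "finite K" "{y. \<forall>g\<in>K. x g = y g} \<subseteq> U"
proof -
  have "openin (product_topology (\<lambda>i. euclidean) UNIV) U"
    using assms by (simp add: open_fun_def)
  from product_topology_open_contains_basis[OF this assms(2)]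
  obtain T where T: "x \<in> (\<Pi>\<^sub>E i\<in>UNIV. T i)" "finite {i. T i \<noteq> UNIV}" "(\<Pi>\<^sub>E i\<in>UNIV. T i) \<subseteq> U"
    by auto
  have "{y. \<forall>g\<in>{i. T i \<noteq> UNIV}. x g = y g} \<subseteq> (\<Pi>\<^sub>E i\<in>UNIV. T i)"
  proof safe
    fix y i assume y: "\<forall>g\<in>{i. T i \<noteq> UNIV}. x g = y g"
    have "x i \<in> T i" using T by auto
    then show "y i \<in> T i" using y by (cases "T i = UNIV") (blast, metis mem_Collect_eq)
  qed auto
  then show ?thesis using that[of "{i. T i \<noteq> UNIV}"] T by blast
qed

lemma compact_UNIV_fun: "compact (UNIV :: ('g \<Rightarrow> 'a::{finite, topological_space}) set)"
proof -
  have "compact_space (euclidean :: 'a topology)"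
    unfolding compact_space_def by (simp add: finite_imp_compact)
  then have "compact_space (product_topology (\<lambda>i::'g. euclidean :: 'a topology) UNIV)"
    by (simp add: compact_space_product_topology)
  then show ?thesis
    by (simp add: euclidean_product_topology compact_space_def)
qed

lemma compact_closed_fun: "closed X \<Longrightarrow> compact X" for X :: "('g \<Rightarrow> 'a::{finite, topological_space}) set"
  using compact_Int_closed[OF compact_UNIV_fun, of X] by simp

lemma clopens_open:
  fixes X :: "('g \<Rightarrow> 'a::discrete_topology) set"
  assumes "A \<in> clopens X"
  obtains U where "open U" "A = X \<inter> U"
proof -
  obtain K where K: "finite K" "determined_on X K A" using assms by (auto simp: clopens_def)
  have "open (\<Union>x\<in>A. {y. \<forall>g\<in>K. x g = y g})"
    using K by (intro open_UN ballI open_agree)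
  moreover have "A = X \<inter> (\<Union>x\<in>A. {y. \<forall>g\<in>K. x g = y g})"
    using K(2) by (auto simp: determined_on_def)
  ultimately show ?thesis by (rule that)
qed

text \<open>An open set is the union of the cylinders inside it, and there are only countably many
  cylinders because the group is countable and the alphabet finite.\<close>

lemma open_Int_sigma_clopens:
  fixes X :: "('g::countable \<Rightarrow> 'a::{finite, discrete_topology}) set"
  assumes "open U"
  shows "X \<inter> U \<in> sigma_sets X (clopens X)"
proof -
  define I where "I = (SIGMA K:{K::'g set. finite K}. (K \<rightarrow>\<^sub>E (UNIV::'a set)))"
  define C where "C i = {x \<in> X. restrict x (fst i) = snd i}" for i :: "'g set \<times> ('g \<Rightarrow> 'a)"
  have "countable {K::'g set. finite K}"
    using countable_Collect_finite by simp
  then have cI: "countable I"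
    unfolding I_def
    by (intro Countable_Set.countable_SIGMA) (simp_all add: countable_finite finite_PiE)
  have "X \<inter> U = \<Union> (C ` {i \<in> I. C i \<subseteq> U})"
  proof safe
    fix x assume x: "x \<in> X" "x \<in> U"
    obtain K where K: "finite K" "{y. \<forall>g\<in>K. x g = y g} \<subseteq> U"
      using open_contains_agree[OF assms x(2)] .
    have "C (K, restrict x K) \<subseteq> U" using K(2) by (auto simp: C_def restrict_eq_iff)
    moreover have "(K, restrict x K) \<in> I" using K by (auto simp: I_def)
    moreover have "x \<in> C (K, restrict x K)" using x by (simp add: C_def)
    ultimately show "x \<in> \<Union> (C ` {i \<in> I. C i \<subseteq> U})" by blast
  qed (auto simp: C_def)
  also have "\<dots> \<in> sigma_sets X (clopens X)"
  proof (rule sigma_sets_UNION)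
    show "countable (C ` {i \<in> I. C i \<subseteq> U})"
      using cI by (intro countable_image) (auto intro: countable_subset)
    fix A assume "A \<in> C ` {i \<in> I. C i \<subseteq> U}"
    then show "A \<in> sigma_sets X (clopens X)"
      by (auto simp: C_def I_def intro!: sigma_sets.Basic clopens_cylinder)
  qed
  finally show ?thesis .
qed

text \<open>Measures on \<open>X\<close> can thus be built, compared and approximated through the
  clopen algebra. Closedness makes \<open>X\<close> a Borel set, so the trace of the Borel sets is
  generated by the traces of open sets.\<close>

lemma sets_restrict_borel_eq:
  fixes X :: "('g::countable \<Rightarrow> 'a::{finite, discrete_topology}) set"
  assumes "closed X"
  shows "sets (restrict_space borel X) = sigma_sets X (clopens X)"
proof -
  have "sets (restrict_space borel X) = (\<inter>) X ` sigma_sets UNIV {S. open S}"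
    by (simp add: sets_restrict_space borel_def)
  also have "\<dots> = sigma_sets X ((\<inter>) X ` {S. open S})"
  proof (rule sigma_sets_Int)
    have "X \<in> sets borel" using assms by simp
    then show "X \<in> sigma_sets UNIV {S. open S}" by (simp add: borel_def)
  qed simp
  also have "\<dots> = sigma_sets X (clopens X)"
  proof (rule sigma_sets_eqI)
    fix A assume "A \<in> clopens X"
    then obtain U where "open U" "A = X \<inter> U" by (rule clopens_open)
    then show "A \<in> sigma_sets X ((\<inter>) X ` {S. open S})" by (auto intro: sigma_sets.Basic)
  qed (use open_Int_sigma_clopens in auto)
  finally show ?thesis .
qed

text \<open>Uniform continuity in terms of coordinates: compactness leaves finitely many centres,
  and the union of their coordinate sets serves all points at once. Both points are compared with a
  common centre, whence \<open>e / 2\<close>.\<close>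

lemma uniform_local_approx:
  fixes X :: "('g \<Rightarrow> 'a::{finite, discrete_topology}) set" and \<phi> :: "('g \<Rightarrow> 'a) \<Rightarrow> real"
  assumes "closed X" "continuous_on X \<phi>" "0 < e"
  shows "\<exists>K. finite K \<and> (\<forall>x\<in>X. \<forall>y\<in>X. (\<forall>g\<in>K. x g = y g) \<longrightarrow> \<bar>\<phi> x - \<phi> y\<bar> < e)"
proof -
  have "\<exists>K. finite K \<and> (\<forall>y\<in>X. (\<forall>g\<in>K. x g = y g) \<longrightarrow> \<bar>\<phi> y - \<phi> x\<bar> < e / 2)" if "x \<in> X" for x
  proof -
    have "\<exists>A. open A \<and> x \<in> A \<and> (\<forall>y\<in>X. y \<in> A \<longrightarrow> \<phi> y \<in> {\<phi> x - e/2<..<\<phi> x + e/2})"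
    proof -
      have "\<phi> x \<in> {\<phi> x - e/2<..<\<phi> x + e/2}" using assms(3) by simp
      then show ?thesis
        using assms(2)[unfolded continuous_on_topological, rule_format, OF that open_greaterThanLessThan]
        by blast
    qed
    then obtain A where A: "open A" "x \<in> A" "\<And>y. y \<in> X \<Longrightarrow> y \<in> A \<Longrightarrow> \<phi> y \<in> {\<phi> x - e/2<..<\<phi> x + e/2}"
      by blast
    obtain K where "finite K" "{y. \<forall>g\<in>K. x g = y g} \<subseteq> A"
      using open_contains_agree[OF A(1,2)] .
    moreover have "\<bar>\<phi> y - \<phi> x\<bar> < e / 2" if "y \<in> X" "y \<in> A" for y
      using A(3)[OF that] unfolding greaterThanLessThan_iff by linarith
    ultimately show ?thesis by blast
  qed
  then have "\<exists>k. \<forall>x\<in>X. finite (k x) \<and> (\<forall>y\<in>X. (\<forall>g\<in>k x. x g = y g) \<longrightarrow> \<bar>\<phi> y - \<phi> x\<bar> < e / 2)"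
    by (intro bchoice) blast
  then obtain k where k: "\<And>x. x \<in> X \<Longrightarrow> finite (k x)"
    "\<And>x y. x \<in> X \<Longrightarrow> y \<in> X \<Longrightarrow> \<forall>g\<in>k x. x g = y g \<Longrightarrow> \<bar>\<phi> y - \<phi> x\<bar> < e / 2"
    by blast
  obtain D where D: "D \<subseteq> X" "finite D" "X \<subseteq> (\<Union>x\<in>D. {y. \<forall>g\<in>k x. x g = y g})"
  proof (rule compactE_image[OF compact_closed_fun[OF assms(1)], of X "\<lambda>x. {y. \<forall>g\<in>k x. x g = y g}"])
    show "open {y. \<forall>g\<in>k x. x g = y g}" if "x \<in> X" for x
      using k(1)[OF that] by (rule open_agree)
  qed auto
  show ?thesis
  proof (intro exI[of _ "\<Union>x\<in>D. k x"] conjI ballI impI)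
    show "finite (\<Union>x\<in>D. k x)" using D k by auto
    fix x y assume xy: "x \<in> X" "y \<in> X" "\<forall>g\<in>\<Union>x\<in>D. k x. x g = y g"
    obtain z where z: "z \<in> D" "\<forall>g\<in>k z. z g = x g" using D(3) xy(1) by blast
    then have "\<forall>g\<in>k z. z g = y g" using xy(3) by auto
    then show "\<bar>\<phi> x - \<phi> y\<bar> < e"
    proof -
      have "z \<in> X" using z D(1) by blast
      have "\<bar>\<phi> x - \<phi> z\<bar> < e / 2" "\<bar>\<phi> y - \<phi> z\<bar> < e / 2"
        using k(2)[OF \<open>z \<in> X\<close> xy(1) z(2)] k(2)[OF \<open>z \<in> X\<close> xy(2) \<open>\<forall>g\<in>k z. z g = y g\<close>] .
      then show ?thesis by linarith
    qed
  qed
qed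

subsection \<open>Measures on a subshift\<close>

text \<open>Invariance is left to a later extension because the measures produced by random swaps
  are in general not invariant.\<close>

locale shift_measure = prob_space M for M :: "('g::countable \<Rightarrow> 'a::{finite, discrete_topology}) measure" +
  fixes X :: "('g \<Rightarrow> 'a) set"
  assumes closed_X: "closed X" and sets_M: "sets M = sets (restrict_space borel X)"
begin

lemma space_M: "space M = X"
  using sets_eq_imp_space_eq[OF sets_M] by (simp add: space_restrict_space)

lemma sets_M_sigma: "sets M = sigma_sets X (clopens X)"
  using sets_M sets_restrict_borel_eq[OF closed_X] by simp

lemma clopens_sets: "A \<in> clopens X \<Longrightarrow> A \<in> sets M"
  by (simp add: sets_M_sigma sigma_sets.Basic)

lemma simple_function_local:
  assumes "finite K" "finite (f ` X)"
    and "\<And>x y. x \<in> X \<Longrightarrow> y \<in> X \<Longrightarrow> \<forall>g\<in>K. x g = y g \<Longrightarrow> f x = f y"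
  shows "simple_function M f"
proof -
  have "determined_on X K (f -` {v} \<inter> X)" for v
    using assms(3) unfolding determined_on_def by (metis IntE IntI inf_le2 vimage_singleton_eq)
  then have "f -` {v} \<inter> X \<in> clopens X" for v
    using assms(1) by (rule clopensI[rotated])
  then show ?thesis
    using assms(2) clopens_sets by (auto simp: simple_function_def space_M)
qed

lemma simple_function_coordinate: "simple_function M (\<lambda>x. x g)"
proof (rule simple_function_local[of "{g}"])
  show "finite ((\<lambda>x. x g) ` X)" by (rule finite_subset[of _ UNIV]) auto
qed auto

sublocale coords: rv_family M "\<lambda>g x. x g"
  by unfold_locales (rule simple_function_coordinate)

text \<open>A clopen set constrains finitely many coordinates, so its preimage is an event about
  finitely many simple functions; clopen sets generate the rest.\<close>

lemma measurable_into:
  assumes "\<And>x. x \<in> X \<Longrightarrow> T x \<in> X" and "\<And>g. simple_function M (\<lambda>x. T x g)"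
  shows "T \<in> measurable M M"
proof (rule measurable_sigma_sets[OF sets_M_sigma])
  show "clopens X \<subseteq> Pow X" using clopens_subset by blast
  show "T \<in> space M \<rightarrow> X" using assms by (auto simp: space_M)
  fix A assume "A \<in> clopens X"
  then obtain K where K: "finite K" "determined_on X K A" by (auto simp: clopens_def)
  have "T -` A \<inter> space M = joint (\<lambda>g x. T x g) K -` ((\<lambda>x. restrict x K) ` A) \<inter> space M"
  proof -
    have "T x \<in> A \<longleftrightarrow> joint (\<lambda>g x. T x g) K x \<in> (\<lambda>x. restrict x K) ` A" if "x \<in> X" for x
    proof
      assume "T x \<in> A"
      then show "joint (\<lambda>g x. T x g) K x \<in> (\<lambda>x. restrict x K) ` A"
        unfolding joint_def by (rule imageI)
    next
      assume "joint (\<lambda>g x. T x g) K x \<in> (\<lambda>x. restrict x K) ` A"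
      then obtain y where y: "y \<in> A" "restrict (T x) K = restrict y K" by (auto simp: joint_def)
      then have "\<forall>g\<in>K. y g = T x g" by (metis restrict_eq_iff)
      then show "T x \<in> A" using K(2) y(1) assms(1)[OF that] unfolding determined_on_def by blast
    qed
    then show ?thesis by (auto simp: space_M)
  qed
  also have "\<dots> \<in> sets M"
    by (rule simple_functionD(2)[OF simple_function_joint[OF K(1) assms(2)]])
  finally show "T -` A \<inter> space M \<in> sets M" .
qed

lemma bounded_phi:
  fixes \<phi> :: "('g \<Rightarrow> 'a) \<Rightarrow> real"
  assumes "continuous_on X \<phi>"
  shows "\<exists>B. \<forall>x\<in>X. \<bar>\<phi> x\<bar> \<le> B"
proof -
  have "bounded (\<phi> ` X)"
    by (intro compact_imp_bounded compact_continuous_image assms compact_closed_fun closed_X)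
  then show ?thesis by (auto simp: bounded_iff)
qed

lemma measurable_phi:
  fixes \<phi> :: "('g \<Rightarrow> 'a) \<Rightarrow> real"
  assumes "continuous_on X \<phi>"
  shows "\<phi> \<in> borel_measurable M"
  using borel_measurable_continuous_on_restrict[OF assms] measurable_cong_sets[OF sets_M refl] by blast

lemma integrable_phi:
  fixes \<phi> :: "('g \<Rightarrow> 'a) \<Rightarrow> real"
  assumes "continuous_on X \<phi>"
  shows "integrable M \<phi>"
proof -
  obtain B where "\<forall>x\<in>X. \<bar>\<phi> x\<bar> \<le> B" using bounded_phi[OF assms] by blast
  then show ?thesis
    by (intro integrable_const_bound[where B=B] measurable_phi assms) (auto simp: space_M)
qed

end

lemma joint_coordinate: "joint (\<lambda>g x. x g) K = (\<lambda>x. restrict x K)"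
  by (auto simp: joint_def)

abbreviation pattern_entropy :: "('g \<Rightarrow> 'a) measure \<Rightarrow> 'g set \<Rightarrow> real" where
  "pattern_entropy M K \<equiv> joint_entropy M (\<lambda>g x. x g) K"

subsection \<open>Entropy rates of partitions\<close>

lemma rv_entropy_distr:
  assumes T: "T \<in> measurable M N" and f: "simple_function N f"
  shows "rv_entropy (distr M N T) f = rv_entropy M (\<lambda>x. f (T x))"
proof -
  have fin: "finite (f ` space N)" using f by (simp add: simple_functionD)
  have "(\<lambda>x. f (T x)) ` space M \<subseteq> f ` space N" using measurable_space[OF T] by auto
  then have "rv_entropy M (\<lambda>x. f (T x)) = (\<Sum>v\<in>f ` space N. eta (measure M {x \<in> space M. f (T x) = v}))"
    by (rule rv_entropy_eq[OF fin])
  moreover have "measure (distr M N T) {x \<in> space N. f x = v} = measure M {x \<in> space M. f (T x) = v}" for v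
  proof -
    have "T -` {x \<in> space N. f x = v} \<inter> space M = {x \<in> space M. f (T x) = v}"
      using measurable_space[OF T] by auto
    then show ?thesis by (simp add: measure_distr[OF T simple_function_fibre[OF f]])
  qed
  ultimately show ?thesis by (simp add: rv_entropy_def)
qed

lemma lshift_lshift: "lshift k (lshift h x) = lshift (h + k) x" for x :: "'g::group_add \<Rightarrow> 'a"
  by (simp add: lshift_def add.assoc)

text \<open>Submodularity conditioned on a constant variable.\<close>

lemma (in prob_space) rv_entropy_Pair_le:
  assumes f: "simple_function M f" and g: "simple_function M g"
  shows "rv_entropy M (\<lambda>x. (f x, g x)) \<le> rv_entropy M f + rv_entropy M g"
proof -
  let ?c = "\<lambda>x::'a. ()"
  have c: "simple_function M ?c" by (rule simple_function_const)
  have e1: "rv_entropy M (\<lambda>x. (f x, g x)) = rv_entropy M (\<lambda>x. (f x, g x, ?c x))"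
    by (rule rv_entropy_cong) (intro simple_function_Pair f g c | simp)+
  have e2: "rv_entropy M (\<lambda>x. (f x, ?c x)) = rv_entropy M f"
    by (rule rv_entropy_cong) (intro simple_function_Pair f g c | simp)+
  have e3: "rv_entropy M (\<lambda>x. (g x, ?c x)) = rv_entropy M g"
    by (rule rv_entropy_cong) (intro simple_function_Pair f g c | simp)+
  show ?thesis
    using rv_entropy_submodular[OF f g c] rv_entropy_const[of "()"] e1 e2 e3 by linarith
qed

lemma rv_entropy_bool:
  "rv_entropy M (\<lambda>x. x \<in> D) = eta (measure M {x \<in> space M. x \<in> D}) + eta (measure M {x \<in> space M. x \<notin> D})"
  by (subst rv_entropy_eq[of UNIV]) (auto simp: UNIV_bool)

lemma simple_function_pred:
  assumes "{x \<in> space M. Q x} \<in> sets M"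
  shows "simple_function M Q"
  unfolding simple_function_def
proof (intro conjI ballI)
  show "finite (Q ` space M)" by (rule finite_subset[of _ UNIV]) auto
  fix b :: bool
  have "Q -` {True} \<inter> space M = {x \<in> space M. Q x}"
    "Q -` {False} \<inter> space M = space M - {x \<in> space M. Q x}"
    by auto
  then have "Q -` {True} \<inter> space M \<in> sets M" "Q -` {False} \<inter> space M \<in> sets M"
    using assms sets.compl_sets[OF assms] by (simp_all only:)
  then show "Q -` {b} \<inter> space M \<in> sets M" by (cases b) (simp_all only:)
qed

text \<open>Turns a partition into a random variable, so that entropies of partitions become
  instances of \<open>rv_entropy\<close>.\<close>

definition cell :: "'b set set \<Rightarrow> 'b \<Rightarrow> 'b set" where
  "cell P x = (THE A. A \<in> P \<and> x \<in> A)"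

lemma cell_eq_iff:
  assumes "partition_on X P" "A \<in> P"
  shows "cell P x = A \<and> x \<in> X \<longleftrightarrow> x \<in> A"
proof -
  have uniq: "B = C" if "B \<in> P" "C \<in> P" "x \<in> B" "x \<in> C" for B C
    using assms(1) that by (auto simp: partition_on_def disjoint_def)
  have *: "cell P x = B" if "B \<in> P" "x \<in> B" for B
    unfolding cell_def using that uniq by (intro the_equality) auto
  have X: "X = \<Union>P" using assms(1) by (auto simp: partition_on_def)
  show ?thesis
  proof
    assume "cell P x = A \<and> x \<in> X"
    then obtain B where B: "B \<in> P" "x \<in> B" and "cell P x = A" using X by auto
    then show "x \<in> A" using *[OF B] by simp
  next
    assume "x \<in> A"
    then show "cell P x = A \<and> x \<in> X" using * assms(2) X by blast
  qed
qed

lemma cell_in: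
  assumes "partition_on X P" "x \<in> X"
  shows "cell P x \<in> P"
proof -
  obtain A where "A \<in> P" "x \<in> A" using assms by (auto simp: partition_on_def)
  then show ?thesis using cell_eq_iff[OF assms(1), of A x] by auto
qed

section \<open>Approximation of measurable sets by clopen sets\<close>

context shift_measure
begin

text \<open>Induction over the generation of the sigma-algebra. A countable union is first cut off
  at a finite stage, by continuity from below, and then approximated piece by piece.\<close>

lemma clopen_approx:
  assumes "A \<in> sets M" "0 < e"
  shows "\<exists>B\<in>clopens X. prob (sym_diff A B) < e"
proof -
  have "A \<in> sigma_sets X (clopens X)" using assms(1) by (simp add: sets_M_sigma)
  then show ?thesis using assms(2)
  proof (induction arbitrary: e)
    case (Basic a)
    then show ?case by (intro bexI[of _ a]) auto
  next
    case Empty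
    then show ?case by (intro bexI[of _ "{}"]) (auto simp: clopens_empty)
  next
    case (Compl a)
    then obtain B where B: "B \<in> clopens X" "prob (sym_diff a B) < e" by blast
    have "a \<subseteq> X" using Compl(1) sigma_sets_into_sp[of "clopens X" X a] clopens_subset by blast
    then have "sym_diff (X - a) (X - B) = sym_diff a B"
      using clopens_subset[OF B(1)] by auto
    then show ?case using B by (intro bexI[of _ "X - B"] clopens_compl) auto
  next
    case (Union a)
    have a: "a i \<in> sets M" for i using Union(1) by (simp add: sets_M_sigma)
    define U where "U n = (\<Union>i<n. a i)" for n
    have U: "range U \<subseteq> sets M" "incseq U" "(\<Union>n. U n) = (\<Union>i. a i)"
    proof -
      show "range U \<subseteq> sets M" using a by (auto simp: U_def)
      show "incseq U" by (auto simp: U_def incseq_def intro: less_le_trans)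
      show "(\<Union>n. U n) = (\<Union>i. a i)" unfolding U_def by blast
    qed
    have "(\<lambda>n. prob (U n)) \<longlonglongrightarrow> prob (\<Union>i. a i)"
      using finite_Lim_measure_incseq[OF U(1,2)] U(3) by simp
    then have "eventually (\<lambda>n. prob (\<Union>i. a i) - e / 2 < prob (U n)) sequentially"
      using \<open>0 < e\<close> by (intro order_tendstoD(1)) auto
    then obtain n where n: "prob (\<Union>i. a i) - e / 2 < prob (U n)"
      by (auto simp: eventually_sequentially)
    \<comment> \<open>The errors of the \<open>n\<close> pieces add up to at most
      \<open>e / 2\<close>; the summand 1 covers \<open>n = 0\<close>.\<close>
    have "\<exists>B. B \<in> clopens X \<and> prob (sym_diff (a i) B) < e / (2 * (real n + 1))" for i
      using Union(2)[of "e / (2 * (real n + 1))" i] \<open>0 < e\<close> by auto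
    then obtain B where B: "\<And>i. B i \<in> clopens X" "\<And>i. prob (sym_diff (a i) (B i)) < e / (2 * (real n + 1))"
      by metis
    have Bn: "(\<Union>i<m. B i) \<in> clopens X" for m
      by (induction m) (simp_all add: clopens_empty lessThan_Suc clopens_Un B)
    have Bs: "B i \<in> sets M" for i using B clopens_sets by blast
    have sub: "sym_diff (\<Union>i. a i) (\<Union>i<n. B i) \<subseteq> ((\<Union>i. a i) - U n) \<union> (\<Union>i<n. sym_diff (a i) (B i))"
      by (auto simp: U_def)
    have "prob (sym_diff (\<Union>i. a i) (\<Union>i<n. B i)) \<le> prob (((\<Union>i. a i) - U n) \<union> (\<Union>i<n. sym_diff (a i) (B i)))"
      using a Bs U(1) by (intro finite_measure_mono sub) auto
    also have "\<dots> \<le> prob ((\<Union>i. a i) - U n) + prob (\<Union>i<n. sym_diff (a i) (B i))"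
      using a Bs U(1) by (intro measure_Un_le) auto
    also have "prob ((\<Union>i. a i) - U n) = prob (\<Union>i. a i) - prob (U n)"
      using a U by (intro finite_measure_Diff) auto
    also have "prob (\<Union>i<n. sym_diff (a i) (B i)) \<le> (\<Sum>i<n. prob (sym_diff (a i) (B i)))"
      using a Bs by (intro finite_measure_subadditive_finite) auto
    also have "\<dots> \<le> (\<Sum>i<n. e / (2 * (real n + 1)))"
      using B(2) by (intro sum_mono less_imp_le)
    also have "\<dots> \<le> e / 2" using \<open>0 < e\<close> by (simp add: field_simps)
    finally have "prob (sym_diff (\<Union>i. a i) (\<Union>i<n. B i)) < e"
      using n by simp
    then show ?case using Bn by blast
  qed
qed

text \<open>The indicator of an event of probability \<open>m\<close> has entropy
  \<open>eta m + eta (1 - m)\<close>, which tends to 0 with \<open>m\<close>.\<close>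

lemma clopen_approx_entropy:
  assumes A: "A \<in> sets M" and "0 < e"
  shows "\<exists>B\<in>clopens X. rv_entropy M (\<lambda>x. x \<in> sym_diff A B) < e"
proof -
  have "\<exists>B. B \<in> clopens X \<and> prob (sym_diff A B) < 1 / real (Suc n)" for n
    using clopen_approx[OF A, of "1 / real (Suc n)"] by auto
  then obtain B where B: "\<And>n. B n \<in> clopens X" "\<And>n. prob (sym_diff A (B n)) < 1 / real (Suc n)"
    by metis
  define m where "m n = prob (sym_diff A (B n))" for n
  have S: "sym_diff A (B n) \<in> sets M" for n using A B clopens_sets by blast
  have "m \<longlonglongrightarrow> 0"
  proof (rule tendsto_sandwich[OF _ _ tendsto_const])
    show "(\<lambda>n. 1 / real (Suc n)) \<longlonglongrightarrow> 0" by (rule LIMSEQ_Suc[OF lim_1_over_n])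
    show "eventually (\<lambda>n. m n \<le> 1 / real (Suc n)) sequentially"
      using B(2) by (intro always_eventually allI less_imp_le) (simp add: m_def)
  qed (simp add: m_def)
  then have "(\<lambda>n. eta (m n) + eta (1 - m n)) \<longlonglongrightarrow> eta 0 + eta (1 - 0)"
  proof (intro tendsto_add tendsto_eta tendsto_diff tendsto_const)
    show "0 \<le> m n" "0 \<le> 1 - m n" for n by (simp_all add: m_def)
  qed simp_all
  then have "eventually (\<lambda>n. eta (m n) + eta (1 - m n) < e) sequentially"
    using \<open>0 < e\<close> by (intro order_tendstoD(2)) (auto simp: eta_def)
  then obtain n where n: "eta (m n) + eta (1 - m n) < e" by (auto simp: eventually_sequentially)
  have "{x \<in> space M. x \<in> sym_diff A (B n)} = sym_diff A (B n)"
    using sets.sets_into_space[OF S[of n]] by blast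
  moreover have "prob {x \<in> space M. x \<notin> sym_diff A (B n)} = 1 - m n"
  proof -
    have "{x \<in> space M. x \<notin> sym_diff A (B n)} = space M - sym_diff A (B n)" by blast
    then show ?thesis using prob_compl[OF S[of n]] by (simp only: m_def)
  qed
  ultimately have "rv_entropy M (\<lambda>x. x \<in> sym_diff A (B n)) < e"
    using n unfolding rv_entropy_bool m_def by (simp only:)
  then show ?thesis using B(1) by blast
qed

end

locale subshift_measure = shift_measure M X
  for M :: "('g::{group_add, countable} \<Rightarrow> 'a::{finite, discrete_topology}) measure" and X +
  assumes subshift_X: "subshift X"
begin

lemma lshift_in: "x \<in> X \<Longrightarrow> lshift g x \<in> X"
  using subshift_X by (auto simp: subshift_def)

lemma measurable_lshift: "lshift g \<in> measurable M M"
proof (rule measurable_into[OF lshift_in])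
  show "simple_function M (\<lambda>x. lshift g x h)" for h
    unfolding lshift_def by (rule simple_function_coordinate)
qed

lemma simple_function_lshift:
  assumes "simple_function M f"
  shows "simple_function M (\<lambda>x. f (lshift g x))"
proof -
  have "(\<lambda>x. f (lshift g x)) ` X \<subseteq> f ` X" using lshift_in by auto
  then have "finite ((\<lambda>x. f (lshift g x)) ` X)"
    using assms finite_subset by (auto simp: simple_function_def space_M)
  moreover have "(\<lambda>x. f (lshift g x)) -` {v} \<inter> space M \<in> sets M" for v
  proof -
    have "(\<lambda>x. f (lshift g x)) -` {v} \<inter> space M = lshift g -` (f -` {v} \<inter> space M) \<inter> space M"
      using lshift_in by (auto simp: space_M)
    then show ?thesis
      using measurable_sets[OF measurable_lshift simple_functionD(2)[OF assms, of "{v}"]] by simp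
  qed
  ultimately show ?thesis by (auto simp: simple_function_def space_M)
qed

end

section \<open>Kolmogorov-Sinai entropy as the entropy rate of patterns\<close>

locale invariant_measure = subshift_measure M X
  for M :: "('g::{group_add, countable} \<Rightarrow> 'a::{finite, discrete_topology}) measure" and X +
  assumes invariant: "distr M M (lshift g) = M"
begin

text \<open>The equivariance \<open>shift\<close> holds both for coordinates and for the cells of a
  partition along an orbit, so one argument serves both families.\<close>

lemma joint_entropy_translate:
  assumes Y: "\<And>g. simple_function M (Y g)" and shift: "\<And>h k x. Y (h + k) x = Y k (lshift h x)"
    and "finite K"
  shows "joint_entropy M Y ((+) h ` K) = joint_entropy M Y K"
proof -
  have sK: "simple_function M (joint Y K)" by (rule simple_function_joint[OF \<open>finite K\<close> Y])
  have "joint_entropy M Y ((+) h ` K) = rv_entropy M (\<lambda>x. joint Y K (lshift h x))"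
  proof (rule rv_entropy_cong)
    show "simple_function M (joint Y ((+) h ` K))"
      using \<open>finite K\<close> Y by (intro simple_function_joint) auto
    show "simple_function M (\<lambda>x. joint Y K (lshift h x))" by (rule simple_function_lshift[OF sK])
    fix x y assume "x \<in> space M" "y \<in> space M"
    show "joint Y ((+) h ` K) x = joint Y ((+) h ` K) y
        \<longleftrightarrow> joint Y K (lshift h x) = joint Y K (lshift h y)"
      by (simp add: joint_eq_iff shift)
  qed
  also have "\<dots> = rv_entropy (distr M M (lshift h)) (joint Y K)"
    by (rule rv_entropy_distr[OF measurable_lshift sK, symmetric])
  finally show ?thesis by (simp only: invariant)
qed

lemma pattern_entropy_translate: "finite K \<Longrightarrow> pattern_entropy M ((+) h ` K) = pattern_entropy M K"
  by (rule joint_entropy_translate[OF simple_function_coordinate]) (auto simp: lshift_def)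

lemma simple_function_cell:
  assumes "finite_partition M P"
  shows "simple_function M (cell P)"
proof -
  have P: "finite P" "P \<subseteq> sets M" "partition_on X P"
    using assms by (auto simp: finite_partition_def space_M)
  have "cell P -` {A} \<inter> X = A" if "A \<in> P" for A
    using cell_eq_iff[OF P(3) that] by blast
  then have "cell P -` {cell P x} \<inter> X \<in> sets M" if "x \<in> X" for x
    using P(2) cell_in[OF P(3) that] by auto
  moreover have "finite (cell P ` X)"
    by (rule finite_subset[OF _ P(1)]) (use cell_in[OF P(3)] in blast)
  ultimately show ?thesis by (auto simp: simple_function_def space_M)
qed

abbreviation part_entropy where
  "part_entropy P \<equiv> joint_entropy M (\<lambda>g x. cell P (lshift g x))"

lemma part_family:
  assumes "finite_partition M P"
  shows "rv_family M (\<lambda>g x. cell P (lshift g x))"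
  by unfold_locales (rule simple_function_lshift[OF simple_function_cell[OF assms]])

lemma part_entropy_translate:
  assumes "finite_partition M P" "finite K"
  shows "part_entropy P ((+) h ` K) = part_entropy P K"
  by (rule joint_entropy_translate[OF simple_function_lshift[OF simple_function_cell[OF assms(1)]] _ assms(2)])
    (simp add: lshift_lshift)

text \<open>The members of the join are the nonempty fibres of the joint cell variable. Removing the
  empty set in \<open>shift_join\<close> corresponds to summing over attained values only.\<close>

lemma partition_entropy_shift_join:
  assumes "finite_partition M P" "finite F"
  shows "partition_entropy M (shift_join M P F) = part_entropy P F"
proof -
  have P: "partition_on X P" using assms(1) by (auto simp: finite_partition_def space_M)
  let ?J = "joint (\<lambda>g x. cell P (lshift g x)) F"
  let ?S = "\<lambda>v. {x \<in> X. ?J x = v}"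
  have J: "?J x = f \<longleftrightarrow> (\<forall>g\<in>F. lshift g x \<in> f g)" if "x \<in> X" "f \<in> F \<rightarrow>\<^sub>E P" for x f
  proof -
    have "?J x = f \<longleftrightarrow> (\<forall>g\<in>F. cell P (lshift g x) = f g)"
      unfolding joint_def using that(2) by (auto simp: fun_eq_iff restrict_def PiE_def extensional_def)
    also have "\<dots> \<longleftrightarrow> (\<forall>g\<in>F. lshift g x \<in> f g)"
      using cell_eq_iff[OF P] lshift_in[OF that(1)] that(2) by (intro ball_cong refl) blast
    finally show ?thesis .
  qed
  have JP: "?J x \<in> F \<rightarrow>\<^sub>E P" if "x \<in> X" for x
    unfolding joint_def using cell_in[OF P] lshift_in[OF that] by auto
  have "shift_join M P F = ?S ` (?J ` X)"
  proof (rule set_eqI)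
    fix S
    have "S \<in> shift_join M P F \<longleftrightarrow> (\<exists>f\<in>F \<rightarrow>\<^sub>E P. S = {x \<in> X. \<forall>g\<in>F. lshift g x \<in> f g} \<and> S \<noteq> {})"
      by (auto simp: shift_join_def space_M)
    also have "\<dots> \<longleftrightarrow> (\<exists>f\<in>F \<rightarrow>\<^sub>E P. S = ?S f \<and> S \<noteq> {})"
      using J by (intro bex_cong refl conj_cong arg_cong2[of _ _ _ _ "(=)"] Collect_cong) blast
    also have "\<dots> \<longleftrightarrow> S \<in> ?S ` (?J ` X)"
      using JP by blast
    finally show "S \<in> shift_join M P F \<longleftrightarrow> S \<in> ?S ` (?J ` X)" .
  qed
  moreover have "inj_on ?S (?J ` X)"
    by (rule inj_onI) blast
  ultimately have "partition_entropy M (shift_join M P F) = (\<Sum>v\<in>?J ` X. eta (prob (?S v)))"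
    by (simp add: partition_entropy_def sum.reindex eta_def sum_negf)
  then show ?thesis by (simp add: rv_entropy_def space_M)
qed

text \<open>Amenability gives the description operator a unique value: without any Folner sequence
  its condition would hold vacuously for every number.\<close>

lemma entropy_wrt_eq:
  assumes "amenable TYPE('g)" "finite_partition M P"
  shows "entropy_wrt M P = entropy_rate (part_entropy P)"
proof -
  interpret Y: rv_family M "\<lambda>g x. cell P (lshift g x)" by (rule part_family[OF assms(2)])
  have lim: "(\<lambda>n. partition_entropy M (shift_join M P (\<Phi> n)) / real (card (\<Phi> n))) \<longlonglongrightarrow> entropy_rate (part_entropy P)"
    if "folner_seq \<Phi>" for \<Phi>
  proof -
    have "finite (\<Phi> n)" for n using that by (simp add: folner_seq_def)
    then show ?thesis
      using entropy_rate_lim[OF Y.entropy_like_axioms part_entropy_translate[OF assms(2)] that]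
      by (simp add: partition_entropy_shift_join[OF assms(2)])
  qed
  obtain \<Phi> :: "nat \<Rightarrow> 'g set" where "folner_seq \<Phi>" using assms(1) by (auto simp: amenable_def)
  then show ?thesis
    unfolding entropy_wrt_def using lim by (intro the_equality) (auto intro: LIMSEQ_unique)
qed

text \<open>
  Membership of \<open>\<sigma>\<^sub>g x\<close> in \<open>A\<close> is read off from finitely many coordinates near \<open>g\<close> and from whether
  \<open>\<sigma>\<^sub>g x\<close> lies in the difference of \<open>A\<close> and a clopen approximation of \<open>A\<close>; the latter event has
  small entropy.
\<close>

lemma part_entropy_rate_le:
  assumes P: "finite_partition M P" and \<Phi>: "folner_seq (\<Phi> :: nat \<Rightarrow> 'g set)"
  shows "entropy_rate (part_entropy P) \<le> entropy_rate (pattern_entropy M)"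
proof (rule field_le_epsilon)
  fix e :: real assume "0 < e"
  have P': "finite P" "P \<subseteq> sets M" "partition_on X P"
    using P by (auto simp: finite_partition_def space_M)
  \<comment> \<open>The error budget per cell: over all cells it sums to at most
    \<open>e\<close>.\<close>
  define d where "d = e / (real (card P) + 1)"
  have "0 < d" using \<open>0 < e\<close> by (simp add: d_def add_nonneg_pos)
  have "\<forall>A\<in>P. \<exists>B. B \<in> clopens X \<and> rv_entropy M (\<lambda>x. x \<in> sym_diff A B) < d"
    using clopen_approx_entropy[OF _ \<open>0 < d\<close>] P'(2) by blast
  then obtain B where B: "\<And>A. A \<in> P \<Longrightarrow> B A \<in> clopens X"
    "\<And>A. A \<in> P \<Longrightarrow> rv_entropy M (\<lambda>x. x \<in> sym_diff A (B A)) < d"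
    by metis
  have "\<forall>A\<in>P. \<exists>K. finite K \<and> determined_on X K (B A)"
    using B(1) by (auto simp: clopens_def)
  then obtain k where k: "\<And>A. A \<in> P \<Longrightarrow> finite (k A)" "\<And>A. A \<in> P \<Longrightarrow> determined_on X (k A) (B A)"
    by metis
  define K where "K = (\<Union>A\<in>P. k A)"
  have "finite K" using k(1) P'(1) by (simp add: K_def)
  \<comment> \<open>The error events, indexed by site and cell. The conjunct
    \<open>snd i \<in> P\<close> makes \<open>Z i\<close> measurable for every index, as
    \<open>rv_family\<close> requires.\<close>
  define Z where "Z i x = (snd i \<in> P \<and> lshift (fst i) x \<in> sym_diff (snd i) (B (snd i)))" for i :: "'g \<times> ('g \<Rightarrow> 'a) set" and x
  have sD: "simple_function M (\<lambda>x. A \<in> P \<and> x \<in> sym_diff A (B A))" for A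
  proof -
    have "sym_diff A (B A) \<in> sets M" if "A \<in> P" using that P'(2) B(1) clopens_sets by blast
    then have "{x \<in> space M. A \<in> P \<and> x \<in> sym_diff A (B A)} \<in> sets M"
    proof (cases "A \<in> P")
      case True
      with \<open>A \<in> P \<Longrightarrow> sym_diff A (B A) \<in> sets M\<close> have S: "sym_diff A (B A) \<in> sets M" by blast
      have "{x \<in> space M. A \<in> P \<and> x \<in> sym_diff A (B A)} = sym_diff A (B A)"
        using sets.sets_into_space[OF S] True by blast
      then show ?thesis using S by (simp only:)
    qed simp
    then show ?thesis by (rule simple_function_pred)
  qed
  interpret Z: rv_family M Z
    unfolding Z_def by unfold_locales (rule simple_function_lshift[OF sD])
  interpret Y: rv_family M "\<lambda>g x. cell P (lshift g x)" by (rule part_family[OF P])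
  define c where "c = pattern_entropy M {0}"
  have c: "0 \<le> c" "pattern_entropy M {g} \<le> c" for g
    using coords.h_nonneg[of "{0}"] pattern_entropy_translate[of "{0}" g] by (auto simp: c_def)
  have single: "joint_entropy M Z {(g, A)} \<le> d" if "A \<in> P" for g A
  proof -
    have s: "simple_function M (\<lambda>x. x \<in> sym_diff A (B A))" using sD[of A] that by simp
    have "joint_entropy M Z {(g, A)} = rv_entropy M (\<lambda>x. lshift g x \<in> sym_diff A (B A))"
    proof (rule rv_entropy_cong)
      show "simple_function M (joint Z {(g, A)})" by (intro simple_function_joint Z.simple) auto
      show "simple_function M (\<lambda>x. lshift g x \<in> sym_diff A (B A))"
        by (rule simple_function_lshift[OF s])
      show "joint Z {(g, A)} x = joint Z {(g, A)} y \<longleftrightarrow>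
          (lshift g x \<in> sym_diff A (B A)) = (lshift g y \<in> sym_diff A (B A))" for x y
        using that unfolding joint_eq_iff Z_def by simp
    qed
    also have "\<dots> = rv_entropy (distr M M (lshift g)) (\<lambda>x. x \<in> sym_diff A (B A))"
      by (rule rv_entropy_distr[OF measurable_lshift s, symmetric])
    also have "\<dots> \<le> d" using B(2)[OF that] by (simp only: invariant)
    finally show ?thesis .
  qed
  let ?o = "\<lambda>F. \<Sum>k\<in>K. real (card ((\<lambda>h. h + k) ` F - F))"
  have bound: "part_entropy P F \<le> pattern_entropy M F
      + c * ?o F + real (card F) * e" if "finite F" for F
  proof -
    \<comment> \<open>The coordinates read by the clopen approximations at the sites of
      \<open>F\<close>. What lies outside \<open>F\<close> is a boundary, negligible along a Folner
      sequence.\<close>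
    define L where "L = (\<Union>k\<in>K. (\<lambda>h. h + k) ` F)"
    have "finite L" using \<open>finite K\<close> that by (simp add: L_def)
    have fFP: "finite (F \<times> P)" using that P'(1) by simp
    have sL: "simple_function M (joint (\<lambda>g x. x g) L)"
      by (intro simple_function_joint simple_function_coordinate \<open>finite L\<close>)
    have sZ: "simple_function M (joint Z (F \<times> P))"
      by (intro simple_function_joint Z.simple fFP)
    have "part_entropy P F \<le> rv_entropy M (\<lambda>x. (joint (\<lambda>g x. x g) L x, joint Z (F \<times> P) x))"
    proof (rule rv_entropy_mono)
      show "simple_function M (\<lambda>x. (joint (\<lambda>g x. x g) L x, joint Z (F \<times> P) x))"
        by (intro simple_function_Pair sL sZ)
      show "simple_function M (joint (\<lambda>g x. cell P (lshift g x)) F)"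
        by (intro simple_function_joint Y.simple that)
      fix x y assume x: "x \<in> space M" and y: "y \<in> space M"
        and "(joint (\<lambda>g x. x g) L x, joint Z (F \<times> P) x) = (joint (\<lambda>g x. x g) L y, joint Z (F \<times> P) y)"
      then have L: "\<And>g. g \<in> L \<Longrightarrow> x g = y g"
        and Z: "\<And>g A. g \<in> F \<Longrightarrow> A \<in> P \<Longrightarrow> Z (g, A) x = Z (g, A) y"
        by (simp_all add: joint_eq_iff)
      have "cell P (lshift g x) = cell P (lshift g y)" if "g \<in> F" for g
      proof -
        define A where "A = cell P (lshift g x)"
        have xX: "lshift g x \<in> X" and yX: "lshift g y \<in> X"
          using x y lshift_in by (auto simp: space_M)
        have "A \<in> P" unfolding A_def by (rule cell_in[OF P'(3) xX])
        have xA: "lshift g x \<in> A" using cell_eq_iff[OF P'(3) \<open>A \<in> P\<close>] xX A_def by blast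
        have agree: "\<forall>h\<in>k A. lshift g x h = lshift g y h"
        proof
          fix h assume "h \<in> k A"
          then have "g + h \<in> L" using \<open>A \<in> P\<close> \<open>g \<in> F\<close> unfolding L_def K_def by blast
          then show "lshift g x h = lshift g y h" using L by (simp add: lshift_def)
        qed
        \<comment> \<open>Membership in \<open>B A\<close> and in its symmetric difference with
          \<open>A\<close> together decide membership in \<open>A\<close>.\<close>
        have "lshift g x \<in> B A \<longleftrightarrow> lshift g y \<in> B A"
          using k(2)[OF \<open>A \<in> P\<close>] agree xX yX unfolding determined_on_def by metis
        moreover have "lshift g x \<in> sym_diff A (B A) \<longleftrightarrow> lshift g y \<in> sym_diff A (B A)"
          using Z[OF \<open>g \<in> F\<close> \<open>A \<in> P\<close>] \<open>A \<in> P\<close> unfolding Z_def by simp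
        ultimately have "lshift g y \<in> A" using xA by blast
        then show ?thesis using cell_eq_iff[OF P'(3) \<open>A \<in> P\<close>] A_def by blast
      qed
      then show "joint (\<lambda>g x. cell P (lshift g x)) F x = joint (\<lambda>g x. cell P (lshift g x)) F y"
        by (simp add: joint_eq_iff)
    qed
    also have "\<dots> \<le> pattern_entropy M L + joint_entropy M Z (F \<times> P)"
      by (rule rv_entropy_Pair_le[OF sL sZ])
    also have "pattern_entropy M L \<le> pattern_entropy M F + pattern_entropy M (L - F)"
    proof -
      have "pattern_entropy M L \<le> pattern_entropy M (F \<union> (L - F))"
        using that \<open>finite L\<close> by (intro coords.h_mono) auto
      also have "\<dots> \<le> pattern_entropy M F + pattern_entropy M (L - F)"
        using that \<open>finite L\<close> by (intro coords.h_Un_le) auto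
      finally show ?thesis .
    qed
    also have "pattern_entropy M (L - F) \<le> c * ?o F"
    proof -
      have "pattern_entropy M (L - F) \<le> (\<Sum>i\<in>L - F. pattern_entropy M {i})"
        using \<open>finite L\<close> by (intro coords.h_le_sum) auto
      also have "\<dots> \<le> real (card (L - F)) * c" by (intro sum_bounded_above c)
      also have "real (card (L - F)) \<le> ?o F"
      proof -
        have "L - F = (\<Union>k\<in>K. (\<lambda>h. h + k) ` F - F)" unfolding L_def by blast
        then have "card (L - F) \<le> (\<Sum>k\<in>K. card ((\<lambda>h. h + k) ` F - F))"
          using card_UN_le[OF \<open>finite K\<close>] by metis
        then show ?thesis by (metis of_nat_le_iff of_nat_sum)
      qed
      finally show ?thesis using c by (simp add: mult_right_mono mult.commute)
    qed
    also have "joint_entropy M Z (F \<times> P) \<le> real (card F) * e"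
    proof -
      have "joint_entropy M Z (F \<times> P) \<le> (\<Sum>i\<in>F \<times> P. joint_entropy M Z {i})"
        by (rule Z.h_le_sum[OF fFP])
      also have "\<dots> \<le> real (card (F \<times> P)) * d" using single by (intro sum_bounded_above) auto
      also have "\<dots> = real (card F) * (real (card P) * d)" by (simp add: card_cartesian_product)
      also have "\<dots> \<le> real (card F) * e"
      proof (rule mult_left_mono)
        have "real (card P) * d \<le> (real (card P) + 1) * d" using \<open>0 < d\<close> by simp
        also have "\<dots> = e" by (simp add: d_def add_nonneg_eq_0_iff)
        finally show "real (card P) * d \<le> e" .
      qed simp
      finally show ?thesis .
    qed
    finally show ?thesis using c by (simp add: add_mono)
  qed
  let ?b = "\<lambda>n. pattern_entropy M (\<Phi> n) / real (card (\<Phi> n))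
      + c * (\<Sum>k\<in>K. real (card ((\<lambda>h. h + k) ` \<Phi> n - \<Phi> n)) / real (card (\<Phi> n))) + e"
  have fin: "finite (\<Phi> n)" "\<Phi> n \<noteq> {}" for n using \<Phi> by (auto simp: folner_seq_def)
  have l1: "(\<lambda>n. part_entropy P (\<Phi> n) / real (card (\<Phi> n))) \<longlonglongrightarrow> entropy_rate (part_entropy P)"
    by (rule entropy_rate_lim[OF Y.entropy_like_axioms part_entropy_translate[OF P] \<Phi>])
  have "(\<lambda>n. ?b n)
      \<longlonglongrightarrow> entropy_rate (pattern_entropy M) + c * (\<Sum>k\<in>K. 0) + e"
    by (intro tendsto_intros folner_seq_diff(1)[OF \<Phi>]
        entropy_rate_lim[OF coords.entropy_like_axioms pattern_entropy_translate \<Phi>])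
  then have l2: "(\<lambda>n. ?b n)
      \<longlonglongrightarrow> entropy_rate (pattern_entropy M) + e" by simp
  show "entropy_rate (part_entropy P) \<le> entropy_rate (pattern_entropy M) + e"
  proof (rule LIMSEQ_le[OF l1 l2], intro exI[of _ 0] allI impI)
    fix n
    have pos: "0 < real (card (\<Phi> n))" using fin[of n] by (simp add: card_gt_0_iff)
    have "part_entropy P (\<Phi> n) / real (card (\<Phi> n)) \<le> (pattern_entropy M (\<Phi> n)
      + c * ?o (\<Phi> n) + real (card (\<Phi> n)) * e) / real (card (\<Phi> n))"
      using pos by (intro divide_right_mono bound fin) auto
    also have "\<dots> = ?b n"
      unfolding sum_divide_distrib[symmetric] using pos by (simp add: add_divide_distrib)
    finally show "part_entropy P (\<Phi> n) / real (card (\<Phi> n)) \<le> ?b n" .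
  qed
qed

text \<open>The Kolmogorov-Sinai theorem for the partition by the symbol at 0: its joins over
  \<open>K\<close> carry the same information as the patterns on \<open>K\<close>, and no other
  finite partition has a larger rate.\<close>

lemma ks_entropy_eq:
  assumes am: "amenable TYPE('g)"
  shows "ks_entropy M = ereal (entropy_rate (pattern_entropy M))"
proof (rule antisym)
  obtain \<Phi> :: "nat \<Rightarrow> 'g set" where \<Phi>: "folner_seq \<Phi>" using am by (auto simp: amenable_def)
  show "ks_entropy M \<le> ereal (entropy_rate (pattern_entropy M))"
    unfolding ks_entropy_def
  proof (rule SUP_least)
    fix P assume "P \<in> {P. finite_partition M P}"
    then have P: "finite_partition M P" by simp
    show "ereal (entropy_wrt M P) \<le> ereal (entropy_rate (pattern_entropy M))"
      unfolding entropy_wrt_eq[OF am P] ereal_less_eq(3) by (rule part_entropy_rate_le[OF P \<Phi>])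
  qed
  \<comment> \<open>Only symbols that occur at 0 are taken, because a partition has no empty
    cell.\<close>
  define Q where "Q = (\<lambda>a. {x \<in> X. x (0::'g) = a}) ` ((\<lambda>x. x 0) ` X)"
  have pQ: "partition_on X Q"
  proof (rule partition_onI)
    show "\<Union>Q = X" unfolding Q_def by blast
    show "{} \<notin> Q" unfolding Q_def by blast
    fix A B assume "A \<in> Q" "B \<in> Q" "A \<noteq> B"
    obtain a b where AB: "A = {x \<in> X. x 0 = a}" "B = {x \<in> X. x 0 = b}"
      using \<open>A \<in> Q\<close> \<open>B \<in> Q\<close> unfolding Q_def by (elim imageE)
    have "A = B" if "y \<in> A" "y \<in> B" for y
    proof -
      have "y 0 = a" "y 0 = b" using that unfolding AB by simp_all
      then show ?thesis by (simp add: AB)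
    qed
    then show "disjnt A B" using \<open>A \<noteq> B\<close> unfolding disjnt_iff by metis
  qed
  have Q: "finite_partition M Q"
    unfolding finite_partition_def
  proof (intro conjI)
    show "finite Q" unfolding Q_def by (rule finite_imageI, rule finite_subset[of _ UNIV]) auto
    show "Q \<subseteq> sets M"
      using simple_function_fibre[OF simple_function_coordinate[of 0]] by (auto simp: Q_def space_M)
    show "partition_on (space M) Q" using pQ by (simp add: space_M)
  qed
  have pq: "cell Q x = {y \<in> X. y 0 = x 0}" if "x \<in> X" for x
  proof -
    have "{y \<in> X. y 0 = x 0} \<in> Q" using that unfolding Q_def by blast
    then show ?thesis using cell_eq_iff[OF pQ, of "{y \<in> X. y 0 = x 0}" x] that by simp
  qed
  have "part_entropy Q K = pattern_entropy M K" if "finite K" for K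
  proof (rule rv_entropy_cong)
    show "simple_function M (joint (\<lambda>g x. cell Q (lshift g x)) K)"
      by (intro simple_function_joint that simple_function_lshift[OF simple_function_cell[OF Q]])
    show "simple_function M (joint (\<lambda>g x. x g) K)"
      by (intro simple_function_joint that simple_function_coordinate)
    fix x y assume xy: "x \<in> space M" "y \<in> space M"
    have "cell Q (lshift g x) = cell Q (lshift g y) \<longleftrightarrow> x g = y g" for g
    proof -
      have X: "lshift g x \<in> X" "lshift g y \<in> X" using xy lshift_in by (auto simp: space_M)
      have "cell Q (lshift g x) = cell Q (lshift g y) \<longleftrightarrow> lshift g x 0 = lshift g y 0"
      proof
        assume eq: "cell Q (lshift g x) = cell Q (lshift g y)"
        have "lshift g x \<in> cell Q (lshift g x)" unfolding pq[OF X(1)] using X(1) by simp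
        then have "lshift g x \<in> {z \<in> X. z 0 = lshift g y 0}"
          unfolding eq pq[OF X(2)] .
        then show "lshift g x 0 = lshift g y 0" by simp
      next
        assume "lshift g x 0 = lshift g y 0"
        then show "cell Q (lshift g x) = cell Q (lshift g y)" by (simp only: pq[OF X(1)] pq[OF X(2)])
      qed
      then show ?thesis by (simp add: lshift_def)
    qed
    then show "joint (\<lambda>g x. cell Q (lshift g x)) K x = joint (\<lambda>g x. cell Q (lshift g x)) K y
        \<longleftrightarrow> joint (\<lambda>g x. x g) K x = joint (\<lambda>g x. x g) K y"
      by (simp add: joint_eq_iff)
  qed
  then have "entropy_rate (part_entropy Q) = entropy_rate (pattern_entropy M)"
    unfolding entropy_rate_def by (intro INF_cong) auto
  then have "ereal (entropy_rate (pattern_entropy M)) = ereal (entropy_wrt M Q)"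
    using entropy_wrt_eq[OF am Q] by simp
  also have "\<dots> \<le> ks_entropy M"
    unfolding ks_entropy_def using Q by (intro SUP_upper) auto
  finally show "ereal (entropy_rate (pattern_entropy M)) \<le> ks_entropy M" .
qed

end

subsection \<open>Cluster points of measures\<close>

lemma compact_box: "compact {f :: 'i \<Rightarrow> real. \<forall>i. f i \<in> {0..1}}"
proof -
  have "compactin (product_topology (\<lambda>i. euclidean) UNIV) (PiE UNIV (\<lambda>i::'i. {0..1::real}))"
    unfolding compactin_PiE by simp
  moreover have "PiE UNIV (\<lambda>i::'i. {0..1::real}) = {f. \<forall>i. f i \<in> {0..1}}" by auto
  ultimately show ?thesis by (simp add: euclidean_product_topology)
qed

text \<open>The index type may be uncountable, as for sets of configurations, where a product of
  intervals is compact but need not be sequentially compact. A filter finer than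
  \<open>sequentially\<close> therefore replaces a subsequence.\<close>

lemma cluster_filter:
  fixes f :: "nat \<Rightarrow> 'i \<Rightarrow> real"
  assumes "\<And>n i. f n i \<in> {0..1}"
  obtains F L where "F \<noteq> bot" "F \<le> sequentially" "\<And>i. ((\<lambda>n. f n i) \<longlongrightarrow> L i) F"
proof -
  have "filtermap f sequentially \<noteq> bot" by (simp add: filtermap_bot_iff)
  moreover have "eventually (\<lambda>x. x \<in> {f. \<forall>i. f i \<in> {0..1}}) (filtermap f sequentially)"
    using assms by (simp add: eventually_filtermap)
  ultimately obtain L where L: "inf (nhds L) (filtermap f sequentially) \<noteq> bot"
    using compact_box[where 'i='i, unfolded compact_filter] by blast
  \<comment> \<open>The neighbourhoods of the cluster point pulled back to indices; that this meets
    every tail is the cluster property.\<close>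
  define F where "F = inf sequentially (filtercomap f (nhds L))"
  have "F \<noteq> bot"
  proof
    assume "F = bot"
    then have "eventually (\<lambda>_. False) F" by simp
    then obtain P Q where P: "eventually P sequentially" and Q: "eventually Q (filtercomap f (nhds L))"
      and PQ: "\<And>n. P n \<Longrightarrow> Q n \<Longrightarrow> False"
      unfolding F_def eventually_inf by blast
    obtain R where R: "eventually R (nhds L)" "\<And>n. R (f n) \<Longrightarrow> Q n"
      using Q unfolding eventually_filtercomap by blast
    have "eventually (\<lambda>y. \<not> R y) (filtermap f sequentially)"
      unfolding eventually_filtermap using P by (rule eventually_mono) (use R(2) PQ in blast)
    then have "eventually (\<lambda>_. False) (inf (nhds L) (filtermap f sequentially))"
      unfolding eventually_inf using R(1) by blast
    then show False using L by (simp add: eventually_False)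
  qed
  moreover have "F \<le> sequentially" by (simp add: F_def)
  moreover have "((\<lambda>n. f n i) \<longlongrightarrow> L i) F" for i
  proof -
    have "filterlim f (nhds L) F"
      unfolding filterlim_iff_le_filtercomap by (simp add: F_def)
    then show ?thesis
      by (rule continuous_on_tendsto_compose[OF continuous_on_product_coordinates]) simp_all
  qed
  ultimately show ?thesis by (rule that)
qed

text \<open>By compactness a finitely additive function on clopen sets is automatically continuous
  at the empty set, the condition for its extension to a measure.\<close>

lemma decseq_clopens_empty:
  fixes X :: "('g \<Rightarrow> 'a::{finite, discrete_topology}) set"
  assumes X: "closed X" and A: "range A \<subseteq> clopens X" "decseq A" "(\<Inter>i. A i) = {}"
  obtains N where "A N = {}"
proof -
  have "\<exists>U. open U \<and> X - A i = X \<inter> U" for i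
  proof -
    have "A i \<in> clopens X" using A(1) by blast
    from clopens_open[OF clopens_compl[OF this]] show ?thesis by metis
  qed
  then obtain U where U: "\<And>i. open (U i)" "\<And>i. X - A i = X \<inter> U i" by metis
  have "X \<subseteq> (\<Union>i. U i)"
  proof
    fix x assume "x \<in> X"
    obtain i where "x \<notin> A i" using A(3) by blast
    then have "x \<in> X \<inter> U i" using \<open>x \<in> X\<close> U(2)[of i] by blast
    then show "x \<in> (\<Union>i. U i)" by blast
  qed
  then obtain D where D: "finite D" "X \<subseteq> (\<Union>i\<in>D. U i)"
    by (rule compactE_image[OF compact_closed_fun[OF X] U(1)])
  obtain N where N: "\<And>i. i \<in> D \<Longrightarrow> i \<le> N" using finite_nat_set_iff_bounded_le[of D] D(1) by blast
  have "A N = {}"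
  proof (rule equals0I)
    fix x assume x: "x \<in> A N"
    have "x \<in> X" using x clopens_subset A(1) by blast
    then obtain i where i: "i \<in> D" "x \<in> U i" using D(2) by blast
    have "x \<notin> A i" using U(2)[of i] i(2) \<open>x \<in> X\<close> by blast
    moreover have "A N \<subseteq> A i" using A(2) N[OF i(1)] by (rule decseqD)
    ultimately show False using x by blast
  qed
  then show ?thesis by (rule that)
qed

text \<open>Weak compactness of the probability measures on \<open>X\<close>. The limits on clopen
  sets form a finitely additive function, which Caratheodory's theorem extends.\<close>

lemma measure_cluster_point:
  fixes X :: "('g::countable \<Rightarrow> 'a::{finite, discrete_topology}) set"
  assumes X: "closed X" and M: "\<And>n. shift_measure (M n) X"
  obtains F \<nu> where "F \<noteq> bot" "F \<le> sequentially" "shift_measure \<nu> X"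
    "\<forall>A\<in>clopens X. ((\<lambda>n. measure (M n) A) \<longlongrightarrow> measure \<nu> A) F"
proof -
  have "measure (M n) A \<in> {0..1}" for n A
    using prob_space.prob_le_1[OF shift_measure.axioms(1)[OF M]] by simp
  then obtain F L where F: "F \<noteq> bot" "F \<le> sequentially" "\<And>A. ((\<lambda>n. measure (M n) A) \<longlongrightarrow> L A) F"
    by (rule cluster_filter[of "\<lambda>n A. measure (M n) A"]) blast
  have L0: "0 \<le> L A" for A
    by (rule tendsto_lowerbound[OF F(3)]) (simp_all add: F(1))
  have LE: "L {} = 0"
    by (rule tendsto_unique[OF F(1) F(3)]) simp
  have LX: "L X = 1"
  proof (rule tendsto_unique[OF F(1) F(3)])
    have "measure (M n) X = 1" for n
      using prob_space.prob_space[OF shift_measure.axioms(1)[OF M]] shift_measure.space_M[OF M] by metis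
    then show "((\<lambda>n. measure (M n) X) \<longlongrightarrow> 1) F" by simp
  qed
  have LU: "L (A \<union> B) = L A + L B" if "A \<in> clopens X" "B \<in> clopens X" "A \<inter> B = {}" for A B
  proof (rule tendsto_unique[OF F(1) F(3)])
    have "measure (M n) (A \<union> B) = measure (M n) A + measure (M n) B" for n
    proof -
      interpret shift_measure "M n" X by (rule M)
      show ?thesis using that clopens_sets by (intro finite_measure_Union) auto
    qed
    then show "((\<lambda>n. measure (M n) (A \<union> B)) \<longlongrightarrow> L A + L B) F"
      using tendsto_add[OF F(3) F(3)] by simp
  qed
  interpret A: algebra X "clopens X" by (rule algebra_clopens)
  obtain \<mu> where \<mu>: "\<And>A. A \<in> clopens X \<Longrightarrow> \<mu> A = ennreal (L A)" "measure_space X (sigma_sets X (clopens X)) \<mu>"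
  proof -
    have "\<exists>\<mu>. (\<forall>s\<in>clopens X. \<mu> s = ennreal (L s)) \<and> measure_space X (sigma_sets X (clopens X)) \<mu>"
    proof (rule A.caratheodory_empty_continuous)
      show "positive (clopens X) (\<lambda>s. ennreal (L s))" by (simp add: positive_def LE)
      show "additive (clopens X) (\<lambda>s. ennreal (L s))"
        unfolding additive_def by (simp add: LU L0 flip: ennreal_plus)
      fix A :: "nat \<Rightarrow> ('g \<Rightarrow> 'a) set"
      assume A: "range A \<subseteq> clopens X" "decseq A" "(\<Inter>i. A i) = {}"
      obtain N where N: "A N = {}" using decseq_clopens_empty[OF X A] .
      have "eventually (\<lambda>n. A n = {}) sequentially"
        unfolding eventually_sequentially using decseqD[OF A(2), of N] N by blast
      then have "eventually (\<lambda>n. ennreal (L (A n)) = 0) sequentially"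
        by (rule eventually_mono) (simp add: LE)
      then show "(\<lambda>n. ennreal (L (A n))) \<longlonglongrightarrow> 0" by (rule tendsto_eventually)
    qed simp
    then show ?thesis using that by blast
  qed
  define \<nu> where "\<nu> = measure_of X (sigma_sets X (clopens X)) \<mu>"
  have sp: "sigma_sets X (clopens X) \<subseteq> Pow X"
    using sigma_sets_into_sp[of "clopens X" X] clopens_subset by blast
  have sets: "sets \<nu> = sigma_sets X (clopens X)"
    unfolding \<nu>_def using sp by (simp add: sets_measure_of sigma_sets_sigma_sets_eq A.space_closed)
  have em: "emeasure \<nu> A = \<mu> A" if "A \<in> sigma_sets X (clopens X)" for A
    unfolding \<nu>_def using \<mu>(2) that by (intro emeasure_measure_of_sigma) (auto simp: measure_space_def)
  have mL: "measure \<nu> A = L A" if "A \<in> clopens X" for A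
    using em[OF sigma_sets.Basic[OF that]] \<mu>(1)[OF that] L0 by (simp add: measure_def)
  have space: "space \<nu> = X" unfolding \<nu>_def using sp by (simp add: space_measure_of)
  have "emeasure \<nu> (space \<nu>) = 1"
    using em[OF sigma_sets.Basic[OF clopens_space]] \<mu>(1)[OF clopens_space] LX by (simp add: space)
  then interpret prob_space \<nu> by (rule prob_spaceI)
  have "shift_measure \<nu> X"
    using X sets by unfold_locales (simp_all add: sets_restrict_borel_eq)
  then show ?thesis using that F mL by metis
qed

context shift_measure
begin

lemma integral_step:
  assumes K: "finite K"
  shows "(\<integral>x. c (restrict x K) \<partial>M) = (\<Sum>u\<in>(\<lambda>x. restrict x K) ` X. c u * prob {x \<in> X. restrict x K = u})"
    and "integrable M (\<lambda>x. c (restrict x K) :: real)"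
proof -
  let ?U = "(\<lambda>x. restrict x K) ` X"
  have "simple_function M (joint (\<lambda>g x. x g) K)"
    by (intro simple_function_joint simple_function_coordinate K)
  then have fU: "finite ?U" by (simp add: simple_function_def joint_coordinate space_M)
  have sets: "{x \<in> X. restrict x K = u} \<in> sets M" for u
    by (intro clopens_sets clopens_cylinder K)
  have eq: "c (restrict x K) = (\<Sum>u\<in>?U. c u * indicat_real {x \<in> X. restrict x K = u} x)" if "x \<in> space M" for x
  proof -
    have "(\<Sum>u\<in>?U. c u * indicat_real {x \<in> X. restrict x K = u} x) = (\<Sum>u\<in>?U. if u = restrict x K then c u else 0)"
      using that by (intro sum.cong refl) (simp add: indicator_def space_M eq_commute)
    also have "\<dots> = c (restrict x K)" using that fU by (simp add: space_M)
    finally show ?thesis by simp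
  qed
  have int: "integrable M (\<lambda>x. \<Sum>u\<in>?U. c u * indicat_real {x \<in> X. restrict x K = u} x)"
    using sets by (intro Bochner_Integration.integrable_sum integrable_mult_right integrable_real_indicator)
      (auto simp: less_top[symmetric])
  have "(\<integral>x. c (restrict x K) \<partial>M) = (\<integral>x. (\<Sum>u\<in>?U. c u * indicat_real {x \<in> X. restrict x K = u} x) \<partial>M)"
    by (intro Bochner_Integration.integral_cong refl eq)
  also have "\<dots> = (\<Sum>u\<in>?U. \<integral>x. c u * indicat_real {x \<in> X. restrict x K = u} x \<partial>M)"
    using sets by (intro Bochner_Integration.integral_sum integrable_mult_right integrable_real_indicator)
      (auto simp: less_top[symmetric])
  also have "\<dots> = (\<Sum>u\<in>?U. c u * prob {x \<in> X. restrict x K = u})"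
    using sets by simp
  finally show "(\<integral>x. c (restrict x K) \<partial>M) = (\<Sum>u\<in>?U. c u * prob {x \<in> X. restrict x K = u})" .
  show "integrable M (\<lambda>x. c (restrict x K))"
    using int by (subst Bochner_Integration.integrable_cong[OF refl eq])
qed

lemma integral_near:
  fixes f g :: "('g \<Rightarrow> 'a) \<Rightarrow> real"
  assumes "integrable M f" "integrable M g" "\<And>x. x \<in> X \<Longrightarrow> \<bar>f x - g x\<bar> \<le> e"
  shows "\<bar>(\<integral>x. f x \<partial>M) - (\<integral>x. g x \<partial>M)\<bar> \<le> e"
proof -
  have le: "f x - g x \<le> e" "g x - f x \<le> e" if "x \<in> X" for x using assms(3)[OF that] by linarith+
  have "(\<integral>x. f x - g x \<partial>M) \<le> e" "(\<integral>x. g x - f x \<partial>M) \<le> e"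
    using assms(1,2) le by (intro integral_le_const Bochner_Integration.integrable_diff AE_I2; simp add: space_M)+
  then show ?thesis using assms(1,2) by simp
qed

end

text \<open>Convergence on clopen sets handles functions of finitely many coordinates; \<phi> is
  uniformly within \<open>e / 3\<close> of such a function, for all the measures at once.\<close>

lemma tendsto_integral_cluster:
  fixes X :: "('g::countable \<Rightarrow> 'a::{finite, discrete_topology}) set" and \<phi> :: "('g \<Rightarrow> 'a) \<Rightarrow> real"
  assumes X: "closed X" and M: "\<And>n. shift_measure (M n) X" and \<nu>: "shift_measure \<nu> X"
    and lim: "\<And>A. A \<in> clopens X \<Longrightarrow> ((\<lambda>n. measure (M n) A) \<longlongrightarrow> measure \<nu> A) F"
    and \<phi>: "continuous_on X \<phi>"
  shows "((\<lambda>n. integral\<^sup>L (M n) \<phi>) \<longlongrightarrow> integral\<^sup>L \<nu> \<phi>) F"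
proof (rule tendstoI)
  fix e :: real assume "0 < e"
  then have e3: "0 < e / 3" by simp
  obtain K where K: "finite K" "\<And>x y. x \<in> X \<Longrightarrow> y \<in> X \<Longrightarrow> \<forall>g\<in>K. x g = y g \<Longrightarrow> \<bar>\<phi> x - \<phi> y\<bar> < e / 3"
    using uniform_local_approx[OF X \<phi> e3] by blast
  \<comment> \<open>The value of \<phi> at an arbitrary configuration continuing the pattern
    \<open>u\<close>.\<close>
  define c where "c u = \<phi> (SOME y. y \<in> X \<and> restrict y K = u)" for u
  let ?s = "\<lambda>N. \<Sum>u\<in>(\<lambda>x. restrict x K) ` X. c u * measure N {x \<in> X. restrict x K = u}"
  have near: "\<bar>\<phi> x - c (restrict x K)\<bar> \<le> e / 3" if "x \<in> X" for x
  proof -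
    define y where "y = (SOME y. y \<in> X \<and> restrict y K = restrict x K)"
    have y: "y \<in> X \<and> restrict y K = restrict x K"
      unfolding y_def by (rule someI[of _ x]) (simp add: that)
    then have "\<forall>g\<in>K. x g = y g" by (metis restrict_eq_iff)
    from K(2)[OF that _ this] y show ?thesis by (simp add: c_def y_def)
  qed
  have close: "\<bar>integral\<^sup>L N \<phi> - ?s N\<bar> \<le> e / 3"
    if "shift_measure N X" for N
  proof -
    interpret N: shift_measure N X by (rule that)
    show ?thesis
      unfolding N.integral_step(1)[OF K(1), symmetric]
      by (intro N.integral_near N.integrable_phi \<phi> N.integral_step(2) K(1) near)
  qed
  have "((\<lambda>n. ?s (M n)) \<longlongrightarrow> ?s \<nu>) F"
    by (intro tendsto_sum tendsto_mult tendsto_const lim clopens_cylinder K(1))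
  then have "eventually (\<lambda>n. dist (?s (M n)) (?s \<nu>) < e / 3) F"
    using e3 by (rule tendstoD)
  then show "eventually (\<lambda>n. dist (integral\<^sup>L (M n) \<phi>) (integral\<^sup>L \<nu> \<phi>) < e) F"
  proof (rule eventually_mono)
    fix n
    assume "dist (?s (M n)) (?s \<nu>) < e / 3"
    then show "dist (integral\<^sup>L (M n) \<phi>) (integral\<^sup>L \<nu> \<phi>) < e"
      using close[OF M[of n]] close[OF \<nu>] unfolding dist_real_def by argo
  qed
qed

text \<open>The index set of the sum does not depend on the measure, so limits of measures can be
  taken term by term.\<close>

lemma pattern_entropy_sum:
  assumes "shift_measure M X"
  shows "pattern_entropy M K = (\<Sum>u\<in>(\<lambda>x. restrict x K) ` X. eta (measure M {x \<in> X. restrict x K = u}))"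
  unfolding rv_entropy_def joint_coordinate shift_measure.space_M[OF assms] ..

lemma tendsto_pattern_entropy_cluster:
  fixes X :: "('g::countable \<Rightarrow> 'a::{finite, discrete_topology}) set"
  assumes M: "\<And>n. shift_measure (M n) X" and \<nu>: "shift_measure \<nu> X"
    and lim: "\<And>A. A \<in> clopens X \<Longrightarrow> ((\<lambda>n. measure (M n) A) \<longlongrightarrow> measure \<nu> A) F"
    and K: "finite K"
  shows "((\<lambda>n. pattern_entropy (M n) K) \<longlongrightarrow> pattern_entropy \<nu> K) F"
  unfolding pattern_entropy_sum[OF M] pattern_entropy_sum[OF \<nu>]
  by (intro tendsto_sum tendsto_eta lim clopens_cylinder K measure_nonneg)

subsection \<open>Mixtures\<close>

context shift_measure
begin

text \<open>The law of \<open>T i x\<close> for independent \<open>i\<close> and \<open>x\<close>. A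
  uniform \<open>i\<close> gives the averages over shifts, a Bernoulli \<open>i\<close> the random
  swap.\<close>

definition mixture :: "'i::countable pmf \<Rightarrow> ('i \<Rightarrow> ('g \<Rightarrow> 'a) \<Rightarrow> ('g \<Rightarrow> 'a)) \<Rightarrow> ('g \<Rightarrow> 'a) measure" where
  "mixture p T = distr (measure_pmf p \<Otimes>\<^sub>M M) M (\<lambda>(i, x). T i x)"

lemma measurable_mixture:
  assumes "\<And>i::'i::countable. T i \<in> measurable M M"
  shows "(\<lambda>(i, x). T i x) \<in> measurable (measure_pmf p \<Otimes>\<^sub>M M) M"
proof -
  have "(\<lambda>(i, x). T i x) \<in> measurable (count_space UNIV \<Otimes>\<^sub>M M) M"
    by (rule measurable_pair_measure_countable1) (simp_all add: assms)
  then show ?thesis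
    by (subst measurable_cong_sets[OF sets_pair_measure_cong[OF sets_measure_pmf_count_space refl] refl])
qed

lemma shift_measure_mixture:
  assumes "\<And>i::'i::countable. T i \<in> measurable M M"
  shows "shift_measure (mixture p T) X"
proof -
  interpret P: prob_space "measure_pmf p" by (rule prob_space_measure_pmf)
  interpret PM: pair_prob_space "measure_pmf p" M ..
  interpret N: prob_space "mixture p T"
    unfolding mixture_def by (rule PM.prob_space_distr[OF measurable_mixture[OF assms]])
  show ?thesis
    by unfold_locales (simp_all add: closed_X mixture_def sets_M)
qed

lemma integral_mixture:
  fixes f :: "('g \<Rightarrow> 'a) \<Rightarrow> real"
  assumes T: "\<And>i::'i::countable. T i \<in> measurable M M" and p: "finite (set_pmf p)"
    and f: "f \<in> borel_measurable M" "\<And>x. x \<in> X \<Longrightarrow> \<bar>f x\<bar> \<le> B"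
  shows "integral\<^sup>L (mixture p T) f = (\<Sum>i\<in>set_pmf p. pmf p i * (\<integral>x. f (T i x) \<partial>M))"
proof -
  interpret P: prob_space "measure_pmf p" by (rule prob_space_measure_pmf)
  interpret PM: pair_prob_space "measure_pmf p" M ..
  note m = measurable_mixture[OF T, where p=p]
  have fm: "(\<lambda>z. f (case z of (i, x) \<Rightarrow> T i x)) \<in> borel_measurable (measure_pmf p \<Otimes>\<^sub>M M)"
    by (rule measurable_compose[OF m f(1)])
  have int: "integrable (measure_pmf p \<Otimes>\<^sub>M M) (\<lambda>z. f (case z of (i, x) \<Rightarrow> T i x))"
  proof (rule PM.integrable_const_bound[where B=B])
    show "AE z in measure_pmf p \<Otimes>\<^sub>M M. norm (f (case z of (i, x) \<Rightarrow> T i x)) \<le> B"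
      using measurable_space[OF m] f(2) by (intro AE_I2) (simp add: space_M)
  qed (rule fm)
  have "integral\<^sup>L (mixture p T) f = (\<integral>z. f (case z of (i, x) \<Rightarrow> T i x) \<partial>(measure_pmf p \<Otimes>\<^sub>M M))"
    unfolding mixture_def by (rule integral_distr[OF m f(1)])
  also have "\<dots> = (\<integral>i. (\<integral>x. f (T i x) \<partial>M) \<partial>measure_pmf p)"
    using PM.integral_fst'[OF int] by simp
  also have "\<dots> = (\<Sum>i\<in>set_pmf p. pmf p i * (\<integral>x. f (T i x) \<partial>M))"
    by (subst integral_measure_pmf[OF p]) simp_all
  finally show ?thesis .
qed

lemma measure_mixture:
  assumes T: "\<And>i::'i::countable. T i \<in> measurable M M" and p: "finite (set_pmf p)"
    and A: "A \<in> sets M"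
  shows "measure (mixture p T) A = (\<Sum>i\<in>set_pmf p. pmf p i * prob {x \<in> X. T i x \<in> A})"
proof -
  interpret N: shift_measure "mixture p T" X by (rule shift_measure_mixture[OF T])
  have "A \<subseteq> X" using sets.sets_into_space[OF A] by (simp add: space_M)
  have AN: "A \<in> sets (mixture p T)" using A by (simp add: mixture_def)
  have "measure (mixture p T) A = integral\<^sup>L (mixture p T) (indicat_real A)"
    using \<open>A \<subseteq> X\<close> by (simp add: N.space_M Int_absorb2)
  also have "\<dots> = (\<Sum>i\<in>set_pmf p. pmf p i * (\<integral>x. indicat_real A (T i x) \<partial>M))"
    by (rule integral_mixture[OF T p, where B=1]) (use A in \<open>auto simp: indicator_def\<close>)
  also have "\<dots> = (\<Sum>i\<in>set_pmf p. pmf p i * prob {x \<in> X. T i x \<in> A})"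
  proof (intro sum.cong refl arg_cong2[of _ _ _ _ times])
    fix i
    have S: "{x \<in> X. T i x \<in> A} \<in> sets M"
      using measurable_sets[OF T A, of i] by (simp add: vimage_def space_M Int_def conj_commute)
    have "(\<integral>x. indicat_real A (T i x) \<partial>M) = (\<integral>x. indicat_real {x \<in> X. T i x \<in> A} x \<partial>M)"
      by (intro Bochner_Integration.integral_cong refl) (simp add: indicator_def space_M)
    also have "\<dots> = prob {x \<in> X. T i x \<in> A}" using S by (simp add: Int_absorb2 space_M)
    finally show "(\<integral>x. indicat_real A (T i x) \<partial>M) = prob {x \<in> X. T i x \<in> A}" .
  qed
  finally show ?thesis .
qed

end

subsection \<open>Averaging over the shifts\<close>

abbreviation shift_energy :: "('g::group_add \<Rightarrow> 'a) measure \<Rightarrow> (('g \<Rightarrow> 'a) \<Rightarrow> real) \<Rightarrow> 'g set \<Rightarrow> real" where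
  "shift_energy M \<phi> \<Phi> \<equiv> (\<Sum>h\<in>\<Phi>. \<integral>x. \<phi> (lshift h x) \<partial>M)"

lemma eta_le_1: "0 \<le> t \<Longrightarrow> eta t \<le> 1"
  using eta_le_tangent[of t 1] by simp

context shift_measure
begin

text \<open>A crude bound, but uniform in the measure: it controls the boundary term of Shearer's
  inequality along a whole sequence of measures.\<close>

lemma pattern_entropy_singleton_le: "pattern_entropy M {g} \<le> real CARD('a)"
proof -
  let ?U = "(\<lambda>x. restrict x {g}) ` X"
  have "?U \<subseteq> (\<lambda>a. restrict (\<lambda>_. a) {g}) ` UNIV"
  proof (rule image_subsetI)
    fix x
    show "restrict x {g} \<in> (\<lambda>a. restrict (\<lambda>_. a) {g}) ` UNIV"
      by (rule image_eqI[of _ _ "x g"]) (simp_all add: fun_eq_iff)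
  qed
  then have "card ?U \<le> card ((\<lambda>a::'a. restrict (\<lambda>_::'g. a) {g}) ` UNIV)"
    by (intro card_mono) auto
  also have "\<dots> \<le> CARD('a)" by (rule card_image_le) simp
  finally have card: "card ?U \<le> CARD('a)" .
  have "pattern_entropy M {g} \<le> real (card ?U) * 1"
    unfolding pattern_entropy_sum[OF shift_measure_axioms]
    by (intro sum_bounded_above eta_le_1 measure_nonneg)
  then show ?thesis using card by simp
qed

end

context subshift_measure
begin

abbreviation average :: "'g set \<Rightarrow> ('g \<Rightarrow> 'a) measure" where
  "average \<Phi> \<equiv> mixture (pmf_of_set \<Phi>) lshift"

context
  fixes \<Phi> :: "'g set"
  assumes \<Phi>: "finite \<Phi>" "\<Phi> \<noteq> {}"
begin

lemma measure_average:
  assumes "A \<in> sets M"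
  shows "measure (average \<Phi>) A = (\<Sum>h\<in>\<Phi>. prob {x \<in> X. lshift h x \<in> A}) / real (card \<Phi>)"
  using \<Phi> measure_mixture[OF measurable_lshift _ assms, of "pmf_of_set \<Phi>"]
  by (simp add: sum_divide_distrib)

lemma integral_average:
  fixes \<phi> :: "('g \<Rightarrow> 'a) \<Rightarrow> real"
  assumes "continuous_on X \<phi>"
  shows "integral\<^sup>L (average \<Phi>) \<phi> = shift_energy M \<phi> \<Phi> / real (card \<Phi>)"
proof -
  obtain B where "\<forall>x\<in>X. \<bar>\<phi> x\<bar> \<le> B" using bounded_phi[OF assms] by blast
  then have "integral\<^sup>L (average \<Phi>) \<phi> = (\<Sum>i\<in>set_pmf (pmf_of_set \<Phi>). pmf (pmf_of_set \<Phi>) i * (\<integral>x. \<phi> (lshift i x) \<partial>M))"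
    using \<Phi> by (intro integral_mixture[where B=B] measurable_lshift measurable_phi assms) auto
  then show ?thesis using \<Phi> by (simp add: sum_divide_distrib)
qed

lemma shift_measure_average: "shift_measure (average \<Phi>) X"
  by (rule shift_measure_mixture[OF measurable_lshift])

text \<open>The law of the pattern on \<open>K\<close> under the average is the mean of the laws on
  the translates \<open>h + K\<close>, and \<open>eta\<close> is concave.\<close>

lemma pattern_entropy_average:
  assumes K: "finite K"
  shows "(\<Sum>h\<in>\<Phi>. pattern_entropy M ((+) h ` K)) \<le> real (card \<Phi>) * pattern_entropy (average \<Phi>) K"
proof -
  let ?U = "(\<lambda>x. restrict x K) ` X"
  let ?m = "\<lambda>h u. prob {x \<in> X. restrict (lshift h x) K = u}"
  let ?a = "\<lambda>u. measure (average \<Phi>) {x \<in> X. restrict x K = u}"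
  have N: "0 < real (card \<Phi>)" using \<Phi> by (simp add: card_gt_0_iff)
  have sK: "simple_function M (\<lambda>x. restrict x K)"
  proof -
    have "simple_function M (joint (\<lambda>g x. x g) K)"
      by (intro simple_function_joint simple_function_coordinate K)
    then show ?thesis by (simp only: joint_coordinate)
  qed
  have fU: "finite ?U" using sK by (simp add: simple_function_def space_M)
  have H: "pattern_entropy M ((+) h ` K) = (\<Sum>u\<in>?U. eta (?m h u))" for h
  proof -
    have "pattern_entropy M ((+) h ` K) = rv_entropy M (\<lambda>x. restrict (lshift h x) K)"
    proof (rule rv_entropy_cong)
      show "simple_function M (joint (\<lambda>g x. x g) ((+) h ` K))"
        using K by (intro simple_function_joint simple_function_coordinate) auto
      show "simple_function M (\<lambda>x. restrict (lshift h x) K)" by (rule simple_function_lshift[OF sK])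
      fix x y assume "x \<in> space M" "y \<in> space M"
      show "joint (\<lambda>g x. x g) ((+) h ` K) x = joint (\<lambda>g x. x g) ((+) h ` K) y
          \<longleftrightarrow> restrict (lshift h x) K = restrict (lshift h y) K"
        unfolding joint_eq_iff restrict_eq_iff lshift_def by simp
    qed
    also have "\<dots> = (\<Sum>u\<in>?U. eta (prob {x \<in> space M. restrict (lshift h x) K = u}))"
      using lshift_in by (intro rv_entropy_eq fU) (auto simp: space_M)
    finally show ?thesis by (simp only: space_M)
  qed
  have m: "?a u
      = (\<Sum>h\<in>\<Phi>. (1 / real (card \<Phi>)) * ?m h u)" for u
  proof -
    have "{x \<in> X. lshift h x \<in> {x \<in> X. restrict x K = u}} = {x \<in> X. restrict (lshift h x) K = u}" for h
      using lshift_in by blast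
    then show ?thesis
      using measure_average[OF clopens_sets[OF clopens_cylinder[OF K, of X u]]] by (simp add: sum_divide_distrib)
  qed
  have "(\<Sum>h\<in>\<Phi>. pattern_entropy M ((+) h ` K))
      = (\<Sum>u\<in>?U. \<Sum>h\<in>\<Phi>. eta (?m h u))"
    unfolding H by (rule sum.swap)
  also have "\<dots> \<le> (\<Sum>u\<in>?U. real (card \<Phi>) * eta (?a u))"
  proof (rule sum_mono)
    fix u
    have "(\<Sum>h\<in>\<Phi>. (1 / real (card \<Phi>)) * eta (?m h u))
        \<le> eta (?a u)"
      unfolding m using N \<Phi> by (intro eta_concave) auto
    then have "real (card \<Phi>) * (\<Sum>h\<in>\<Phi>. (1 / real (card \<Phi>)) * eta (?m h u))
        \<le> real (card \<Phi>) * eta (?a u)"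
      using N by (intro mult_left_mono) auto
    then show "(\<Sum>h\<in>\<Phi>. eta (?m h u))
        \<le> real (card \<Phi>) * eta (?a u)"
      using N by (simp add: sum_divide_distrib[symmetric])
  qed
  also have "\<dots> = real (card \<Phi>) * pattern_entropy (average \<Phi>) K"
    unfolding pattern_entropy_sum[OF shift_measure_average] by (simp add: sum_distrib_left)
  finally show ?thesis .
qed

text \<open>Since \<open>lshift g\<close> after \<open>lshift h\<close> is
  \<open>lshift (h + g)\<close>, the two averages are sums over \<Phi> and its right translate by
  \<open>g\<close>; the common terms cancel and the others lie between 0 and 1.\<close>

lemma average_almost_invariant:
  assumes A: "A \<in> sets M"
  shows "\<bar>measure (average \<Phi>) {x \<in> X. lshift g x \<in> A} - measure (average \<Phi>) A\<bar>
    \<le> real (card (sym_diff ((\<lambda>h. h + g) ` \<Phi>) \<Phi>)) / real (card \<Phi>)"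
proof -
  define a where "a h = prob {x \<in> X. lshift h x \<in> A}" for h
  have a: "0 \<le> a h" "a h \<le> 1" for h by (simp_all add: a_def)
  have N: "0 < real (card \<Phi>)" using \<Phi> by (simp add: card_gt_0_iff)
  let ?G = "(\<lambda>h. h + g) ` \<Phi>"
  have "{x \<in> X. lshift g x \<in> A} \<in> sets M"
    using measurable_sets[OF measurable_lshift A, of g] by (simp add: vimage_def space_M Int_def conj_commute)
  then have "measure (average \<Phi>) {x \<in> X. lshift g x \<in> A}
      = (\<Sum>h\<in>\<Phi>. prob {x \<in> X. lshift h x \<in> {x \<in> X. lshift g x \<in> A}}) / real (card \<Phi>)"
    by (rule measure_average)
  also have "(\<Sum>h\<in>\<Phi>. prob {x \<in> X. lshift h x \<in> {x \<in> X. lshift g x \<in> A}}) = (\<Sum>h\<in>\<Phi>. a (h + g))"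
  proof (rule sum.cong[OF refl])
    fix h
    have "{x \<in> X. lshift h x \<in> {x \<in> X. lshift g x \<in> A}} = {x \<in> X. lshift (h + g) x \<in> A}"
      using lshift_in by (simp add: lshift_lshift cong: conj_cong)
    then show "prob {x \<in> X. lshift h x \<in> {x \<in> X. lshift g x \<in> A}} = a (h + g)"
      by (simp only: a_def)
  qed
  also have "\<dots> = (\<Sum>h\<in>?G. a h)"
    by (subst sum.reindex) (auto simp: inj_on_def)
  finally have "measure (average \<Phi>) {x \<in> X. lshift g x \<in> A} = (\<Sum>h\<in>?G. a h) / real (card \<Phi>)" .
  moreover have "measure (average \<Phi>) A = (\<Sum>h\<in>\<Phi>. a h) / real (card \<Phi>)"
    using measure_average[OF A] by (simp add: a_def)
  ultimately have eq: "measure (average \<Phi>) {x \<in> X. lshift g x \<in> A} - measure (average \<Phi>) A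
      = ((\<Sum>h\<in>?G. a h) - (\<Sum>h\<in>\<Phi>. a h)) / real (card \<Phi>)"
    by (simp add: diff_divide_distrib)
  have G: "finite ?G" using \<Phi> by simp
  have s1: "(\<Sum>h\<in>?G. a h) = (\<Sum>h\<in>?G \<inter> \<Phi>. a h) + (\<Sum>h\<in>?G - \<Phi>. a h)"
    by (rule sum.Int_Diff[OF G])
  have s2: "(\<Sum>h\<in>\<Phi>. a h) = (\<Sum>h\<in>?G \<inter> \<Phi>. a h) + (\<Sum>h\<in>\<Phi> - ?G. a h)"
    using sum.Int_Diff[OF \<Phi>(1), of a ?G] by (simp add: Int_commute)
  have b1: "0 \<le> (\<Sum>h\<in>?G - \<Phi>. a h)" "0 \<le> (\<Sum>h\<in>\<Phi> - ?G. a h)" using a by (auto intro: sum_nonneg)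
  have b2: "(\<Sum>h\<in>?G - \<Phi>. a h) \<le> real (card (?G - \<Phi>)) * 1" "(\<Sum>h\<in>\<Phi> - ?G. a h) \<le> real (card (\<Phi> - ?G)) * 1"
    using a by (intro sum_bounded_above; simp)+
  have c: "card (sym_diff ?G \<Phi>) = card (?G - \<Phi>) + card (\<Phi> - ?G)"
    using G \<Phi> by (intro card_Un_disjoint) auto
  have "\<bar>(\<Sum>h\<in>?G. a h) - (\<Sum>h\<in>\<Phi>. a h)\<bar> \<le> real (card (sym_diff ?G \<Phi>))"
    using s1 s2 b1 b2 c by simp
  then show ?thesis unfolding eq using N by (simp add: abs_divide divide_right_mono)
qed

end

end

section \<open>Invariance of the limit and its pressure\<close>

lemma invariant_measures_iff:
  fixes X :: "('g::{group_add, countable} \<Rightarrow> 'a::{finite, discrete_topology}) set"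
  assumes "subshift X"
  shows "\<mu> \<in> invariant_measures X \<longleftrightarrow> invariant_measure \<mu> X"
  using assms
  by (auto simp: invariant_measures_def invariant_measure_def invariant_measure_axioms_def
      subshift_measure_def subshift_measure_axioms_def shift_measure_def shift_measure_axioms_def subshift_def)

lemma invariant_measureI:
  fixes X :: "('g::{group_add, countable} \<Rightarrow> 'a::{finite, discrete_topology}) set"
  assumes X: "subshift X" and \<nu>: "shift_measure \<nu> X"
    and inv: "\<And>g A. A \<in> clopens X \<Longrightarrow> measure \<nu> {x \<in> X. lshift g x \<in> A} = measure \<nu> A"
  shows "invariant_measure \<nu> X"
proof -
  interpret \<nu>: shift_measure \<nu> X by (rule \<nu>)
  interpret \<nu>: subshift_measure \<nu> X by unfold_locales (rule X)
  have "distr \<nu> \<nu> (lshift g) = \<nu>" for g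
  proof (rule measure_eqI_generator_eq[where E="clopens X" and \<Omega>=X and A="\<lambda>_. X"])
    show "Int_stable (clopens X)" by (rule Int_stableI) (rule clopens_Int)
    show "clopens X \<subseteq> Pow X" using clopens_subset by blast
    show "sets (distr \<nu> \<nu> (lshift g)) = sigma_sets X (clopens X)" "sets \<nu> = sigma_sets X (clopens X)"
      by (simp_all add: \<nu>.sets_M_sigma)
    show "range (\<lambda>_. X) \<subseteq> clopens X" using clopens_space by blast
    show "emeasure (distr \<nu> \<nu> (lshift g)) X \<noteq> \<infinity>" for i :: nat
      using \<nu>.measurable_lshift \<nu>.clopens_sets[OF clopens_space] by (simp add: emeasure_distr \<nu>.emeasure_eq_measure)
    fix A assume A: "A \<in> clopens X"
    have "lshift g -` A \<inter> space \<nu> = {x \<in> X. lshift g x \<in> A}" by (auto simp: \<nu>.space_M)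
    then show "emeasure (distr \<nu> \<nu> (lshift g)) A = emeasure \<nu> A"
      using inv[OF A] by (simp add: emeasure_distr[OF \<nu>.measurable_lshift \<nu>.clopens_sets[OF A]] \<nu>.emeasure_eq_measure)
  qed simp
  then show ?thesis by unfold_locales
qed

lemma clopens_lshift:
  fixes X :: "('g::group_add \<Rightarrow> 'a) set"
  assumes "A \<in> clopens X" "\<And>x. x \<in> X \<Longrightarrow> lshift g x \<in> X"
  shows "{x \<in> X. lshift g x \<in> A} \<in> clopens X"
proof -
  obtain K where K: "finite K" "determined_on X K A" using assms(1) by (auto simp: clopens_def)
  show ?thesis
  proof (rule clopensI[of "(+) g ` K"])
    show "determined_on X ((+) g ` K) {x \<in> X. lshift g x \<in> A}"
      unfolding determined_on_def
    proof (intro conjI ballI impI)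
      fix x y assume x: "x \<in> {x \<in> X. lshift g x \<in> A}" and y: "y \<in> X" and eq: "\<forall>h\<in>(+) g ` K. x h = y h"
      have "\<forall>h\<in>K. lshift g x h = lshift g y h" using eq unfolding lshift_def by blast
      then have "lshift g y \<in> A"
        using K(2) x assms(2)[OF y] unfolding determined_on_def by blast
      then show "y \<in> {x \<in> X. lshift g x \<in> A}" using y by blast
    qed blast
  qed (use K in simp)
qed

text \<open>
  The averages of measures with large entropy and energy over a Folner sequence accumulate at an
  invariant measure; Shearer's inequality and concavity bound its entropy from below.
\<close>

lemma equilibrium_entropy_bound:
  fixes X :: "('g::{group_add, countable} \<Rightarrow> 'a::{finite, discrete_topology}) set"
    and \<phi> :: "('g \<Rightarrow> 'a) \<Rightarrow> real"
  assumes am: "amenable TYPE('g)" and X: "subshift X" and \<phi>: "continuous_on X \<phi>"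
    and eq: "equilibrium_state X \<phi> \<mu>" and \<Phi>: "folner_seq \<Phi>"
    and N: "\<And>n. shift_measure (N n) X" and "0 < c"
    and large: "eventually (\<lambda>n. real (card (\<Phi> n)) * (entropy_rate (pattern_entropy \<mu>) + integral\<^sup>L \<mu> \<phi> + c)
      \<le> pattern_entropy (N n) (\<Phi> n) + shift_energy (N n) \<phi> (\<Phi> n)) sequentially"
  shows False
proof -
  have fin: "finite (\<Phi> n)" "\<Phi> n \<noteq> {}" for n using \<Phi> by (auto simp: folner_seq_def)
  have cX: "closed X" using X by (simp add: subshift_def)
  have N': "subshift_measure (N n) X" for n
    using N X by (simp add: subshift_measure_def subshift_measure_axioms_def)
  define \<nu>n where "\<nu>n n = shift_measure.mixture (N n) (pmf_of_set (\<Phi> n)) lshift" for n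
  have \<nu>n: "shift_measure (\<nu>n n) X" for n
    unfolding \<nu>n_def by (rule subshift_measure.shift_measure_average[OF N' fin])
  obtain F \<nu> where F: "F \<noteq> bot" "F \<le> sequentially" and \<nu>: "shift_measure \<nu> X"
    and lims: "\<forall>A\<in>clopens X. ((\<lambda>n. measure (\<nu>n n) A) \<longlongrightarrow> measure \<nu> A) F"
    by (rule measure_cluster_point[OF cX, of \<nu>n, OF \<nu>n])
  have lim: "((\<lambda>n. measure (\<nu>n n) A) \<longlongrightarrow> measure \<nu> A) F" if "A \<in> clopens X" for A
    using lims that by blast
  have \<nu>inv: "invariant_measure \<nu> X"
  proof (rule invariant_measureI[OF X \<nu>])
    fix g and A :: "('g \<Rightarrow> 'a) set" assume A: "A \<in> clopens X"
    have lX: "lshift g x \<in> X" if "x \<in> X" for x using X that by (auto simp: subshift_def)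
    have B: "{x \<in> X. lshift g x \<in> A} \<in> clopens X" by (rule clopens_lshift[OF A lX])
    let ?d = "\<lambda>n. measure (\<nu>n n) {x \<in> X. lshift g x \<in> A} - measure (\<nu>n n) A"
    have "?d \<longlonglongrightarrow> 0"
    proof (rule Lim_null_comparison[OF always_eventually])
      show "(\<lambda>n. real (card (sym_diff ((\<lambda>h. h + g) ` \<Phi> n) (\<Phi> n))) / real (card (\<Phi> n))) \<longlonglongrightarrow> 0"
        using \<Phi> by (simp add: folner_seq_def)
      show "\<forall>n. norm (?d n)
          \<le> real (card (sym_diff ((\<lambda>h. h + g) ` \<Phi> n) (\<Phi> n))) / real (card (\<Phi> n))"
        unfolding \<nu>n_def real_norm_def
        using subshift_measure.average_almost_invariant[OF N' fin shift_measure.clopens_sets[OF N A]] by blast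
    qed
    then have "(?d \<longlongrightarrow> 0) F"
      by (rule tendsto_mono[OF F(2)])
    moreover have "(?d
        \<longlongrightarrow> measure \<nu> {x \<in> X. lshift g x \<in> A} - measure \<nu> A) F"
      by (intro tendsto_diff lim A B)
    ultimately show "measure \<nu> {x \<in> X. lshift g x \<in> A} = measure \<nu> A"
      using tendsto_unique[OF F(1)] by fastforce
  qed
  define l where "l = entropy_rate (pattern_entropy \<mu>) + integral\<^sup>L \<mu> \<phi> + c"
  have int: "((\<lambda>n. integral\<^sup>L (\<nu>n n) \<phi>) \<longlongrightarrow> integral\<^sup>L \<nu> \<phi>) F"
    by (rule tendsto_integral_cluster[OF cX \<nu>n \<nu> lim \<phi>])
  \<comment> \<open>The rate is an infimum over finite sets, so one \<open>K\<close> can be fixed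
    before the limit is taken.\<close>
  have "l - integral\<^sup>L \<nu> \<phi> \<le> entropy_rate (pattern_entropy \<nu>)"
  proof (rule entropy_rate_ge)
    fix K :: "'g set" assume K: "finite K" "K \<noteq> {}"
    define r where "r n = (\<Sum>k\<in>K. real (card ((\<lambda>g. g - k) ` \<Phi> n - \<Phi> n)) / real (card (\<Phi> n)))" for n
    have "r \<longlonglongrightarrow> (\<Sum>k\<in>K. 0)"
      unfolding r_def by (intro tendsto_sum folner_seq_diff_minus \<Phi>)
    then have r: "(r \<longlongrightarrow> 0) F" using tendsto_mono[OF F(2)] by simp
    have k: "0 < real (card K)" using K by (simp add: card_gt_0_iff)
    let ?h = "\<lambda>n. pattern_entropy (\<nu>n n) K / real (card K) + r n * real CARD('a) + integral\<^sup>L (\<nu>n n) \<phi>"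
    have lim2: "((\<lambda>n. ?h n)
        \<longlongrightarrow> pattern_entropy \<nu> K / real (card K) + 0 * real CARD('a) + integral\<^sup>L \<nu> \<phi>) F"
      using k by (intro tendsto_intros r int tendsto_pattern_entropy_cluster[OF \<nu>n \<nu> lim K(1)]) auto
    have "eventually (\<lambda>n. l \<le> ?h n) sequentially"
      using large
    proof (rule eventually_mono)
      fix n
      assume n: "real (card (\<Phi> n)) * (entropy_rate (pattern_entropy \<mu>) + integral\<^sup>L \<mu> \<phi> + c)
        \<le> pattern_entropy (N n) (\<Phi> n) + shift_energy (N n) \<phi> (\<Phi> n)"
      interpret Nn: subshift_measure "N n" X by (rule N')
      define m where "m = real (card (\<Phi> n))"
      have m: "0 < m" using fin[of n] by (simp add: m_def card_gt_0_iff)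
      have R: "(\<Sum>k\<in>K. real (card ((\<lambda>g. g - k) ` \<Phi> n - \<Phi> n))) = r n * m"
        using m by (simp add: r_def sum_distrib_right m_def)
      \<comment> \<open>\<open>N n\<close> need not be invariant, so the translates of
        \<open>K\<close> have different entropies. Concavity then bounds their sum by the entropy of
        the averaged measure on \<open>K\<close>.\<close>
      have "real (card K) * pattern_entropy (N n) (\<Phi> n)
          \<le> (\<Sum>g\<in>\<Phi> n. pattern_entropy (N n) ((+) g ` K)) + (r n * m) * (real (card K) * real CARD('a))"
        unfolding R[symmetric]
        by (rule folner_shearer[OF Nn.coords.entropy_like_axioms fin(1) K(1)])
          (simp_all add: Nn.pattern_entropy_singleton_le)
      also have "(\<Sum>g\<in>\<Phi> n. pattern_entropy (N n) ((+) g ` K)) \<le> m * pattern_entropy (\<nu>n n) K"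
        unfolding m_def \<nu>n_def by (rule Nn.pattern_entropy_average[OF fin K(1)])
      finally have "real (card K) * pattern_entropy (N n) (\<Phi> n)
          \<le> real (card K) * (m * (pattern_entropy (\<nu>n n) K / real (card K) + r n * real CARD('a)))"
        using k by (simp add: algebra_simps)
      then have "pattern_entropy (N n) (\<Phi> n) \<le> m * (pattern_entropy (\<nu>n n) K / real (card K) + r n * real CARD('a))"
        using k by (simp only: mult_le_cancel_left_pos)
      moreover have "shift_energy (N n) \<phi> (\<Phi> n) = m * integral\<^sup>L (\<nu>n n) \<phi>"
        using Nn.integral_average[OF fin \<phi>] m by (simp add: \<nu>n_def m_def)
      ultimately have "m * l \<le> m * (?h n)"
        using n unfolding m_def[symmetric] l_def[symmetric] by (simp only: distrib_left)
      then show "l \<le> ?h n"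
        using m by (simp only: mult_le_cancel_left_pos)
    qed
    then have "eventually (\<lambda>n. l \<le> ?h n) F"
      by (rule filter_leD[OF F(2)])
    then have "l \<le> pattern_entropy \<nu> K / real (card K) + 0 * real CARD('a) + integral\<^sup>L \<nu> \<phi>"
      by (rule tendsto_lowerbound[OF lim2 _ F(1)])
    then show "l - integral\<^sup>L \<nu> \<phi> \<le> pattern_entropy \<nu> K / real (card K)" by simp
  qed
  moreover have "entropy_rate (pattern_entropy \<nu>) + integral\<^sup>L \<nu> \<phi> \<le> entropy_rate (pattern_entropy \<mu>) + integral\<^sup>L \<mu> \<phi>"
  proof -
    have "invariant_measure \<mu> X"
      using eq invariant_measures_iff[OF X] by (simp add: equilibrium_state_def)
    then have "ks_entropy \<mu> = ereal (entropy_rate (pattern_entropy \<mu>))"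
      by (rule invariant_measure.ks_entropy_eq[OF _ am])
    moreover have "ks_entropy \<nu> = ereal (entropy_rate (pattern_entropy \<nu>))"
      by (rule invariant_measure.ks_entropy_eq[OF \<nu>inv am])
    moreover have "ks_entropy \<nu> + ereal (integral\<^sup>L \<nu> \<phi>) \<le> ks_entropy \<mu> + ereal (integral\<^sup>L \<mu> \<phi>)"
      using eq \<nu>inv invariant_measures_iff[OF X] by (simp add: equilibrium_state_def)
    ultimately show ?thesis by simp
  qed
  ultimately show False using \<open>0 < c\<close> by (simp add: l_def)
qed

subsection \<open>The entropy gained by replacing a frequent pattern\<close>

text \<open>Mass \<open>e * a\<close> moves from an atom of mass \<open>a\<close> to one of mass
  \<open>b\<close>. Tangents at the new masses \<open>A\<close> and \<open>B\<close> bound the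
  entropy change below by \<open>e * a * (ln A - ln B)\<close>. Linearising the logarithm of
  \<open>A / B\<close> around a reference ratio \<open>t\<close> leaves a correction that is linear
  in \<open>a\<close> and \<open>b\<close> and so can be summed over atoms.\<close>

lemma eta_transfer:
  assumes a: "0 \<le> a" and b: "0 \<le> b" and e: "0 < e" "e < 1" and t: "0 < t"
  shows "e * a * ln t + e * (a - t * (b + e * a) / (1 - e))
    \<le> (eta ((1 - e) * a) - eta a) + (eta (b + e * a) - eta b)"
proof (cases "a = 0")
  case True
  have "0 \<le> e * (t * b / (1 - e))" using b e t by simp
  then show ?thesis using True by simp
next
  case False
  then have "0 < a" using a by simp
  define A where "A = (1 - e) * a"
  define B where "B = b + e * a"
  have A: "0 < A" using \<open>0 < a\<close> e by (simp add: A_def)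
  have B: "0 < B" using \<open>0 < a\<close> b e by (simp add: B_def add_nonneg_pos)
  have eA: "eta A = - (A * ln A)" and eB: "eta B = - (B * ln B)" by (simp_all add: eta_def)
  have h1: "e * a * ln A + e * a \<le> eta A - eta a"
    using eta_le_tangent[OF a A] unfolding eA by (simp add: A_def algebra_simps)
  have h2: "- (e * a * ln B) - e * a \<le> eta B - eta b"
    using eta_le_tangent[OF b B] unfolding eB by (simp add: B_def algebra_simps)
  have "ln (t * B / A) \<le> t * B / A - 1"
    using A B t by (intro ln_le_minus_one) simp
  then have "ln t + 1 - t * B / A \<le> ln A - ln B"
    using A B t by (simp add: ln_div ln_mult)
  then have "(e * a) * (ln t + 1 - t * B / A) \<le> (e * a) * (ln A - ln B)"
    using e \<open>0 < a\<close> by (intro mult_left_mono) auto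
  moreover have "(e * a) * (ln t + 1 - t * B / A) = e * a * ln t + e * (a - t * B / (1 - e))"
  proof -
    have "a * (t * B / A) = t * B / (1 - e)" using \<open>0 < a\<close> e by (simp add: A_def field_simps)
    moreover have "(e * a) * (ln t + 1 - t * B / A) = e * a * ln t + e * (a - a * (t * B / A))"
      by (simp only: right_diff_distrib distrib_left mult.assoc mult_1_right)
    ultimately show ?thesis by (simp only:)
  qed
  moreover have "(e * a) * (ln A - ln B) = e * a * ln A - e * a * ln B" by (simp only: right_diff_distrib)
  ultimately have "e * a * ln t + e * (a - t * B / (1 - e)) \<le> (eta A - eta a) + (eta B - eta b)"
    using h1 h2 by linarith
  then show ?thesis by (simp only: A_def B_def)
qed

text \<open>The ratios of individual masses \<open>m u\<close> and \<open>m (t u)\<close> are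
  uncontrolled; only the totals satisfy the condition with \<tau>. This suffices because the summed
  correction depends on the totals alone, as in the log-sum inequality.\<close>

lemma eta_sum_transfer:
  assumes U: "finite U" "V \<subseteq> U" and t: "inj_on t V" "t ` V \<subseteq> U - V" and m: "\<And>u. 0 \<le> m u"
    and e: "0 < e" "e < 1" and \<tau>: "0 < \<tau>"
    and q: "(\<Sum>u\<in>V. m (t u)) \<le> q" and le: "\<tau> * (q + e * (\<Sum>u\<in>V. m u)) \<le> (1 - e) * (\<Sum>u\<in>V. m u)"
    and m': "\<And>u. u \<in> V \<Longrightarrow> m' u = (1 - e) * m u" "\<And>u. u \<in> V \<Longrightarrow> m' (t u) = m (t u) + e * m u"
      "\<And>u. u \<in> U - V - t ` V \<Longrightarrow> m' u = m u"
  shows "(\<Sum>u\<in>U. eta (m u)) + e * (\<Sum>u\<in>V. m u) * ln \<tau> \<le> (\<Sum>u\<in>U. eta (m' u))"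
proof -
  define p where "p = (\<Sum>u\<in>V. m u)"
  have fV: "finite V" using U finite_subset by blast
  have split: "(\<Sum>u\<in>U. f u) = (\<Sum>u\<in>V. f u + f (t u)) + (\<Sum>u\<in>U - V - t ` V. f u)" for f :: "_ \<Rightarrow> real"
  proof -
    have "(\<Sum>u\<in>U. f u) = (\<Sum>u\<in>U - V. f u) + (\<Sum>u\<in>V. f u)"
      using U by (intro sum.subset_diff) auto
    also have "(\<Sum>u\<in>U - V. f u) = (\<Sum>u\<in>U - V - t ` V. f u) + (\<Sum>u\<in>t ` V. f u)"
      using U t by (intro sum.subset_diff) auto
    also have "(\<Sum>u\<in>t ` V. f u) = (\<Sum>u\<in>V. f (t u))" using sum.reindex[OF t(1), of f] by simp
    finally show ?thesis by (simp add: sum.distrib)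
  qed
  \<comment> \<open>The summed correction is nonnegative: this is where \<open>q\<close> and
    \<open>le\<close> enter.\<close>
  have "e * p * ln \<tau> \<le> e * p * ln \<tau> + e * (p - \<tau> * ((\<Sum>u\<in>V. m (t u)) + e * p) / (1 - e))"
  proof -
    have "\<tau> * ((\<Sum>u\<in>V. m (t u)) + e * p) \<le> \<tau> * (q + e * p)"
      using q \<tau> by (intro mult_left_mono) auto
    also have "\<dots> \<le> p * (1 - e)" using le by (simp add: p_def mult.commute)
    finally have "\<tau> * ((\<Sum>u\<in>V. m (t u)) + e * p) / (1 - e) \<le> p"
      using e by (simp add: pos_divide_le_eq)
    then show ?thesis using e by simp
  qed
  also have "\<dots> = (\<Sum>u\<in>V. e * m u * ln \<tau> + e * (m u - \<tau> * (m (t u) + e * m u) / (1 - e)))"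
  proof -
    have s1: "(\<Sum>u\<in>V. e * m u * ln \<tau>) = e * p * ln \<tau>"
      unfolding p_def sum_distrib_left sum_distrib_right ..
    have s2: "(\<Sum>u\<in>V. \<tau> * (m (t u) + e * m u) / (1 - e)) = \<tau> * ((\<Sum>u\<in>V. m (t u)) + e * p) / (1 - e)"
      unfolding p_def sum_distrib_left sum.distrib[symmetric] sum_divide_distrib ..
    have s3: "(\<Sum>u\<in>V. e * (m u - \<tau> * (m (t u) + e * m u) / (1 - e)))
        = e * (p - \<tau> * ((\<Sum>u\<in>V. m (t u)) + e * p) / (1 - e))"
      unfolding sum_distrib_left[symmetric] sum_subtractf s2 p_def ..
    show ?thesis unfolding sum.distrib s1 s3 ..
  qed
  also have "\<dots> \<le> (\<Sum>u\<in>V. (eta ((1 - e) * m u) - eta (m u)) + (eta (m (t u) + e * m u) - eta (m (t u))))"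
    by (intro sum_mono eta_transfer m e \<tau>)
  also have "\<dots> = (\<Sum>u\<in>V. eta (m' u) + eta (m' (t u))) - (\<Sum>u\<in>V. eta (m u) + eta (m (t u)))"
    by (simp add: m'(1,2) sum_subtractf[symmetric] algebra_simps)
  also have "\<dots> = (\<Sum>u\<in>U. eta (m' u)) - (\<Sum>u\<in>U. eta (m u))"
    unfolding split[of "\<lambda>u. eta (m u)"] split[of "\<lambda>u. eta (m' u)"]
    by (simp add: m'(3))
  finally show ?thesis by (simp add: p_def)
qed

subsection \<open>Swapping patterns\<close>

text \<open>One direction of \<open>pattern_swap\<close>, conjugated to the site \<open>g\<close>:
  \<open>v\<close> becomes \<open>w\<close>, but not conversely, so mass flows only from
  \<open>v\<close> to \<open>w\<close>.\<close>

definition swap_at :: "'g::group_add set \<Rightarrow> ('g \<Rightarrow> 'a) \<Rightarrow> ('g \<Rightarrow> 'a) \<Rightarrow> 'g \<Rightarrow> ('g \<Rightarrow> 'a) \<Rightarrow> 'g \<Rightarrow> 'a" where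
  "swap_at F v w g x = (if restrict (lshift g x) F = v then lshift (- g) (glue F w (lshift g x)) else x)"

lemma swap_at_outside:
  assumes "h \<notin> (+) g ` F"
  shows "swap_at F v w g x h = x h"
proof -
  have "- g + h \<notin> F"
  proof
    assume "- g + h \<in> F"
    then have "g + (- g + h) \<in> (+) g ` F" by (rule imageI)
    then show False using assms by simp
  qed
  then show ?thesis by (simp add: swap_at_def lshift_def glue_def)
qed

lemma swap_at_local:
  assumes "\<forall>k\<in>(+) g ` F \<union> {h}. x k = y k"
  shows "swap_at F v w g x h = swap_at F v w g y h"
proof -
  have "\<forall>k\<in>F. lshift g x k = lshift g y k" using assms unfolding lshift_def by blast
  then have "restrict (lshift g x) F = restrict (lshift g y) F" by (simp only: restrict_eq_iff)
  moreover have "x h = y h" using assms by blast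
  ultimately show ?thesis by (simp add: swap_at_def lshift_def glue_def)
qed

lemma lshift_swap_at:
  assumes "restrict (lshift g x) F = v"
  shows "lshift g (swap_at F v w g x) = glue F w (lshift g x)"
  using assms by (simp add: swap_at_def lshift_lshift) (simp add: lshift_def)

locale pattern_pair =
  fixes X :: "('g::{group_add, countable} \<Rightarrow> 'a::{finite, discrete_topology}) set" and F v w
  assumes shift_X: "subshift X" and finite_F: "finite F"
    and v: "v \<in> language F X" and w: "w \<in> language F X" and neq: "v \<noteq> w"
    and ext: "extender_set X F v \<subseteq> extender_set X F w"
begin

text \<open>The one place where the inclusion of extender sets is applied: whatever surrounds
  \<open>v\<close> in \<open>X\<close> may also surround \<open>w\<close>.\<close>

lemma glue_in:
  assumes y: "y \<in> X" "restrict y F = v"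
  shows "glue F w y \<in> X" and "pattern_swap X F v w y = glue F w y" and "restrict (glue F w y) F = w"
proof -
  have eq: "glue F w (restrict y (- F)) = glue F w y" by (auto simp: glue_def fun_eq_iff)
  have "glue F v (restrict y (- F)) = y"
    unfolding y(2)[symmetric] by (auto simp: glue_def fun_eq_iff)
  then have "restrict y (- F) \<in> extender_set X F v" using y(1) by (simp add: extender_set_def)
  then have "restrict y (- F) \<in> extender_set X F w" using ext by blast
  then show *: "glue F w y \<in> X" by (simp add: extender_set_def eq)
  show "pattern_swap X F v w y = glue F w y"
    using y * by (simp add: pattern_swap_def cylinder_def eq)
  obtain z where "w = restrict z F" using w by (auto simp: language_def)
  then show "restrict (glue F w y) F = w" by (auto simp: glue_def fun_eq_iff)
qed

text \<open>Over the empty set there is only one pattern, so distinct patterns need a nonempty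
  \<open>F\<close>.\<close>

lemma F_nonempty: "F \<noteq> {}"
  using v w neq by (auto simp: language_def)

abbreviation swap :: "'g \<Rightarrow> ('g \<Rightarrow> 'a) \<Rightarrow> 'g \<Rightarrow> 'a" where
  "swap \<equiv> swap_at F v w"

lemma lshift_X: "x \<in> X \<Longrightarrow> lshift g x \<in> X"
  using shift_X by (auto simp: subshift_def)

lemma swap_in: "x \<in> X \<Longrightarrow> swap g x \<in> X"
  using glue_in(1) lshift_X by (auto simp: swap_at_def)

abbreviation occ :: "'g \<Rightarrow> ('g \<Rightarrow> 'a) \<Rightarrow> ('g \<Rightarrow> 'a) set" where
  "occ g u \<equiv> {x \<in> X. restrict (lshift g x) F = u}"

lemma occ_swap: "x \<in> occ g v \<Longrightarrow> swap g x \<in> occ g w"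
  using glue_in(3)[OF lshift_X] swap_in by (simp add: lshift_swap_at)

lemma swap_notin: "x \<in> X \<Longrightarrow> swap g x \<notin> occ g v"
  using occ_swap[of x g] neq by (cases "x \<in> occ g v") (auto simp: swap_at_def)

lemma occ_cong:
  assumes "\<forall>k\<in>(+) g ` F. x k = y k"
  shows "restrict (lshift g x) F = restrict (lshift g y) F"
  using assms unfolding restrict_eq_iff lshift_def by blast

lemma clopen_occ: "occ g u \<in> clopens X"
proof (rule clopensI[of "(+) g ` F"])
  show "determined_on X ((+) g ` F) (occ g u)"
    unfolding determined_on_def
  proof (intro conjI ballI impI)
    fix x y assume "x \<in> occ g u" "y \<in> X" "\<forall>k\<in>(+) g ` F. x k = y k"
    then show "y \<in> occ g u" using occ_cong[of g x y] by simp
  qed blast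
qed (simp add: finite_F)

end

locale swap_measure = subshift_measure M X + pattern_pair X F v w
  for M :: "('g::{group_add, countable} \<Rightarrow> 'a::{finite, discrete_topology}) measure" and X F v w
begin

lemma measurable_swap: "swap g \<in> measurable M M"
proof (rule measurable_into[OF swap_in])
  fix h
  show "simple_function M (\<lambda>x. swap g x h)"
  proof (rule simple_function_local[of "(+) g ` F \<union> {h}"])
    show "finite ((+) g ` F \<union> {h})" using finite_F by simp
    show "finite ((\<lambda>x. swap g x h) ` X)" by (rule finite_subset[OF subset_UNIV]) simp
    fix x y :: "'g \<Rightarrow> 'a" assume "\<forall>k\<in>(+) g ` F \<union> {h}. x k = y k"
    then show "swap g x h = swap g y h" by (rule swap_at_local)
  qed
qed

definition swapped :: "real \<Rightarrow> 'g \<Rightarrow> ('g \<Rightarrow> 'a) measure" where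
  "swapped e g = mixture (bernoulli_pmf e) (\<lambda>b. if b then swap g else (\<lambda>x. x))"

lemma measurable_swapped: "(if b then swap g else (\<lambda>x. x)) \<in> measurable M M"
  using measurable_swap by simp

lemma shift_measure_swapped: "shift_measure (swapped e g) X"
  unfolding swapped_def by (rule shift_measure_mixture[OF measurable_swapped])

context
  fixes e :: real
  assumes e: "0 < e" "e < 1"
begin

lemma measure_swapped:
  assumes A: "A \<in> sets M"
  shows "measure (swapped e g) A = e * prob {x \<in> X. swap g x \<in> A} + (1 - e) * prob A"
proof -
  have "A \<subseteq> X" using sets.sets_into_space[OF A] by (simp add: space_M)
  then have "{x \<in> X. x \<in> A} = A" by blast
  moreover have "measure (swapped e g) A = (\<Sum>b\<in>set_pmf (bernoulli_pmf e). pmf (bernoulli_pmf e) b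
      * prob {x \<in> X. (if b then swap g else (\<lambda>x. x)) x \<in> A})"
    unfolding swapped_def by (rule measure_mixture[OF measurable_swapped _ A]) simp
  ultimately show ?thesis using e by (simp add: set_pmf_bernoulli UNIV_bool)
qed

lemma integral_swapped:
  fixes f :: "('g \<Rightarrow> 'a) \<Rightarrow> real"
  assumes f: "f \<in> borel_measurable M" "\<And>x. x \<in> X \<Longrightarrow> \<bar>f x\<bar> \<le> B"
  shows "integral\<^sup>L (swapped e g) f = e * (\<integral>x. f (swap g x) \<partial>M) + (1 - e) * integral\<^sup>L M f"
proof -
  have "integral\<^sup>L (swapped e g) f = (\<Sum>b\<in>set_pmf (bernoulli_pmf e). pmf (bernoulli_pmf e) b
      * (\<integral>x. f ((if b then swap g else (\<lambda>x. x)) x) \<partial>M))"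
    unfolding swapped_def by (rule integral_mixture[OF measurable_swapped _ f]) simp_all
  then show ?thesis using e by (simp add: set_pmf_bernoulli UNIV_bool)
qed

text \<open>A swap at \<open>g\<close> does not touch a disjoint window; this keeps the
  probabilities of \<open>v\<close> and \<open>w\<close> available at later sites.\<close>

lemma swapped_occ:
  assumes "(+) g' ` F \<inter> (+) g ` F = {}"
  shows "measure (swapped e g) (occ g' u) = prob (occ g' u)"
proof -
  have eq: "{x \<in> X. swap g x \<in> occ g' u} = occ g' u"
  proof -
    have "restrict (lshift g' (swap g x)) F = restrict (lshift g' x) F" for x
      using assms by (intro occ_cong ballI swap_at_outside) blast
    then show ?thesis using swap_in by auto
  qed
  show ?thesis unfolding measure_swapped[OF clopens_sets[OF clopen_occ]] eq by (simp add: algebra_simps)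
qed

text \<open>On the finite set of patterns on \<Phi> the swap is a map \<open>t\<close>, injective on
  the patterns \<open>V\<close> that show \<open>v\<close> at \<open>g\<close>, with values among
  those that show \<open>w\<close>. Each member of \<open>V\<close> passes the fraction
  \<open>e\<close> of its mass to its own image, the situation of
  \<open>eta_sum_transfer\<close>.\<close>

lemma pattern_entropy_swapped:
  assumes \<Phi>: "finite \<Phi>" "(+) g ` F \<subseteq> \<Phi>" and "0 < \<tau>"
    and le: "\<tau> * (prob (occ g w) + e * prob (occ g v)) \<le> (1 - e) * prob (occ g v)"
  shows "pattern_entropy M \<Phi> + e * prob (occ g v) * ln \<tau> \<le> pattern_entropy (swapped e g) \<Phi>"
proof -
  let ?r = "\<lambda>x. restrict x \<Phi>"
  let ?U = "?r ` X"
  define V where "V = ?r ` occ g v"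
  define t where "t u = ?r (swap g u)" for u
  define m where "m u = prob {x \<in> X. ?r x = u}" for u
  define m' where "m' u = measure (swapped e g) {x \<in> X. ?r x = u}" for u
  have cyl: "{x \<in> X. ?r x = u} \<in> sets M" for u
    by (rule clopens_sets[OF clopens_cylinder[OF \<Phi>(1)]])
  have fU: "finite ?U"
  proof -
    have "simple_function M (joint (\<lambda>g x. x g) \<Phi>)"
      by (intro simple_function_joint simple_function_coordinate \<Phi>(1))
    then show ?thesis by (simp add: simple_function_def joint_coordinate space_M)
  qed
  have agree: "\<forall>k\<in>\<Phi>. ?r x k = x k" for x :: "'g \<Rightarrow> 'a" by simp
  \<comment> \<open>Since \<open>g + F\<close> lies inside \<Phi>, the swap can be carried out on
    the restricted pattern.\<close>
  have tr: "t (?r x) = ?r (swap g x)" for x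
    unfolding t_def restrict_eq_iff
  proof
    fix h assume "h \<in> \<Phi>"
    then show "swap g (?r x) h = swap g x h"
      using \<Phi>(2) by (intro swap_at_local ballI) auto
  qed
  have occr: "x \<in> occ g u \<longleftrightarrow> y \<in> occ g u" if "x \<in> X" "y \<in> X" "?r x = ?r y" for x y u
  proof -
    have "\<forall>k\<in>\<Phi>. x k = y k" using that(3) by (simp only: restrict_eq_iff)
    then have "restrict (lshift g x) F = restrict (lshift g y) F" using \<Phi>(2) by (intro occ_cong) blast
    then show ?thesis using that by simp
  qed
  have inV: "?r x \<in> V \<longleftrightarrow> x \<in> occ g v" if "x \<in> X" for x
    unfolding V_def using occr[OF that] that by blast
  have tV: "t ` V \<subseteq> ?U - V"
  proof
    fix u assume "u \<in> t ` V"
    then obtain x where x: "x \<in> occ g v" "u = ?r (swap g x)" unfolding V_def using tr by auto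
    then have "swap g x \<in> X" "swap g x \<notin> occ g v" using swap_in swap_notin by blast+
    then show "u \<in> ?U - V" using inV x(2) by blast
  qed
  have tW: "?r ` occ g w \<supseteq> t ` V"
    unfolding V_def using tr occ_swap by auto
  \<comment> \<open>Outside the window the swap changes nothing; inside it, both originals show
    \<open>v\<close>.\<close>
  have inj: "inj_on t V"
  proof (rule inj_onI)
    fix u u' assume "u \<in> V" "u' \<in> V" and eq: "t u = t u'"
    then obtain x y where x: "x \<in> occ g v" "u = ?r x" and y: "y \<in> occ g v" "u' = ?r y"
      unfolding V_def by blast
    have sw: "\<forall>h\<in>\<Phi>. swap g x h = swap g y h"
      using eq unfolding x(2) y(2) tr restrict_eq_iff .
    have oc: "restrict (lshift g x) F = restrict (lshift g y) F" using x(1) y(1) by simp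
    show "u = u'"
      unfolding x(2) y(2) restrict_eq_iff
    proof
      fix h assume h: "h \<in> \<Phi>"
      show "x h = y h"
      proof (cases "h \<in> (+) g ` F")
        case True
        then obtain k where k: "k \<in> F" "h = g + k" by blast
        have "lshift g x k = lshift g y k" using oc k(1) unfolding restrict_eq_iff by blast
        then show ?thesis by (simp add: k(2) lshift_def)
      next
        case False
        then show ?thesis using sw h swap_at_outside[OF False, where v=v and w=w] by metis
      qed
    qed
  qed
  have sum_m: "(\<Sum>u\<in>W. m u) = prob {x \<in> X. ?r x \<in> W}" if "finite W" for W
  proof -
    have "{x \<in> X. ?r x \<in> W} = (\<Union>u\<in>W. {x \<in> X. ?r x = u})" by blast
    moreover have "prob (\<Union>u\<in>W. {x \<in> X. ?r x = u}) = (\<Sum>u\<in>W. m u)"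
      unfolding m_def using that cyl
      by (intro finite_measure_finite_Union) (auto simp: disjoint_family_on_def)
    ultimately show ?thesis by (simp only:)
  qed
  have fV: "finite V" unfolding V_def by (rule finite_subset[OF _ fU]) blast
  have p: "(\<Sum>u\<in>V. m u) = prob (occ g v)"
  proof -
    have "{x \<in> X. ?r x \<in> V} = occ g v" using inV by blast
    then show ?thesis by (simp only: sum_m[OF fV])
  qed
  have q: "(\<Sum>u\<in>V. m (t u)) \<le> prob (occ g w)"
  proof -
    have "(\<Sum>u\<in>V. m (t u)) = (\<Sum>u\<in>t ` V. m u)" using sum.reindex[OF inj, of m] by simp
    also have "\<dots> = prob {x \<in> X. ?r x \<in> t ` V}" by (rule sum_m) (simp add: fV)
    also have "\<dots> \<le> prob (occ g w)"
    proof (rule finite_measure_mono)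
      show "{x \<in> X. ?r x \<in> t ` V} \<subseteq> occ g w"
      proof (rule subsetI)
        fix x assume "x \<in> {x \<in> X. ?r x \<in> t ` V}"
        then have "x \<in> X" "?r x \<in> ?r ` occ g w" using tW by blast+
        then obtain y where "y \<in> occ g w" "?r x = ?r y" by blast
        then show "x \<in> occ g w" using occr[of x y w] \<open>x \<in> X\<close> by blast
      qed
    qed (rule clopens_sets[OF clopen_occ])
    finally show ?thesis .
  qed
  have m'_eq: "m' u = e * prob {x \<in> X. t (?r x) = u} + (1 - e) * m u" for u
  proof -
    have "{x \<in> X. swap g x \<in> {x \<in> X. ?r x = u}} = {x \<in> X. t (?r x) = u}"
      using swap_in tr by auto
    then show ?thesis unfolding m'_def m_def measure_swapped[OF cyl] by simp
  qed
  have t_id: "t u = u" if u: "u \<in> ?U - V" for u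
  proof -
    obtain x where x: "x \<in> X" "u = ?r x" using u by blast
    then have "x \<notin> occ g v" using u inV by blast
    then have "swap g x = x" using x(1) by (simp add: swap_at_def)
    then show ?thesis using tr[of x] x(2) by simp
  qed
  have "(\<Sum>u\<in>?U. eta (m u)) + e * (\<Sum>u\<in>V. m u) * ln \<tau> \<le> (\<Sum>u\<in>?U. eta (m' u))"
  proof (rule eta_sum_transfer[OF fU _ inj tV _ e \<open>0 < \<tau>\<close> q])
    show "V \<subseteq> ?U" unfolding V_def by blast
    show "\<tau> * (prob (occ g w) + e * (\<Sum>u\<in>V. m u)) \<le> (1 - e) * (\<Sum>u\<in>V. m u)"
      using le by (simp only: p)
    show "0 \<le> m u" for u by (simp add: m_def)
  next
    fix u assume u: "u \<in> V"
    have emp: "{x \<in> X. t (?r x) = u} = {}"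
    proof (rule equals0I)
      fix x assume x: "x \<in> {x \<in> X. t (?r x) = u}"
      then have "?r (swap g x) \<in> V" using tr u by simp
      then show False using inV[OF swap_in] swap_notin x by blast
    qed
    show "m' u = (1 - e) * m u" unfolding m'_eq emp by simp
    have tu: "t u \<in> ?U - V" using tV u by blast
    \<comment> \<open>The image \<open>t u\<close> is reached from itself, being outside
      \<open>V\<close> and hence fixed, and from the single element \<open>u\<close> of
      \<open>V\<close>.\<close>
    have "{x \<in> X. t (?r x) = t u} = {x \<in> X. ?r x \<in> {t u, u}}"
    proof (intro Collect_cong conj_cong refl iffI)
      fix x assume x: "x \<in> X" "t (?r x) = t u"
      show "?r x \<in> {t u, u}"
      proof (cases "?r x \<in> V")
        case True
        then show ?thesis using inj_onD[OF inj x(2) True u] by simp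
      next
        case False
        then show ?thesis using t_id[of "?r x"] x by simp
      qed
    next
      fix x assume "x \<in> X" "?r x \<in> {t u, u}"
      then show "t (?r x) = t u" using t_id[OF tu] by auto
    qed
    moreover have "prob {x \<in> X. ?r x \<in> {t u, u}} = m (t u) + m u"
    proof -
      have "t u \<noteq> u" using tu u by (metis DiffD2)
      then show ?thesis using sum_m[of "{t u, u}"] by simp
    qed
    ultimately show "m' (t u) = m (t u) + e * m u"
      unfolding m'_eq by (simp add: algebra_simps)
  next
    fix u assume u: "u \<in> ?U - V - t ` V"
    have "{x \<in> X. t (?r x) = u} = {x \<in> X. ?r x = u}"
    proof (intro Collect_cong conj_cong refl iffI)
      fix x assume x: "x \<in> X" "t (?r x) = u"
      have "?r x \<notin> V" using x(2) u by blast
      then show "?r x = u" using t_id[of "?r x"] x by simp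
    next
      fix x assume "x \<in> X" "?r x = u"
      then show "t (?r x) = u" using t_id u by blast
    qed
    then show "m' u = m u" unfolding m'_eq m_def by (simp add: algebra_simps)
  qed
  then show ?thesis
    unfolding pattern_entropy_sum[OF shift_measure_axioms] pattern_entropy_sum[OF shift_measure_swapped]
    unfolding p unfolding m_def m'_def .
qed

text \<open>Only configurations showing \<open>v\<close> at \<open>g\<close> change, with
  probability \<open>e\<close>, and each such change loses at most \<open>D\<close>.\<close>

lemma energy_swapped:
  fixes \<phi> :: "('g \<Rightarrow> 'a) \<Rightarrow> real"
  assumes \<phi>: "continuous_on X \<phi>" and \<Phi>: "finite \<Phi>"
    and D: "\<And>x. x \<in> occ g v \<Longrightarrow> (\<Sum>h\<in>\<Phi>. \<phi> (lshift h x) - \<phi> (lshift h (swap g x))) \<le> D"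
  shows "shift_energy M \<phi> \<Phi> - e * prob (occ g v) * D
    \<le> shift_energy (swapped e g) \<phi> \<Phi>"
proof -
  interpret N: shift_measure "swapped e g" X by (rule shift_measure_swapped)
  interpret N: subshift_measure "swapped e g" X by unfold_locales (rule shift_X)
  obtain B where B: "\<forall>x\<in>X. \<bar>\<phi> x\<bar> \<le> B" using bounded_phi[OF \<phi>] by blast
  define f where "f x = (\<Sum>h\<in>\<Phi>. \<phi> (lshift h x))" for x
  have mf: "f \<in> borel_measurable M"
    unfolding f_def
    by (intro borel_measurable_sum measurable_compose[OF measurable_lshift] measurable_phi \<phi>)
  have bf: "\<bar>f x\<bar> \<le> real (card \<Phi>) * B" if "x \<in> X" for x
  proof -
    have "\<bar>f x\<bar> \<le> (\<Sum>h\<in>\<Phi>. \<bar>\<phi> (lshift h x)\<bar>)" unfolding f_def by (rule sum_abs)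
    also have "\<dots> \<le> real (card \<Phi>) * B" using B lshift_in[OF that] by (intro sum_bounded_above) blast
    finally show ?thesis .
  qed
  have int_f: "integrable M f"
    by (rule integrable_const_bound[where B="real (card \<Phi>) * B"]) (use bf mf in \<open>auto simp: space_M\<close>)
  have mfs: "(\<lambda>x. f (swap g x)) \<in> borel_measurable M" by (rule measurable_compose[OF measurable_swap mf])
  have int_fs: "integrable M (\<lambda>x. f (swap g x))"
    by (rule integrable_const_bound[where B="real (card \<Phi>) * B"]) (use bf swap_in mfs in \<open>auto simp: space_M\<close>)
  have comp: "integrable K (\<lambda>x. \<phi> (lshift h x))" if "subshift_measure K X" for h K
  proof -
    interpret K: subshift_measure K X by (rule that)
    show ?thesis
      by (rule K.integrable_const_bound[where B=B])
        (use B K.lshift_in measurable_compose[OF K.measurable_lshift K.measurable_phi[OF \<phi>]] in \<open>auto simp: K.space_M\<close>)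
  qed
  have EM: "shift_energy M \<phi> \<Phi> = integral\<^sup>L M f"
    unfolding f_def using comp[OF subshift_measure_axioms] by (simp add: Bochner_Integration.integral_sum)
  have EN: "shift_energy (swapped e g) \<phi> \<Phi> = integral\<^sup>L (swapped e g) f"
    unfolding f_def using comp[OF N.subshift_measure_axioms] by (simp add: Bochner_Integration.integral_sum)
  have os: "occ g v \<in> sets M" by (rule clopens_sets[OF clopen_occ])
  have "integral\<^sup>L M f - (\<integral>x. f (swap g x) \<partial>M) = (\<integral>x. f x - f (swap g x) \<partial>M)"
    using int_f int_fs by simp
  also have "\<dots> \<le> (\<integral>x. D * indicat_real (occ g v) x \<partial>M)"
  proof (rule integral_mono)
    show "integrable M (\<lambda>x. f x - f (swap g x))" using int_f int_fs by simp
    show "integrable M (\<lambda>x. D * indicat_real (occ g v) x)"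
      using os by (intro integrable_mult_right integrable_real_indicator) (auto simp: less_top[symmetric])
    fix x assume x: "x \<in> space M"
    show "f x - f (swap g x) \<le> D * indicat_real (occ g v) x"
    proof (cases "x \<in> occ g v")
      case True
      then show ?thesis using D[OF True] by (simp add: f_def sum_subtractf)
    next
      case False
      then have "swap g x = x" using x by (simp add: swap_at_def space_M)
      then show ?thesis using False by simp
    qed
  qed
  also have "\<dots> = D * prob (occ g v)" using os by (simp add: Int_absorb2 space_M)
  finally have "e * (integral\<^sup>L M f - (\<integral>x. f (swap g x) \<partial>M)) \<le> e * (D * prob (occ g v))"
    using e by (intro mult_left_mono) auto
  moreover have "integral\<^sup>L (swapped e g) f = e * (\<integral>x. f (swap g x) \<partial>M) + (1 - e) * integral\<^sup>L M f"
    by (rule integral_swapped[OF mf bf])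
  ultimately show ?thesis
    unfolding EM EN by (simp add: algebra_simps)
qed

end

end

context pattern_pair
begin

text \<open>The last conjunct is the induction invariant: at every site whose window avoids all
  treated windows, \<open>v\<close> and \<open>w\<close> still have probabilities \<open>p\<close>
  and \<open>q\<close>. Hence the hypothesis \<open>le\<close> applies unchanged to each new
  site.\<close>

lemma swap_iterate:
  fixes \<phi> :: "('g \<Rightarrow> 'a) \<Rightarrow> real"
  assumes M: "shift_measure M X" and \<phi>: "continuous_on X \<phi>"
    and p: "\<And>g. measure M (occ g v) = p" and q: "\<And>g. measure M (occ g w) = q"
    and e: "0 < e" "e < 1" and \<tau>: "0 < \<tau>" and le: "\<tau> * (q + e * p) \<le> (1 - e) * p"
    and \<Phi>: "finite \<Phi>" and "finite C"
    and C: "\<And>g. g \<in> C \<Longrightarrow> (+) g ` F \<subseteq> \<Phi>"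
      "\<And>g g'. g \<in> C \<Longrightarrow> g' \<in> C \<Longrightarrow> g \<noteq> g' \<Longrightarrow> (+) g ` F \<inter> (+) g' ` F = {}"
      "\<And>g x. g \<in> C \<Longrightarrow> x \<in> occ g v \<Longrightarrow> (\<Sum>h\<in>\<Phi>. \<phi> (lshift h x) - \<phi> (lshift h (swap g x))) \<le> D"
  shows "\<exists>N. shift_measure N X
    \<and> pattern_entropy M \<Phi> + shift_energy M \<phi> \<Phi> + real (card C) * (e * p * (ln \<tau> - D))
      \<le> pattern_entropy N \<Phi> + shift_energy N \<phi> \<Phi>
    \<and> (\<forall>g. (\<forall>g'\<in>C. (+) g ` F \<inter> (+) g' ` F = {}) \<longrightarrow> measure N (occ g v) = p \<and> measure N (occ g w) = q)"
    (is "?P C")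
  using \<open>finite C\<close> C
proof (induction C rule: finite_induct)
  case empty
  show ?case by (intro exI[of _ M] conjI allI impI M p q) simp
next
  case (insert g C)
  have "?P C"
  proof (rule insert.IH)
    show "(+) g ` F \<subseteq> \<Phi>" if "g \<in> C" for g
      by (rule insert.prems(1)[OF insertI2[OF that]])
    show "(+) g ` F \<inter> (+) g' ` F = {}" if "g \<in> C" "g' \<in> C" "g \<noteq> g'" for g g'
      by (rule insert.prems(2)[OF insertI2[OF that(1)] insertI2[OF that(2)] that(3)])
    show "(\<Sum>h\<in>\<Phi>. \<phi> (lshift h x) - \<phi> (lshift h (swap g x))) \<le> D" if "g \<in> C" "x \<in> occ g v" for g x
      by (rule insert.prems(3)[OF insertI2[OF that(1)] that(2)])
  qed
  then obtain N where N: "shift_measure N X"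
    and HE: "pattern_entropy M \<Phi> + shift_energy M \<phi> \<Phi> + real (card C) * (e * p * (ln \<tau> - D))
      \<le> pattern_entropy N \<Phi> + shift_energy N \<phi> \<Phi>"
    and marg': "\<forall>g. (\<forall>g'\<in>C. (+) g ` F \<inter> (+) g' ` F = {}) \<longrightarrow> measure N (occ g v) = p \<and> measure N (occ g w) = q"
    by (elim exE conjE)

  interpret N: shift_measure N X by (rule N)
  interpret N: swap_measure N X F v w by unfold_locales (rule shift_X)
  have "\<forall>g'\<in>C. (+) g ` F \<inter> (+) g' ` F = {}"
  proof
    fix g' assume g': "g' \<in> C"
    then have "g \<noteq> g'" using insert.hyps(2) by metis
    then show "(+) g ` F \<inter> (+) g' ` F = {}" by (rule insert.prems(2)[OF insertI1 insertI2[OF g']])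
  qed
  then have "measure N (occ g v) = p \<and> measure N (occ g w) = q" by (rule marg'[THEN spec, THEN mp])
  then have pq: "measure N (occ g v) = p" "measure N (occ g w) = q" by (rule conjunct1, rule conjunct2)
  \<comment> \<open>A fresh Bernoulli choice on top of \<open>N\<close>, independent of the choices
    already made.\<close>
  let ?N = "N.swapped e g"
  have "pattern_entropy N \<Phi> + e * p * ln \<tau> \<le> pattern_entropy ?N \<Phi>"
    using N.pattern_entropy_swapped[OF e \<Phi> insert.prems(1)[OF insertI1] \<tau>] le by (simp add: pq)
  moreover have "shift_energy N \<phi> \<Phi> - e * p * D \<le> shift_energy ?N \<phi> \<Phi>"
  proof -
    have "shift_energy N \<phi> \<Phi> - e * measure N (occ g v) * D
        \<le> shift_energy ?N \<phi> \<Phi>"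
      by (rule N.energy_swapped[OF e \<phi> \<Phi>]) (rule insert.prems(3)[OF insertI1])
    then show ?thesis by (simp only: pq)
  qed
  moreover have "real (card (insert g C)) * (e * p * (ln \<tau> - D))
      = real (card C) * (e * p * (ln \<tau> - D)) + e * p * ln \<tau> - e * p * D"
    using insert.hyps by (simp add: algebra_simps)
  ultimately have "pattern_entropy M \<Phi> + shift_energy M \<phi> \<Phi> + real (card (insert g C)) * (e * p * (ln \<tau> - D))
      \<le> pattern_entropy ?N \<Phi> + shift_energy ?N \<phi> \<Phi>"
    using HE by linarith
  moreover have "measure ?N (occ g' v) = p \<and> measure ?N (occ g' w) = q"
    if "\<forall>k\<in>insert g C. (+) g' ` F \<inter> (+) k ` F = {}" for g'
  proof -
    have "(+) g' ` F \<inter> (+) g ` F = {}" using that by blast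
    moreover have "\<forall>k\<in>C. (+) g' ` F \<inter> (+) k ` F = {}" using that by simp
    then have "measure N (occ g' v) = p \<and> measure N (occ g' w) = q" by (rule marg'[THEN spec, THEN mp])
    ultimately show ?thesis by (simp only: N.swapped_occ[OF e])
  qed
  ultimately show ?case
    by (intro exI[of _ ?N] conjI allI impI N.shift_measure_swapped) blast+
qed

end

subsection \<open>Summable variation\<close>

lemma variation_ge:
  fixes X :: "('g \<Rightarrow> 'a::{finite, discrete_topology}) set"
  assumes "closed X" "continuous_on X \<phi>" "x \<in> X" "y \<in> X" "\<forall>g\<in>E. x g = y g"
  shows "\<bar>\<phi> x - \<phi> y\<bar> \<le> variation X \<phi> E"
proof -
  let ?S = "{\<phi> x - \<phi> y |x y. x \<in> X \<and> y \<in> X \<and> restrict x E = restrict y E}"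
  have "bounded (\<phi> ` X)"
    by (intro compact_imp_bounded compact_continuous_image assms compact_closed_fun)
  then obtain B where B: "\<forall>x\<in>X. \<bar>\<phi> x\<bar> \<le> B" by (auto simp: bounded_iff)
  have bdd: "bdd_above ?S"
  proof (rule bdd_aboveI[of _ "2 * B"])
    fix s assume "s \<in> ?S"
    then obtain a b where ab: "s = \<phi> a - \<phi> b" "a \<in> X" "b \<in> X" by blast
    then have "\<bar>\<phi> a\<bar> \<le> B" "\<bar>\<phi> b\<bar> \<le> B" using B by blast+
    then show "s \<le> 2 * B" unfolding ab(1) by linarith
  qed
  have r: "restrict x E = restrict y E" using assms(5) by (simp only: restrict_eq_iff)
  have "\<phi> x - \<phi> y \<in> ?S" "\<phi> y - \<phi> x \<in> ?S"
    using assms(3,4) r r[symmetric] by blast+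
  then have "\<phi> x - \<phi> y \<le> Sup ?S" "\<phi> y - \<phi> x \<le> Sup ?S"
    using bdd by (auto intro: cSup_upper)
  then show ?thesis unfolding variation_def by linarith
qed

text \<open>A finite set lies in some \<open>E n\<close>, whose sum is bounded layer by layer. The
  set \<open>E 0\<close> belongs to no layer and enters as a separate finite sum.\<close>

lemma summable_on_UNIV_by_layers:
  fixes d :: "'b \<Rightarrow> real" and E :: "nat \<Rightarrow> 'b set"
  assumes E: "\<And>n. finite (E n)" "incseq E" "(\<Union>n. E n) = UNIV"
    and d0: "\<And>k. 0 \<le> d k" and layer: "\<And>n k. k \<in> E (Suc n) - E n \<Longrightarrow> d k \<le> a n"
    and a: "summable (\<lambda>n. real (card (E (Suc n) - E n)) * a n)" "\<And>n. 0 \<le> a n"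
  shows "d summable_on UNIV"
proof (rule nonneg_bdd_above_summable_on)
  let ?b = "\<lambda>n. real (card (E (Suc n) - E n)) * a n"
  have bound: "sum d (E n) \<le> sum d (E 0) + sum ?b {..<n}" for n
  proof (induction n)
    case (Suc n)
    have sub: "E n \<subseteq> E (Suc n)" using E(2) by (simp add: incseq_SucD)
    have "sum d (E (Suc n)) = sum d (E (Suc n) - E n) + sum d (E n)"
      by (rule sum.subset_diff[OF sub E(1)])
    also have "sum d (E (Suc n) - E n) \<le> ?b n" by (rule sum_bounded_above) (rule layer)
    finally show ?case using Suc by simp
  qed simp
  show "bdd_above (sum d ` {S. S \<subseteq> UNIV \<and> finite S})"
  proof (rule bdd_aboveI2)
    fix S :: "'b set" assume "S \<in> {S. S \<subseteq> UNIV \<and> finite S}"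
    then have "finite S" by blast
    have "S \<subseteq> (\<Union>n. E n)" using E(3) by simp
    then obtain n where n: "S \<subseteq> E n"
    proof -
      have "\<forall>s\<in>S. \<exists>n. s \<in> E n" using \<open>S \<subseteq> (\<Union>n. E n)\<close> by blast
      then obtain f where f: "\<forall>s\<in>S. s \<in> E (f s)" by metis
      obtain m where m: "\<And>s. s \<in> S \<Longrightarrow> f s \<le> m"
        using finite_nat_set_iff_bounded_le[of "f ` S"] \<open>finite S\<close> by blast
      have "S \<subseteq> E m"
      proof
        fix s assume "s \<in> S"
        then show "s \<in> E m" using f incseqD[OF E(2) m[OF \<open>s \<in> S\<close>]] by blast
      qed
      then show ?thesis by (rule that)
    qed
    have "sum d S \<le> sum d (E n)" using n E(1) d0 by (intro sum_mono2) auto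
    also have "\<dots> \<le> sum d (E 0) + sum ?b {..<n}" by (rule bound)
    also have "sum ?b {..<n} \<le> suminf ?b" using a by (intro sum_le_suminf) auto
    finally show "sum d S \<le> sum d (E 0) + suminf ?b" by simp
  qed
qed (rule d0)

text \<open>If \<open>x\<close> and \<open>y\<close> differ only on \<open>F\<close>, their shifts
  by \<open>g\<close> agree on \<open>E n\<close> unless some \<open>k\<close> in \<open>E n\<close>
  has \<open>g + k = f\<close> in \<open>F\<close>, that is \<open>- k = - f + g\<close>. So the
  variation over \<open>E n\<close> bounds the difference as soon as no \<open>- f + g\<close> lies
  in the inverse of \<open>E n\<close>; this explains the inverses in the definition of summable
  variation.\<close>

lemma summable_variation_bound:
  fixes X :: "('g::{group_add, countable} \<Rightarrow> 'a::{finite, discrete_topology}) set"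
  assumes X: "subshift X" and \<phi>: "\<phi> \<in> summable_variation X" and F: "finite F" "F \<noteq> {}"
  obtains c where "c summable_on UNIV"
    "\<forall>x\<in>X. \<forall>y\<in>X. (\<forall>h. h \<notin> F \<longrightarrow> x h = y h) \<longrightarrow> (\<forall>g. \<bar>\<phi> (lshift g x) - \<phi> (lshift g y)\<bar> \<le> c g)"
proof (cases "X = {}")
  case True
  then show ?thesis using that[of "\<lambda>_. 0"] by simp
next
  case False
  then obtain z where z: "z \<in> X" by blast
  have cX: "closed X" using X by (simp add: subshift_def)
  have cont: "continuous_on X \<phi>" using \<phi> by (simp add: summable_variation_def)
  obtain E where E: "exhaustive E"
    and sm: "summable (\<lambda>n. real (card (uminus ` E (Suc n) - uminus ` E n)) * variation X \<phi> (E n))"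
    using \<phi> by (auto simp: summable_variation_def)
  define E' where "E' n = uminus ` E n" for n
  have E'1: "finite (E' n)" for n using E by (simp add: exhaustive_def E'_def)
  have E'2: "incseq E'" using E unfolding exhaustive_def E'_def incseq_def by (meson image_mono)
  have mem: "k \<in> E' n \<longleftrightarrow> - k \<in> E n" for k n
  proof
    assume "- k \<in> E n"
    then have "- (- k) \<in> E' n" unfolding E'_def by (rule imageI)
    then show "k \<in> E' n" by simp
  qed (auto simp: E'_def)
  have ex: "\<exists>n. k \<in> E' n" for k
  proof -
    have "- k \<in> (\<Union>n. E n)" using E by (simp add: exhaustive_def)
    then show ?thesis using mem by blast
  qed
  then have E'3: "(\<Union>n. E' n) = UNIV" by blast
  define V where "V n = variation X \<phi> (E n)" for n
  have V0: "0 \<le> V n" for n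
    using variation_ge[OF cX cont z z, of "E n"] by (simp add: V_def)
  define B where "B = variation X \<phi> {}"
  have B0: "0 \<le> B" using variation_ge[OF cX cont z z, of "{}"] by (simp add: B_def)
  define lev where "lev k = (LEAST n. k \<in> E' n)" for k
  have lev: "k \<in> E' (lev k)" for k unfolding lev_def by (rule LeastI_ex[OF ex])
  have lev_le: "lev k \<le> n" if "k \<in> E' n" for k n unfolding lev_def using that by (rule Least_le)
  \<comment> \<open>First appearance in layer \<open>Suc n\<close> means absence from
    \<open>E' n\<close>, hence agreement on \<open>E n\<close>. At level 0 nothing is known and the
    total oscillation \<open>B\<close> is used.\<close>
  define d where "d k = (case lev k of 0 \<Rightarrow> B | Suc n \<Rightarrow> V n)" for k
  have d0: "0 \<le> d k" for k using V0 B0 by (simp add: d_def split: nat.split)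
  have "d summable_on UNIV"
  proof (rule summable_on_UNIV_by_layers[OF E'1 E'2 E'3 d0])
    show "summable (\<lambda>n. real (card (E' (Suc n) - E' n)) * V n)" using sm by (simp add: E'_def V_def)
    show "0 \<le> V n" for n by (rule V0)
    fix n k assume k: "k \<in> E' (Suc n) - E' n"
    have "lev k \<noteq> m" if "m \<le> n" for m
      using lev[of k] incseqD[OF E'2 that] k by blast
    then have "lev k = Suc n" using lev_le[of k "Suc n"] k by (metis DiffD1 le_SucE order_refl)
    then show "d k \<le> V n" by (simp add: d_def)
  qed
  moreover have "bij_betw (\<lambda>g. - f + g) UNIV UNIV" for f :: 'g
    by (rule bij_betwI[where g="\<lambda>g. f + g"]) auto
  ultimately have tr: "(\<lambda>g. d (- f + g)) summable_on UNIV" for f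
    using summable_on_reindex_bij_betw[of "\<lambda>g. - f + g" UNIV UNIV d] by simp
  have c: "(\<lambda>g. \<Sum>f\<in>F. d (- f + g)) summable_on UNIV"
    using F(1) by (induction F rule: finite_induct) (simp_all add: summable_on_add tr)
  have "\<bar>\<phi> (lshift g x) - \<phi> (lshift g y)\<bar> \<le> (\<Sum>f\<in>F. d (- f + g))"
    if x: "x \<in> X" and y: "y \<in> X" and xy: "\<And>h. h \<notin> F \<Longrightarrow> x h = y h" for x y g
  proof -
    have sX: "lshift g x \<in> X" "lshift g y \<in> X" using X x y by (auto simp: subshift_def)
    \<comment> \<open>The element \<open>- f + g\<close> of smallest level is the first to appear
      and determines the bound; the sum over \<open>F\<close> then dominates its term without
      depending on which \<open>f\<close> it was.\<close>
    let ?L = "(\<lambda>f. lev (- f + g)) ` F"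
    have "Min ?L \<in> ?L" using F by (intro Min_in) auto
    then obtain f0 where f0: "f0 \<in> F" "Min ?L = lev (- f0 + g)" by blast
    have f0_le: "lev (- f0 + g) \<le> lev (- f + g)" if "f \<in> F" for f
      unfolding f0(2)[symmetric] using F that by (intro Min_le) auto
    have "\<bar>\<phi> (lshift g x) - \<phi> (lshift g y)\<bar> \<le> d (- f0 + g)"
    proof (cases "lev (- f0 + g)")
      case 0
      then show ?thesis using variation_ge[OF cX cont sX, of "{}"] by (simp add: d_def B_def)
    next
      case (Suc n)
      have "lshift g x k = lshift g y k" if k: "k \<in> E n" for k
      proof -
        have "g + k \<notin> F"
        proof
          assume "g + k \<in> F"
          then have "Suc n \<le> lev (- (g + k) + g)" unfolding Suc[symmetric] by (rule f0_le)
          also have "- (g + k) + g = - k" by (simp add: minus_add add.assoc)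
          also have "lev (- k) \<le> n" using k by (intro lev_le) (simp add: mem)
          finally show False by simp
        qed
        then show ?thesis using xy by (simp add: lshift_def)
      qed
      then show ?thesis using variation_ge[OF cX cont sX, of "E n"] Suc by (simp add: d_def V_def)
    qed
    also have "\<dots> \<le> (\<Sum>f\<in>F. d (- f + g))"
      using f0(1) F(1) d0 by (intro member_le_sum[of f0 F "\<lambda>f. d (- f + g)"]) auto
    finally show ?thesis .
  qed
  then show ?thesis using that[OF c] by blast
qed

text \<open>\<open>K\<close> depends on the majorant \<open>c\<close> alone, so it serves all
  configurations at once: the tail of \<open>d\<close> is at least minus the tail of
  \<open>c\<close>.\<close>

lemma uniform_tail_bound:
  fixes c :: "'b \<Rightarrow> real"
  assumes c: "c summable_on UNIV" and "0 < \<kappa>"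
  obtains K where "finite K"
    "\<forall>B d. finite B \<longrightarrow> K \<subseteq> B \<longrightarrow> (\<forall>g. \<bar>d g\<bar> \<le> c g) \<longrightarrow> sum d B \<le> infsum d UNIV + \<kappa>"
proof -
  have "(sum c \<longlongrightarrow> infsum c UNIV) (finite_subsets_at_top UNIV)"
    using has_sum_infsum[OF c] by (simp add: has_sum_def)
  then have "eventually (\<lambda>B. infsum c UNIV - \<kappa> < sum c B) (finite_subsets_at_top UNIV)"
    using \<open>0 < \<kappa>\<close> by (intro order_tendstoD(1)) auto
  then obtain K where K: "finite K" "\<And>B. finite B \<Longrightarrow> K \<subseteq> B \<Longrightarrow> infsum c UNIV - \<kappa> < sum c B"
    by (auto simp: eventually_finite_subsets_at_top)
  have "sum d B \<le> infsum d UNIV + \<kappa>" if B: "finite B" "K \<subseteq> B" and d: "\<forall>g. \<bar>d g\<bar> \<le> c g" for B d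
  proof -
    have dU: "d summable_on UNIV"
    proof -
      have "(\<lambda>g. norm (d g)) summable_on UNIV"
        by (rule Infinite_Sum.abs_summable_on_comparison_test'[OF c]) (use d in auto)
      then show ?thesis by (rule Infinite_Sum.abs_summable_summable)
    qed
    have dB: "d summable_on - B" and cB: "c summable_on - B"
      using summable_on_subset_banach[OF dU] summable_on_subset_banach[OF c] by auto
    have spl: "infsum f UNIV = sum f B + infsum f (- B)" if "f summable_on UNIV" for f :: "'b \<Rightarrow> real"
      using infsum_Un_disjoint[of f B "- B"] B(1) that summable_on_subset_banach[OF that, of "- B"]
      by (simp add: Compl_partition)
    have "- infsum c (- B) = infsum (\<lambda>g. - c g) (- B)" by (simp add: infsum_uminus)
    also have "\<dots> \<le> infsum d (- B)"
    proof (rule infsum_mono)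
      show "(\<lambda>g. - c g) summable_on - B" using cB by (simp add: summable_on_uminus)
      show "- c x \<le> d x" for x using d[rule_format, of x] by linarith
    qed (rule dB)
    finally have "- infsum c (- B) \<le> infsum d (- B)" .
    moreover have "infsum c (- B) < \<kappa>" using spl[OF c] K(2)[OF B] by linarith
    ultimately show ?thesis using spl[OF dU] by linarith
  qed
  then show ?thesis using that[OF K(1)] by blast
qed

subsection \<open>Separated sites in a Folner set\<close>

lemma maximal_independent_subset:
  assumes "finite I" and refl: "\<And>i. R i i" and sym: "\<And>i j. R i j \<Longrightarrow> R j i"
  shows "\<exists>C\<subseteq>I. (\<forall>i\<in>C. \<forall>j\<in>C. i \<noteq> j \<longrightarrow> \<not> R i j) \<and> (\<forall>i\<in>I. \<exists>j\<in>C. R i j)"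
  using assms(1)
proof (induction I rule: finite_induct)
  case (insert i I)
  from insert.IH obtain C
    where C: "C \<subseteq> I" "\<forall>i\<in>C. \<forall>j\<in>C. i \<noteq> j \<longrightarrow> \<not> R i j" "\<forall>i\<in>I. \<exists>j\<in>C. R i j"
    by (elim exE conjE)
  show ?case
  proof (cases "\<exists>j\<in>C. R i j")
    case True
    show ?thesis
    proof (intro exI[of _ C] conjI)
      show "C \<subseteq> insert i I" using C(1) by (rule subset_insertI2)
      show "\<forall>k\<in>insert i I. \<exists>j\<in>C. R k j" using C(3) True by simp
    qed (rule C(2))
  next
    case False
    show ?thesis
    proof (intro exI[of _ "insert i C"] conjI)
      show "insert i C \<subseteq> insert i I" using C(1) by (rule Set.insert_mono)
      show "\<forall>k\<in>insert i C. \<forall>j\<in>insert i C. k \<noteq> j \<longrightarrow> \<not> R k j"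
        using C(2) False sym by (metis insert_iff)
      show "\<forall>k\<in>insert i I. \<exists>j\<in>insert i C. R k j" using C(3) refl by (metis insert_iff)
    qed
  qed
qed simp

text \<open>In a maximal family with disjoint windows every \<open>g\<close> in \<open>I\<close>
  conflicts with some member \<open>c\<close>, so \<open>g = c + f - f'\<close>. Each
  \<open>c\<close> thus accounts for at most \<open>card F * card F\<close> points of
  \<open>I\<close>.\<close>

lemma separated_subset:
  fixes F :: "'g::group_add set"
  assumes "finite I" "finite F" "F \<noteq> {}"
  obtains C where "C \<subseteq> I" "\<forall>g\<in>C. \<forall>g'\<in>C. g \<noteq> g' \<longrightarrow> (+) g ` F \<inter> (+) g' ` F = {}"
    "card I \<le> card C * (card F * card F)"
proof -
  define R where "R g g' \<longleftrightarrow> (+) g ` F \<inter> (+) g' ` F \<noteq> {}" for g g'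
  have R: "R g g" "R g g' \<Longrightarrow> R g' g" for g g'
    using assms(3) by (simp_all add: R_def Int_commute)
  obtain C where C: "C \<subseteq> I" "\<forall>g\<in>C. \<forall>g'\<in>C. g \<noteq> g' \<longrightarrow> \<not> R g g'" "\<forall>g\<in>I. \<exists>g'\<in>C. R g g'"
    using maximal_independent_subset[of I R, OF assms(1) R] by blast
  have sep: "\<forall>g\<in>C. \<forall>g'\<in>C. g \<noteq> g' \<longrightarrow> (+) g ` F \<inter> (+) g' ` F = {}"
    using C(2) unfolding R_def by metis
  have fC: "finite C" using C(1) assms(1) by (rule finite_subset)
  have "I \<subseteq> (\<lambda>(c, f, f'). c + f - f') ` (C \<times> F \<times> F)"
  proof
    fix g assume "g \<in> I"
    then obtain c f f' where cf: "c \<in> C" "f \<in> F" "f' \<in> F" "g + f' = c + f" using C(3) unfolding R_def by blast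
    then have "g = c + f - f'" by (simp add: eq_diff_eq)
    then show "g \<in> (\<lambda>(c, f, f'). c + f - f') ` (C \<times> F \<times> F)" using cf by force
  qed
  then have "card I \<le> card ((\<lambda>(c, f, f'). c + f - f') ` (C \<times> F \<times> F))"
    using fC assms(2) by (intro card_mono) auto
  also have "\<dots> \<le> card (C \<times> F \<times> F)" using fC assms(2) by (intro card_image_le) auto
  finally have "card I \<le> card C * (card F * card F)" by (simp add: card_cartesian_product)
  then show ?thesis by (rule that[OF C(1) sep])
qed

text \<open>Points with \<open>g + k\<close> outside \<Phi> are counted by the part of the right
  translate of \<Phi> by \<open>k\<close> outside \<Phi>. The factor 2 stands for any fixed positive
  proportion.\<close>

lemma folner_interior:
  fixes K :: "'g::group_add set"
  assumes \<Phi>: "folner_seq \<Phi>" and K: "finite K"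
  shows "eventually (\<lambda>n. real (card (\<Phi> n)) \<le> 2 * real (card {g \<in> \<Phi> n. (+) g ` K \<subseteq> \<Phi> n})) sequentially"
proof -
  have fin: "finite (\<Phi> n)" "\<Phi> n \<noteq> {}" for n using \<Phi> by (auto simp: folner_seq_def)
  have "(\<lambda>n. \<Sum>k\<in>K. real (card ((\<lambda>h. h + k) ` \<Phi> n - \<Phi> n)) / real (card (\<Phi> n))) \<longlonglongrightarrow> (\<Sum>k\<in>K. 0)"
    by (intro tendsto_sum folner_seq_diff(1)[OF \<Phi>])
  then have "eventually (\<lambda>n. (\<Sum>k\<in>K. real (card ((\<lambda>h. h + k) ` \<Phi> n - \<Phi> n)) / real (card (\<Phi> n))) < 1 / 2) sequentially"
    by (intro order_tendstoD(2)) auto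
  then show ?thesis
  proof (rule eventually_mono)
    fix n
    assume n: "(\<Sum>k\<in>K. real (card ((\<lambda>h. h + k) ` \<Phi> n - \<Phi> n)) / real (card (\<Phi> n))) < 1 / 2"
    let ?I = "{g \<in> \<Phi> n. (+) g ` K \<subseteq> \<Phi> n}"
    have pos: "0 < real (card (\<Phi> n))" using fin[of n] by (simp add: card_gt_0_iff)
    have "\<Phi> n - ?I \<subseteq> (\<Union>k\<in>K. {g \<in> \<Phi> n. g + k \<notin> \<Phi> n})"
    proof
      fix g assume "g \<in> \<Phi> n - ?I"
      then have "g \<in> \<Phi> n" "\<not> (+) g ` K \<subseteq> \<Phi> n" by simp_all
      then show "g \<in> (\<Union>k\<in>K. {g \<in> \<Phi> n. g + k \<notin> \<Phi> n})" by blast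
    qed
    moreover have "finite (\<Union>k\<in>K. {g \<in> \<Phi> n. g + k \<notin> \<Phi> n})"
      by (rule finite_subset[OF _ fin(1)[of n]]) blast
    ultimately have "card (\<Phi> n - ?I) \<le> card (\<Union>k\<in>K. {g \<in> \<Phi> n. g + k \<notin> \<Phi> n})"
      by (intro card_mono)
    also have "\<dots> \<le> (\<Sum>k\<in>K. card {g \<in> \<Phi> n. g + k \<notin> \<Phi> n})" by (rule card_UN_le[OF K])
    also have "\<dots> \<le> (\<Sum>k\<in>K. card ((\<lambda>h. h + k) ` \<Phi> n - \<Phi> n))"
    proof (rule sum_mono)
      fix k
      have "card {g \<in> \<Phi> n. g + k \<notin> \<Phi> n} = card ((\<lambda>h. h + k) ` {g \<in> \<Phi> n. g + k \<notin> \<Phi> n})"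
        by (rule card_image[symmetric]) (simp add: inj_on_def)
      also have "\<dots> \<le> card ((\<lambda>h. h + k) ` \<Phi> n - \<Phi> n)"
      proof (rule card_mono)
        show "finite ((\<lambda>h. h + k) ` \<Phi> n - \<Phi> n)" using fin(1)[of n] by simp
        show "(\<lambda>h. h + k) ` {g \<in> \<Phi> n. g + k \<notin> \<Phi> n} \<subseteq> (\<lambda>h. h + k) ` \<Phi> n - \<Phi> n" by blast
      qed
      finally show "card {g \<in> \<Phi> n. g + k \<notin> \<Phi> n} \<le> card ((\<lambda>h. h + k) ` \<Phi> n - \<Phi> n)" .
    qed
    finally have "real (card (\<Phi> n - ?I)) \<le> real (\<Sum>k\<in>K. card ((\<lambda>h. h + k) ` \<Phi> n - \<Phi> n))"
      by (rule of_nat_mono)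
    then have "real (card (\<Phi> n - ?I)) \<le> (\<Sum>k\<in>K. real (card ((\<lambda>h. h + k) ` \<Phi> n - \<Phi> n)))"
      by (simp only: of_nat_sum)
    also have "\<dots> < real (card (\<Phi> n)) / 2"
      using n pos unfolding sum_divide_distrib[symmetric] by (simp add: field_simps)
    finally have "real (card (\<Phi> n - ?I)) < real (card (\<Phi> n)) / 2" .
    moreover have "finite ?I" by (rule finite_subset[OF _ fin(1)[of n]]) blast
    then have "card (\<Phi> n - ?I) = card (\<Phi> n) - card ?I" by (rule card_Diff_subset) blast
    moreover have "card ?I \<le> card (\<Phi> n)" by (rule card_mono[OF fin(1)]) blast
    ultimately show "real (card (\<Phi> n)) \<le> 2 * real (card ?I)" by (simp add: of_nat_diff)
  qed
qed

subsection \<open>The inequality for distinct patterns\<close>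

context pattern_pair
begin

text \<open>At least half of \<Phi> is interior, and disjointness of windows costs a further factor
  \<open>card F * card F\<close>, whence the denominator of the total gain.\<close>

lemma folner_swaps:
  fixes \<phi> :: "('g \<Rightarrow> 'a) \<Rightarrow> real"
  assumes M: "shift_measure M X" and \<phi>: "continuous_on X \<phi>"
    and p: "\<And>g. measure M (occ g v) = p" and q: "\<And>g. measure M (occ g w) = q"
    and e: "0 < e" "e < 1" and \<tau>: "0 < \<tau>" and le: "\<tau> * (q + e * p) \<le> (1 - e) * p"
    and \<Phi>: "finite \<Phi>" and K: "F \<subseteq> K"
    and D: "\<And>g x. (+) g ` K \<subseteq> \<Phi> \<Longrightarrow> x \<in> occ g v \<Longrightarrow> (\<Sum>h\<in>\<Phi>. \<phi> (lshift h x) - \<phi> (lshift h (swap g x))) \<le> D"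
    and interior: "real (card \<Phi>) \<le> 2 * real (card {g \<in> \<Phi>. (+) g ` K \<subseteq> \<Phi>})"
    and gain: "0 \<le> e * p * (ln \<tau> - D)"
  shows "\<exists>N. shift_measure N X
    \<and> pattern_entropy M \<Phi> + shift_energy M \<phi> \<Phi>
        + real (card \<Phi>) * (e * p * (ln \<tau> - D) / (2 * (real (card F) * real (card F))))
      \<le> pattern_entropy N \<Phi> + shift_energy N \<phi> \<Phi>"
proof -
  note F = F_nonempty
  let ?I = "{g \<in> \<Phi>. (+) g ` K \<subseteq> \<Phi>}"
  let ?f = "real (card F) * real (card F)"
  have fI: "finite ?I" by (rule finite_subset[OF _ \<Phi>]) blast
  obtain C where C: "C \<subseteq> ?I" "\<forall>g\<in>C. \<forall>g'\<in>C. g \<noteq> g' \<longrightarrow> (+) g ` F \<inter> (+) g' ` F = {}"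
    "card ?I \<le> card C * (card F * card F)"
    by (rule separated_subset[OF fI finite_F F])
  have fC: "finite C" by (rule finite_subset[OF C(1) fI])
  have CK: "(+) g ` K \<subseteq> \<Phi>" if "g \<in> C" for g using C(1) that by (metis (no_types, lifting) mem_Collect_eq subsetD)
  have "\<exists>N. shift_measure N X
    \<and> pattern_entropy M \<Phi> + shift_energy M \<phi> \<Phi> + real (card C) * (e * p * (ln \<tau> - D))
      \<le> pattern_entropy N \<Phi> + shift_energy N \<phi> \<Phi>
    \<and> (\<forall>g. (\<forall>g'\<in>C. (+) g ` F \<inter> (+) g' ` F = {}) \<longrightarrow> measure N (occ g v) = p \<and> measure N (occ g w) = q)"
  proof (rule swap_iterate[OF M \<phi> p q e \<tau> le \<Phi> fC])
    show "(+) g ` F \<subseteq> \<Phi>" if "g \<in> C" for g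
      by (rule subset_trans[OF image_mono[OF K] CK[OF that]])
    show "(+) g ` F \<inter> (+) g' ` F = {}" if "g \<in> C" "g' \<in> C" "g \<noteq> g'" for g g'
      using C(2)[rule_format, OF that] .
    show "(\<Sum>h\<in>\<Phi>. \<phi> (lshift h x) - \<phi> (lshift h (swap g x))) \<le> D" if "g \<in> C" "x \<in> occ g v" for g x
      by (rule D[OF CK[OF that(1)] that(2)])
  qed
  then obtain N where N: "shift_measure N X"
    and HE: "pattern_entropy M \<Phi> + shift_energy M \<phi> \<Phi> + real (card C) * (e * p * (ln \<tau> - D))
      \<le> pattern_entropy N \<Phi> + shift_energy N \<phi> \<Phi>"
    by (elim exE conjE)
  have f: "0 < ?f" using F finite_F by (simp add: card_gt_0_iff)
  have "real (card ?I) \<le> real (card C) * ?f"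
    using of_nat_mono[OF C(3), where 'a=real] by simp
  then have "real (card \<Phi>) \<le> real (card C) * (2 * ?f)" using interior by simp
  then have "real (card \<Phi>) * (e * p * (ln \<tau> - D)) \<le> (real (card C) * (2 * ?f)) * (e * p * (ln \<tau> - D))"
    using gain by (rule mult_right_mono)
  then have "real (card \<Phi>) * (e * p * (ln \<tau> - D)) / (2 * ?f) \<le> real (card C) * (e * p * (ln \<tau> - D))"
    using f by (simp add: pos_divide_le_eq mult_ac)
  then have "real (card \<Phi>) * (e * p * (ln \<tau> - D) / (2 * ?f)) \<le> real (card C) * (e * p * (ln \<tau> - D))"
    by simp
  with HE N show ?thesis by (intro exI[of _ N] conjI) auto
qed

text \<open>Substituting \<open>h = g + k\<close> turns the energy change on \<Phi> into a partial
  sum of the series at \<open>lshift g x\<close>, over a set that contains \<open>K\<close>.\<close>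

lemma swap_energy_le:
  fixes \<phi> :: "('g \<Rightarrow> 'a) \<Rightarrow> real"
  assumes \<Phi>: "finite \<Phi>" "(+) g ` K \<subseteq> \<Phi>" and x: "x \<in> occ g v"
    and tail: "\<And>B. finite B \<Longrightarrow> K \<subseteq> B
      \<Longrightarrow> (\<Sum>k\<in>B. \<phi> (lshift k (lshift g x)) - \<phi> (lshift k (pattern_swap X F v w (lshift g x)))) \<le> D"
  shows "(\<Sum>h\<in>\<Phi>. \<phi> (lshift h x) - \<phi> (lshift h (swap g x))) \<le> D"
proof -
  let ?B = "(\<lambda>h. - g + h) ` \<Phi>"
  have xr: "restrict (lshift g x) F = v" and xX: "lshift g x \<in> X" using x lshift_X by blast+
  have "(\<Sum>h\<in>\<Phi>. \<phi> (lshift h x) - \<phi> (lshift h (swap g x)))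
      = (\<Sum>h\<in>\<Phi>. \<phi> (lshift (- g + h) (lshift g x)) - \<phi> (lshift (- g + h) (lshift g (swap g x))))"
    by (simp add: lshift_lshift)
  also have "\<dots> = (\<Sum>k\<in>?B. \<phi> (lshift k (lshift g x)) - \<phi> (lshift k (lshift g (swap g x))))"
    by (subst sum.reindex) (auto simp: inj_on_def)
  also have "lshift g (swap g x) = pattern_swap X F v w (lshift g x)"
    unfolding lshift_swap_at[OF xr] glue_in(2)[OF xX xr] ..
  also have "(\<Sum>k\<in>?B. \<phi> (lshift k (lshift g x)) - \<phi> (lshift k (pattern_swap X F v w (lshift g x)))) \<le> D"
  proof (rule tail)
    show "K \<subseteq> ?B"
    proof
      fix k assume "k \<in> K"
      then have "g + k \<in> \<Phi>" using \<Phi>(2) by blast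
      then show "k \<in> ?B" by (rule rev_image_eqI) (simp add: add.assoc[symmetric])
    qed
  qed (simp add: \<Phi>(1))
  finally show ?thesis .
qed

lemma pattern_measure_le:
  fixes \<phi> :: "('g \<Rightarrow> 'a) \<Rightarrow> real"
  assumes am: "amenable TYPE('g)" and \<phi>: "\<phi> \<in> summable_variation X" and eq: "equilibrium_state X \<phi> \<mu>"
  shows "measure \<mu> (cylinder X F v) \<le> measure \<mu> (cylinder X F w) *
    (SUP x\<in>cylinder X F v.
       exp (\<Sum>\<^sub>\<infinity>g\<in>UNIV. \<phi> (lshift g x) - \<phi> (lshift g (pattern_swap X F v w x))))"
proof (rule ccontr)
  define d where "d y = (\<lambda>g. \<phi> (lshift g y) - \<phi> (lshift g (pattern_swap X F v w y)))" for y
  define T where "T y = infsum (d y) UNIV" for y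
  define S where "S = (SUP x\<in>cylinder X F v. exp (T x))"
  define p where "p = measure \<mu> (cylinder X F v)"
  define q where "q = measure \<mu> (cylinder X F w)"
  assume "\<not> ?thesis"
  then have pq: "q * S < p" unfolding p_def q_def S_def T_def d_def by (rule not_le_imp_less)
  have \<phi>c: "continuous_on X \<phi>" using \<phi> by (simp add: summable_variation_def)
  interpret \<mu>: invariant_measure \<mu> X
    using eq invariant_measures_iff[OF shift_X] by (simp add: equilibrium_state_def)
  note F = F_nonempty
  obtain c where c: "c summable_on UNIV"
    and cb: "\<forall>x\<in>X. \<forall>y\<in>X. (\<forall>h. h \<notin> F \<longrightarrow> x h = y h) \<longrightarrow> (\<forall>g. \<bar>\<phi> (lshift g x) - \<phi> (lshift g y)\<bar> \<le> c g)"
    by (rule summable_variation_bound[OF shift_X \<phi> finite_F F])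
  have dc: "\<forall>g. \<bar>d y g\<bar> \<le> c g" if y: "y \<in> cylinder X F v" for y
  proof -
    have y': "y \<in> X" "restrict y F = v" using y by (simp_all add: cylinder_def)
    have "y h = pattern_swap X F v w y h" if "h \<notin> F" for h
      using that by (simp add: glue_in(2)[OF y'] glue_def)
    moreover have "pattern_swap X F v w y \<in> X" using glue_in(1,2)[OF y'] by simp
    ultimately show ?thesis using cb y'(1) unfolding d_def by blast
  qed
  have T_le: "T y \<le> infsum c UNIV" if y: "y \<in> cylinder X F v" for y
  proof -
    have "(\<lambda>g. norm (d y g)) summable_on UNIV"
      by (rule Infinite_Sum.abs_summable_on_comparison_test'[OF c]) (use dc[OF y] in auto)
    then have "d y summable_on UNIV" by (rule Infinite_Sum.abs_summable_summable)
    moreover have "d y g \<le> c g" for g using dc[OF y, rule_format, of g] by linarith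
    ultimately show ?thesis unfolding T_def using c by (intro infsum_mono) auto
  qed
  \<comment> \<open>The real supremum bounds its members only for a set that is bounded
    above.\<close>
  have bdd: "bdd_above ((\<lambda>x. exp (T x)) ` cylinder X F v)"
    by (rule bdd_aboveI2[where M="exp (infsum c UNIV)"]) (simp add: T_le)
  have S_ge: "exp (T y) \<le> S" if "y \<in> cylinder X F v" for y
    unfolding S_def using that bdd by (rule cSUP_upper)
  obtain z where "z \<in> X" "v = restrict z F" using v by (auto simp: language_def)
  then have z: "z \<in> cylinder X F v" by (simp add: cylinder_def)
  have S: "0 < S" using S_ge[OF z] exp_gt_zero less_le_trans by blast
  have T_ln: "T y \<le> ln S" if "y \<in> cylinder X F v" for y
    using S_ge[OF that] S by (simp add: ln_ge_iff)
  have q0: "0 \<le> q" by (simp add: q_def)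
  then have p0: "0 < p" using pq S by (meson le_less_trans less_eq_real_def mult_nonneg_nonneg)
  \<comment> \<open>Slightly above \<open>S\<close>, with \<open>\<tau> * q\<close> still below
    \<open>p\<close>; the form \<open>q + 1\<close> covers \<open>q = 0\<close>.\<close>
  define \<tau> where "\<tau> = S + (p - q * S) / (2 * (q + 1))"
  have \<tau>S: "S < \<tau>" using pq q0 by (simp add: \<tau>_def)
  then have \<tau>: "0 < \<tau>" using S by linarith
  have \<tau>q: "\<tau> * q < p"
  proof -
    have "(p - q * S) / (2 * (q + 1)) * q = (p - q * S) * (q / (2 * (q + 1)))" by simp
    also have "\<dots> < (p - q * S) * 1"
      using pq q0 by (intro mult_strict_left_mono) (simp_all add: pos_divide_less_eq)
    finally have "S * q + (p - q * S) / (2 * (q + 1)) * q < p" by (simp add: mult.commute)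
    then show ?thesis by (simp only: \<tau>_def distrib_right)
  qed
  \<comment> \<open>Half of the gap pays for the tails of the energy series, the other half is the
    net gain.\<close>
  define \<kappa> where "\<kappa> = (ln \<tau> - ln S) / 2"
  have \<kappa>: "0 < \<kappa>" using \<tau>S S \<tau> by (simp add: \<kappa>_def)
  define D where "D = ln S + \<kappa>"
  have gap: "ln \<tau> - D = \<kappa>" by (simp add: D_def \<kappa>_def field_simps)
  \<comment> \<open>The solution of \<open>\<tau> * (q + e * p) = (1 - e) * p\<close>.\<close>
  define e where "e = (p - \<tau> * q) / ((\<tau> + 1) * p)"
  have e: "0 < e" "e < 1"
  proof -
    have den: "0 < (\<tau> + 1) * p" using \<tau> p0 by simp
    show "0 < e" using den \<tau>q by (simp add: e_def)
    have "p - \<tau> * q \<le> p" using \<tau> q0 by simp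
    also have "p < (\<tau> + 1) * p" using \<tau> p0 by (simp add: distrib_right)
    finally show "e < 1" using den by (simp add: e_def)
  qed
  have e_eq: "\<tau> * (q + e * p) \<le> (1 - e) * p"
  proof -
    have "e * ((\<tau> + 1) * p) = p - \<tau> * q" using \<tau> p0 by (simp add: e_def)
    then show ?thesis by (simp add: algebra_simps)
  qed
  obtain K0 where K0: "finite K0"
    "\<forall>B d. finite B \<longrightarrow> K0 \<subseteq> B \<longrightarrow> (\<forall>g. \<bar>d g\<bar> \<le> c g) \<longrightarrow> sum d B \<le> infsum d UNIV + \<kappa>"
    by (rule uniform_tail_bound[OF c \<kappa>])
  define K where "K = K0 \<union> F"
  have K: "finite K" "F \<subseteq> K" using K0(1) finite_F by (simp_all add: K_def)
  have energy: "(\<Sum>h\<in>\<Psi>. \<phi> (lshift h x) - \<phi> (lshift h (swap g x))) \<le> D"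
    if "finite \<Psi>" "(+) g ` K \<subseteq> \<Psi>" and x: "x \<in> occ g v" for \<Psi> g x
  proof (rule swap_energy_le[OF that(1,2) x])
    have y: "lshift g x \<in> cylinder X F v" using x lshift_X by (simp add: cylinder_def)
    fix B assume B: "finite B" "K \<subseteq> B"
    then have "sum (d (lshift g x)) B \<le> T (lshift g x) + \<kappa>"
      using K0(2) dc[OF y] unfolding T_def K_def by blast
    then show "(\<Sum>k\<in>B. \<phi> (lshift k (lshift g x)) - \<phi> (lshift k (pattern_swap X F v w (lshift g x)))) \<le> D"
      using T_ln[OF y] unfolding d_def D_def by linarith
  qed
  have occ: "measure \<mu> (occ g u) = measure \<mu> (cylinder X F u)" for g u
  proof -
    have A: "cylinder X F u \<in> sets \<mu>"
      unfolding cylinder_def by (rule \<mu>.clopens_sets[OF clopens_cylinder[OF finite_F]])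
    have "lshift g -` cylinder X F u \<inter> space \<mu> = occ g u"
      using lshift_X by (auto simp: cylinder_def \<mu>.space_M)
    then have "measure (distr \<mu> \<mu> (lshift g)) (cylinder X F u) = measure \<mu> (occ g u)"
      by (simp only: measure_distr[OF \<mu>.measurable_lshift A])
    then show ?thesis by (simp only: \<mu>.invariant)
  qed
  obtain \<Phi> :: "nat \<Rightarrow> 'g set" where \<Phi>: "folner_seq \<Phi>" using am by (auto simp: amenable_def)
  have fin: "finite (\<Phi> n)" "\<Phi> n \<noteq> {}" for n using \<Phi> by (auto simp: folner_seq_def)
  define r where "r = e * p * \<kappa> / (2 * (real (card F) * real (card F)))"
  have r: "0 < r" using e p0 \<kappa> F finite_F by (simp add: r_def card_gt_0_iff)
  \<comment> \<open>The sequence \<open>N\<close> must be defined for all \<open>n\<close>; where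
    the interior is too small, \<mu> itself is an admissible choice.\<close>
  define good where "good n \<longleftrightarrow> real (card (\<Phi> n)) \<le> 2 * real (card {g \<in> \<Phi> n. (+) g ` K \<subseteq> \<Phi> n})" for n
  have "\<exists>N. shift_measure N X \<and> (good n \<longrightarrow>
      pattern_entropy \<mu> (\<Phi> n) + shift_energy \<mu> \<phi> (\<Phi> n) + real (card (\<Phi> n)) * r
      \<le> pattern_entropy N (\<Phi> n) + shift_energy N \<phi> (\<Phi> n))" for n
  proof (cases "good n")
    case True
    have "\<exists>N. shift_measure N X
      \<and> pattern_entropy \<mu> (\<Phi> n) + shift_energy \<mu> \<phi> (\<Phi> n)
          + real (card (\<Phi> n)) * (e * p * (ln \<tau> - D) / (2 * (real (card F) * real (card F))))
        \<le> pattern_entropy N (\<Phi> n) + shift_energy N \<phi> (\<Phi> n)"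
    proof (rule folner_swaps[OF \<mu>.shift_measure_axioms \<phi>c _ _ e \<tau> e_eq fin(1) K(2)])
      show "measure \<mu> (occ g v) = p" "measure \<mu> (occ g w) = q" for g
        unfolding occ p_def q_def by (rule refl)+
      show "real (card (\<Phi> n)) \<le> 2 * real (card {g \<in> \<Phi> n. (+) g ` K \<subseteq> \<Phi> n})"
        using True unfolding good_def .
      show "0 \<le> e * p * (ln \<tau> - D)" unfolding gap using e p0 \<kappa> by simp
    qed (rule energy[OF fin(1)])
    then show ?thesis unfolding gap r_def by blast
  next
    case False
    then show ?thesis using \<mu>.shift_measure_axioms by blast
  qed
  then obtain N where N: "\<And>n. shift_measure (N n) X"
    and HE: "\<And>n. good n \<Longrightarrow> pattern_entropy \<mu> (\<Phi> n) + shift_energy \<mu> \<phi> (\<Phi> n) + real (card (\<Phi> n)) * r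
      \<le> pattern_entropy (N n) (\<Phi> n) + shift_energy (N n) \<phi> (\<Phi> n)"
    by metis
  have "(\<integral>x. \<phi> (lshift h x) \<partial>\<mu>) = integral\<^sup>L \<mu> \<phi>" for h
    using integral_distr[OF \<mu>.measurable_lshift \<mu>.measurable_phi[OF \<phi>c], of h] by (simp only: \<mu>.invariant)
  then have E\<mu>: "shift_energy \<mu> \<phi> (\<Phi> n) = real (card (\<Phi> n)) * integral\<^sup>L \<mu> \<phi>" for n
    by simp
  \<comment> \<open>Valid for every \<open>n\<close> without an error term, because the rate is an
    infimum.\<close>
  have H\<mu>: "real (card (\<Phi> n)) * entropy_rate (pattern_entropy \<mu>) \<le> pattern_entropy \<mu> (\<Phi> n)" for n
    using entropy_rate_le[OF \<mu>.coords.entropy_like_axioms fin, of n] fin[of n]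
    by (simp add: pos_le_divide_eq card_gt_0_iff mult.commute)
  have "eventually (\<lambda>n. real (card (\<Phi> n)) * (entropy_rate (pattern_entropy \<mu>) + integral\<^sup>L \<mu> \<phi> + r)
      \<le> pattern_entropy (N n) (\<Phi> n) + shift_energy (N n) \<phi> (\<Phi> n)) sequentially"
    using folner_interior[OF \<Phi> K(1)]
  proof (rule eventually_mono)
    fix n assume "real (card (\<Phi> n)) \<le> 2 * real (card {g \<in> \<Phi> n. (+) g ` K \<subseteq> \<Phi> n})"
    then have "good n" unfolding good_def .
    from HE[OF this] show "real (card (\<Phi> n)) * (entropy_rate (pattern_entropy \<mu>) + integral\<^sup>L \<mu> \<phi> + r)
      \<le> pattern_entropy (N n) (\<Phi> n) + shift_energy (N n) \<phi> (\<Phi> n)"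
      using H\<mu>[of n] unfolding E\<mu> by (simp only: distrib_left)
  qed
  then show False
    by (rule equilibrium_entropy_bound[OF am shift_X \<phi>c eq \<Phi> N r])
qed

end

theorem theorem1:
  fixes X :: "('g::{group_add, countable} \<Rightarrow> 'a::{finite, discrete_topology}) set"
    and \<phi> :: "('g \<Rightarrow> 'a) \<Rightarrow> real"
    and \<mu> :: "('g \<Rightarrow> 'a) measure"
    and F :: "'g set"
    and v w :: "'g \<Rightarrow> 'a"
  assumes "amenable TYPE('g)"
    and "subshift X"
    and "\<phi> \<in> summable_variation X"
    and "equilibrium_state X \<phi> \<mu>"
    and "finite F"
    and "v \<in> language F X" and "w \<in> language F X"
    and "extender_set X F v \<subseteq> extender_set X F w"
  shows "measure \<mu> (cylinder X F v) \<le> measure \<mu> (cylinder X F w) *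
    (SUP x\<in>cylinder X F v.
       exp (\<Sum>\<^sub>\<infinity>g\<in>UNIV. \<phi> (lshift g x) - \<phi> (lshift g (pattern_swap X F v w x))))"
proof (cases "v = w")
  case True
  \<comment> \<open>For equal patterns the series vanishes, so the supremum is 1 over a cylinder
    that is nonempty because \<open>v\<close> belongs to the language.\<close>
  have swap: "pattern_swap X F v w x = x" if "x \<in> cylinder X F v" for x
  proof -
    have v: "restrict x F = v" using that by (simp add: cylinder_def)
    have "glue F v (restrict x (- F)) = x"
      unfolding v[symmetric] by (auto simp: glue_def fun_eq_iff)
    then show ?thesis using that True by (simp add: pattern_swap_def)
  qed
  obtain z where "z \<in> X" "v = restrict z F" using assms(6) by (auto simp: language_def)
  then have "cylinder X F v \<noteq> {}" by (auto simp: cylinder_def)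
  then have "(SUP x\<in>cylinder X F v.
      exp (\<Sum>\<^sub>\<infinity>g\<in>UNIV. \<phi> (lshift g x) - \<phi> (lshift g (pattern_swap X F v w x)))) = (1::real)"
    using swap by simp
  then show ?thesis using True by simp
next
  case False
  interpret pattern_pair X F v w
    using assms False by unfold_locales
  show ?thesis using assms by (intro pattern_measure_le)
qed

end
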